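(* Let $\Omega\subset\mathbb{R}^d$ be a bounded connected open Lipschitz set, let $p,q>1$, and let $f\in (W^{1,p}(\Omega))^*$ satisfy the compatibility condition $\int_\Omega f\,\mathrm{d}x=0$. For $\alpha>0$ let $$E_\alpha:=\inf\Big\{\tfrac1p\int_\Omega|\nabla u|^p\,\mathrm{d}x+\tfrac{\alpha}{q}\int_{\partial\Omega}|u|^q\,\mathrm{d}S-\int_\Omega fu\,\mathrm{d}x:\ u\in W^{1,p}(\Omega)\Big\},$$ let $$E_0:=\inf\Big\{\tfrac1p\int_\Omega|\nabla u|^p\,\mathrm{d}x-\int_\Omega fu\,\mathrm{d}x:\ u\in W^{1,p}(\Omega),\ \int_{\partial\Omega}|u|^{q-2}u\,\mathrm{d}S=0\Big\},$$ and let $u_0\in W^{1,p}(\Omega)$ be the unique minimizer of $E_0$. Assume that $u_0\in L^q(\partial\Omega)$. Then $$E_\alpha=E_0+\frac{\alpha}{q}\int_{\partial\Omega}|u_0|^q\,\mathrm{d}S+o(\alpha)\qquad\text{as }\alpha\to0^+.$$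
   Context: $\mathrm{d}S$ is the $(d-1)$-dimensional Hausdorff measure on $\partial\Omega$; boundary values of $u\in W^{1,p}(\Omega)$ are traces, and $u_0\in L^q(\partial\Omega)$ means that the trace of $u_0$ belongs to $L^q(\partial\Omega)$. $\int_\Omega fu\,\mathrm{d}x$ denotes the duality pairing $\langle f,u\rangle$, and $\int_\Omega f\,\mathrm{d}x:=\langle f,1\rangle$. In $E_\alpha$ the boundary integral is $+\infty$ if the trace of $u$ is not in $L^q(\partial\Omega)$. In $E_0$ the constraint is understood for $u$ whose trace lies in $L^{q-1}(\partial\Omega)$ (i.e. $\int_{\partial\Omega}|u|^{q-1}\,\mathrm{d}S<\infty$), so that the constraint integral is defined; $|s|^{q-2}s$ is $0$ at $s=0$. The minimizer $u_0$ is the weak solution of the Neumann problem: $\int_\Omega|\nabla u_0|^{p-2}\nabla u_0\cdot\nabla\varphi\,\mathrm{d}x=\int_\Omega f\varphi\,\mathrm{d}x$ for all $\varphi\in W^{1,p}(\Omega)$, normalized by $\int_{\partial\Omega}|u_0|^{q-2}u_0\,\mathrm{d}S=0$. *)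

theory Defs
  imports "HOL-Analysis.Analysis" "HOL-Library.Landau_Symbols"
begin

section \<open>Hausdorff measure\<close>

text \<open>
  The factor \<open>unit_ball_vol k / 2 ^ k\<close> normalises the measure so that it is the surface measure.
  The empty set is treated separately because for \<open>k = 0\<close> (counting measure) a nonempty set has to
  contribute 1 even if its diameter is 0. The outer measure \<open>hausdorff_outer k\<close> is additive on sets at
  positive distance, hence by Caratheodory's criterion countably additive on the Borel sets, as
  \<open>measure_of\<close> requires.
\<close>

definition hausdorff_content :: "nat \<Rightarrow> real \<Rightarrow> 'a::metric_space set \<Rightarrow> ennreal" where
  "hausdorff_content k \<delta> A =
     (INF U \<in> {U :: nat \<Rightarrow> 'a set. A \<subseteq> (\<Union>i. U i) \<and> (\<forall>i. bounded (U i) \<and> diameter (U i) \<le> \<delta>)}.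
        \<Sum>i. if U i = {} then 0 else ennreal (unit_ball_vol (real k) * (diameter (U i) / 2) ^ k))"

definition hausdorff_outer :: "nat \<Rightarrow> 'a::metric_space set \<Rightarrow> ennreal" where
  "hausdorff_outer k A = (SUP \<delta> \<in> {0<..}. hausdorff_content k \<delta> A)"

definition hausdorff_measure :: "nat \<Rightarrow> 'a::metric_space measure" where
  "hausdorff_measure k = measure_of UNIV (sets borel) (hausdorff_outer k)"

definition surface_measure :: "'a::euclidean_space set \<Rightarrow> 'a measure" where
  "surface_measure \<Omega> = restrict_space (hausdorff_measure (DIM('a) - 1)) (frontier \<Omega>)"


section \<open>Lipschitz sets\<close>

text \<open>
  Near every boundary point \<open>\<Omega>\<close> is the strict epigraph, in some direction \<open>e\<close>, of a Lipschitz
  function \<open>\<gamma>\<close> on the hyperplane orthogonal to \<open>e\<close>; \<open>y - (y \<bullet> e) *\<^sub>R e\<close> is the orthogonal projection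
  of \<open>y\<close> to that hyperplane.
\<close>

definition lipschitz_boundary :: "'a::euclidean_space set \<Rightarrow> bool" where
  "lipschitz_boundary \<Omega> \<longleftrightarrow>
     (\<forall>x \<in> frontier \<Omega>. \<exists>r > 0. \<exists>e. \<exists>\<gamma>. \<exists>L.
        norm e = 1 \<and> L-lipschitz_on {z. z \<bullet> e = 0} \<gamma> \<and>
        \<Omega> \<inter> ball x r = {y \<in> ball x r. \<gamma> (y - (y \<bullet> e) *\<^sub>R e) < y \<bullet> e})"


section \<open>Sobolev spaces\<close>

definition Lp_fun :: "'a measure \<Rightarrow> real \<Rightarrow> ('a \<Rightarrow> 'b::real_normed_vector) \<Rightarrow> bool" where
  "Lp_fun M p h \<longleftrightarrow> h \<in> borel_measurable M \<and> integrable M (\<lambda>x. norm (h x) powr p)"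

primrec C_k :: "nat \<Rightarrow> ('a::euclidean_space \<Rightarrow> real) \<Rightarrow> bool" where
  "C_k 0 \<phi> \<longleftrightarrow> continuous_on UNIV \<phi>"
| "C_k (Suc k) \<phi> \<longleftrightarrow> \<phi> differentiable_on UNIV \<and>
     (\<forall>i \<in> Basis. C_k k (\<lambda>x. frechet_derivative \<phi> (at x) i))"

definition smooth :: "('a::euclidean_space \<Rightarrow> real) \<Rightarrow> bool" where
  "smooth \<phi> \<longleftrightarrow> (\<forall>k. C_k k \<phi>)"

definition test_fun :: "'a::euclidean_space set \<Rightarrow> ('a \<Rightarrow> real) \<Rightarrow> bool" where
  "test_fun \<Omega> \<phi> \<longleftrightarrow>
     smooth \<phi> \<and> compact (closure {x. \<phi> x \<noteq> 0}) \<and> closure {x. \<phi> x \<noteq> 0} \<subseteq> \<Omega>"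

definition locally_integrable ::
    "'a::euclidean_space set \<Rightarrow> ('a \<Rightarrow> 'b::{banach, second_countable_topology}) \<Rightarrow> bool" where
  "locally_integrable \<Omega> h \<longleftrightarrow> (\<forall>K. compact K \<and> K \<subseteq> \<Omega> \<longrightarrow> set_integrable lebesgue K h)"

definition has_weak_gradient ::
    "'a::euclidean_space set \<Rightarrow> ('a \<Rightarrow> real) \<Rightarrow> ('a \<Rightarrow> 'a) \<Rightarrow> bool" where
  "has_weak_gradient \<Omega> u G \<longleftrightarrow>
     locally_integrable \<Omega> u \<and> locally_integrable \<Omega> G \<and>
     (\<forall>\<phi>. test_fun \<Omega> \<phi> \<longrightarrow> (\<forall>i \<in> Basis.
        (LINT x|lebesgue_on \<Omega>. u x * frechet_derivative \<phi> (at x) i) =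
        - (LINT x|lebesgue_on \<Omega>. (G x \<bullet> i) * \<phi> x)))"

text \<open>
  Functions are not identified when they agree almost everywhere, and their values outside \<open>\<Omega>\<close> are
  irrelevant. The weak gradient is an arbitrary representative of its class.
\<close>

definition weak_gradient :: "'a::euclidean_space set \<Rightarrow> ('a \<Rightarrow> real) \<Rightarrow> 'a \<Rightarrow> 'a" where
  "weak_gradient \<Omega> u = (SOME G. has_weak_gradient \<Omega> u G)"

definition sobolev_W1 :: "'a::euclidean_space set \<Rightarrow> real \<Rightarrow> ('a \<Rightarrow> real) set" where
  "sobolev_W1 \<Omega> p =
     {u. Lp_fun (lebesgue_on \<Omega>) p u \<and>
         (\<exists>G. has_weak_gradient \<Omega> u G \<and> Lp_fun (lebesgue_on \<Omega>) p G)}"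

definition sobolev_norm :: "'a::euclidean_space set \<Rightarrow> real \<Rightarrow> ('a \<Rightarrow> real) \<Rightarrow> real" where
  "sobolev_norm \<Omega> p u =
     ((LINT x|lebesgue_on \<Omega>. \<bar>u x\<bar> powr p)
      + (LINT x|lebesgue_on \<Omega>. norm (weak_gradient \<Omega> u x) powr p)) powr (1 / p)"

text \<open>
  Boundedness together with linearity forces a functional to respect equality almost everywhere.
\<close>

definition sobolev_dual ::
    "'a::euclidean_space set \<Rightarrow> real \<Rightarrow> (('a \<Rightarrow> real) \<Rightarrow> real) set" where
  "sobolev_dual \<Omega> p =
     {f. (\<forall>u \<in> sobolev_W1 \<Omega> p. \<forall>v \<in> sobolev_W1 \<Omega> p. f (\<lambda>x. u x + v x) = f u + f v) \<and>
         (\<forall>c. \<forall>u \<in> sobolev_W1 \<Omega> p. f (\<lambda>x. c * u x) = c * f u) \<and>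
         (\<exists>C. \<forall>u \<in> sobolev_W1 \<Omega> p. \<bar>f u\<bar> \<le> C * sobolev_norm \<Omega> p u)}"


section \<open>Traces\<close>

text \<open>
  \<open>has_trace \<Omega> p u g\<close>: \<open>g\<close> represents the image of \<open>u\<close> under the trace operator from
  \<open>W\<^sup>1\<^sup>,\<^sup>p(\<Omega>)\<close> to \<open>L\<^sup>p(\<partial>\<Omega>)\<close>, i.e. under the continuous extension of the restriction map
  \<open>v \<mapsto> v|\<^sub>\<partial>\<^sub>\<Omega>\<close> from the functions that are smooth up to the boundary.
\<close>

definition has_trace ::
    "'a::euclidean_space set \<Rightarrow> real \<Rightarrow> ('a \<Rightarrow> real) \<Rightarrow> ('a \<Rightarrow> real) \<Rightarrow> bool" where
  "has_trace \<Omega> p u g \<longleftrightarrow>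
     u \<in> sobolev_W1 \<Omega> p \<and> Lp_fun (surface_measure \<Omega>) p g \<and>
     (\<exists>v :: nat \<Rightarrow> 'a \<Rightarrow> real. (\<forall>n. smooth (v n)) \<and>
        (\<lambda>n. sobolev_norm \<Omega> p (\<lambda>x. v n x - u x)) \<longlonglongrightarrow> 0 \<and>
        (\<lambda>n. LINT x|surface_measure \<Omega>. \<bar>v n x - g x\<bar> powr p) \<longlonglongrightarrow> 0)"

definition sobolev_trace :: "'a::euclidean_space set \<Rightarrow> real \<Rightarrow> ('a \<Rightarrow> real) \<Rightarrow> 'a \<Rightarrow> real" where
  "sobolev_trace \<Omega> p u = (SOME g. has_trace \<Omega> p u g)"

text \<open>Here \<open>r\<close> may be any positive exponent, also one below 1.\<close>

definition trace_in_L :: "'a::euclidean_space set \<Rightarrow> real \<Rightarrow> real \<Rightarrow> ('a \<Rightarrow> real) \<Rightarrow> bool" where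
  "trace_in_L \<Omega> p r u \<longleftrightarrow>
     has_trace \<Omega> p u (sobolev_trace \<Omega> p u) \<and> Lp_fun (surface_measure \<Omega>) r (sobolev_trace \<Omega> p u)"


section \<open>The variational problems\<close>

definition neumann_energy ::
    "'a::euclidean_space set \<Rightarrow> real \<Rightarrow> (('a \<Rightarrow> real) \<Rightarrow> real) \<Rightarrow> ('a \<Rightarrow> real) \<Rightarrow> real" where
  "neumann_energy \<Omega> p f u =
     1 / p * (LINT x|lebesgue_on \<Omega>. norm (weak_gradient \<Omega> u x) powr p) - f u"

definition boundary_integral ::
    "'a::euclidean_space set \<Rightarrow> real \<Rightarrow> real \<Rightarrow> ('a \<Rightarrow> real) \<Rightarrow> ereal" where
  "boundary_integral \<Omega> p q u =
     (if trace_in_L \<Omega> p q u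
      then ereal (LINT x|surface_measure \<Omega>. \<bar>sobolev_trace \<Omega> p u x\<bar> powr q) else \<infinity>)"

definition E_robin ::
    "'a::euclidean_space set \<Rightarrow> real \<Rightarrow> real \<Rightarrow> (('a \<Rightarrow> real) \<Rightarrow> real) \<Rightarrow> real \<Rightarrow> ereal" where
  "E_robin \<Omega> p q f \<alpha> =
     (INF u \<in> sobolev_W1 \<Omega> p.
        ereal (neumann_energy \<Omega> p f u) + ereal (\<alpha> / q) * boundary_integral \<Omega> p q u)"

definition neumann_admissible ::
    "'a::euclidean_space set \<Rightarrow> real \<Rightarrow> real \<Rightarrow> ('a \<Rightarrow> real) set" where
  "neumann_admissible \<Omega> p q =
     {u \<in> sobolev_W1 \<Omega> p. trace_in_L \<Omega> p (q - 1) u \<and>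
        (LINT x|surface_measure \<Omega>. \<bar>sobolev_trace \<Omega> p u x\<bar> powr (q - 2) * sobolev_trace \<Omega> p u x) = 0}"

definition E_neumann ::
    "'a::euclidean_space set \<Rightarrow> real \<Rightarrow> real \<Rightarrow> (('a \<Rightarrow> real) \<Rightarrow> real) \<Rightarrow> ereal" where
  "E_neumann \<Omega> p q f = (INF u \<in> neumann_admissible \<Omega> p q. ereal (neumann_energy \<Omega> p f u))"

definition neumann_minimizer ::
    "'a::euclidean_space set \<Rightarrow> real \<Rightarrow> real \<Rightarrow> (('a \<Rightarrow> real) \<Rightarrow> real) \<Rightarrow> ('a \<Rightarrow> real) \<Rightarrow> bool" where
  "neumann_minimizer \<Omega> p q f u \<longleftrightarrow>
     u \<in> neumann_admissible \<Omega> p q \<and> ereal (neumann_energy \<Omega> p f u) = E_neumann \<Omega> p q f"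

end

theory Submission
  imports Defs
begin

text \<open>
  Inserting the minimizer \<open>u\<^sub>0\<close> into the Robin problem shows that \<open>E\<^sub>\<alpha>\<close> is at most the claimed value. For
  the other direction, note that adding a constant to a function leaves its energy unchanged, because
  the weak gradient does not see constants and \<open>f(1) = 0\<close>. By the intermediate value theorem every
  function with trace in \<open>L\<^sup>q\<close> becomes admissible for \<open>E\<^sub>0\<close> after subtracting a suitable constant
  (\<open>ex_shift_odd_power_integral_zero\<close>), so its energy is at least \<open>E\<^sub>0\<close> (\<open>E_neumann_le_energy\<close>).

  Suppose that \<open>E\<^sub>\<alpha> < E\<^sub>0 + \<alpha>/q \<integral>|u\<^sub>0|\<^sup>q - \<epsilon> \<alpha>\<close> along a sequence of \<open>\<alpha>\<close> tending to 0. Functions \<open>u\<close> whose Robin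
  energy is below this value have energy tending to \<open>E\<^sub>0\<close> and satisfy
  \<open>\<integral>|u|\<^sup>q \<le> \<integral>|u\<^sub>0|\<^sup>q - q \<epsilon>\<close>. This contradicts the lower semicontinuity of the boundary integral along
  sequences that minimise the energy (\<open>boundary_integral_lower_semicontinuous\<close>), which is the core of
  the proof. It rests on three facts.

  The midpoint of \<open>u\<close> and \<open>u\<^sub>0\<close> has energy at least \<open>E\<^sub>0\<close>, so uniform convexity of \<open>|\<cdot>|\<^sup>p\<close> makes the
  gradients converge to that of \<open>u\<^sub>0\<close> in \<open>L\<^sup>p\<close> (\<open>norm_diff_powr_le_midpoint_defect\<close>).

  On a connected Lipschitz domain, functions whose gradients tend to 0 have traces that approach
  constants (\<open>traces_approach_constants\<close>), so the traces of \<open>u\<close> approach \<open>u\<^sub>0 + c\<close> for constants \<open>c\<close>; the bound on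
  the boundary integrals keeps these constants bounded. This is a Poincare inequality combined with a
  trace inequality. Both are obtained by elementary translations: a function with small gradient
  changes little in \<open>L\<^sup>1\<close> when it is translated, and near a boundary point, where a Lipschitz domain is an
  epigraph, small upward translations stay inside the domain. The surface measure enters only
  through an upper bound by the volume above the graph (\<open>hausdorff_outer_le_if_density\<close>).

  Finally, after passing to a subsequence, Fatou's lemma gives \<open>\<integral>|u\<^sub>0 + c|\<^sup>q \<le> \<integral>|u\<^sub>0|\<^sup>q - q \<epsilon>\<close> for a limit
  \<open>c\<close> of the constants. The constraint on \<open>u\<^sub>0\<close> says exactly that the convex function
  \<open>c \<mapsto> \<integral>|u\<^sub>0 + c|\<^sup>q\<close> has its minimum at 0.

  Traces are limits of smooth functions and weak gradients are arbitrary representatives. To calculate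
  with them, the uniqueness of weak gradients (\<open>has_weak_gradient_unique\<close>) and of traces
  (\<open>has_trace_unique\<close>) has to be established first.
\<close>

section \<open>Integrals of powers\<close>

lemma powr_add_le:
  fixes a b r :: real
  assumes "0 \<le> a" "0 \<le> b" "0 \<le> r"
  shows "(a + b) powr r \<le> 2 powr r * (a powr r + b powr r)"
proof -
  have "(a + b) powr r \<le> (2 * max a b) powr r"
    using assms by (intro powr_mono2) auto
  also have "\<dots> = 2 powr r * (max a b) powr r"
    using assms by (simp add: powr_mult)
  also have "(max a b) powr r \<le> a powr r + b powr r"
    by (auto simp: max_def)
  finally show ?thesis by simp
qed

lemma norm_add_powr_le:
  fixes a b :: "'b::real_normed_vector"
  assumes "0 \<le> r"
  shows "norm (a + b) powr r \<le> 2 powr r * (norm a powr r + norm b powr r)"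
proof -
  have "norm (a + b) powr r \<le> (norm a + norm b) powr r"
    using assms by (intro powr_mono2 norm_triangle_ineq) auto
  also have "\<dots> \<le> 2 powr r * (norm a powr r + norm b powr r)"
    by (rule powr_add_le) (use assms in auto)
  finally show ?thesis .
qed

lemma Lp_fun_add:
  fixes g h :: "'a \<Rightarrow> 'b::{second_countable_topology,real_normed_vector}"
  assumes "Lp_fun M r g" "Lp_fun M r h" "0 \<le> r"
  shows "Lp_fun M r (\<lambda>x. g x + h x)"
proof -
  have [measurable]: "g \<in> borel_measurable M" "h \<in> borel_measurable M"
    using assms by (auto simp: Lp_fun_def)
  have "integrable M (\<lambda>x. norm (g x + h x) powr r)"
  proof (rule Bochner_Integration.integrable_bound)
    show "integrable M (\<lambda>x. 2 powr r * (norm (g x) powr r + norm (h x) powr r))"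
      using assms by (intro integrable_mult_right integrable_add) (auto simp: Lp_fun_def)
    show "AE x in M. norm (norm (g x + h x) powr r) \<le> norm (2 powr r * (norm (g x) powr r + norm (h x) powr r))"
      using norm_add_powr_le[OF assms(3)] by auto
  qed measurable
  then show ?thesis by (simp add: Lp_fun_def)
qed

lemma Lp_fun_scaleR:
  fixes g :: "'a \<Rightarrow> 'b::{second_countable_topology,real_normed_vector}"
  assumes "Lp_fun M r g"
  shows "Lp_fun M r (\<lambda>x. c *\<^sub>R g x)"
  using assms by (auto simp: Lp_fun_def powr_mult)

lemma Lp_fun_diff:
  fixes g h :: "'a \<Rightarrow> 'b::{second_countable_topology,real_normed_vector}"
  assumes "Lp_fun M r g" "Lp_fun M r h" "0 \<le> r"
  shows "Lp_fun M r (\<lambda>x. g x - h x)"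
  using Lp_fun_add[OF assms(1) Lp_fun_scaleR[OF assms(2), of "-1"] assms(3)] by simp

lemma (in finite_measure) Lp_fun_bounded:
  assumes "h \<in> borel_measurable M" "\<And>x. x \<in> space M \<Longrightarrow> norm (h x) \<le> B" "0 \<le> r"
  shows "Lp_fun M r h"
  unfolding Lp_fun_def
proof
  show "h \<in> borel_measurable M" by fact
  then have [measurable]: "(\<lambda>x. norm (h x)) \<in> borel_measurable M" by measurable
  show "integrable M (\<lambda>x. norm (h x) powr r)"
    by (rule integrable_const_bound[where B = "B powr r"])
       (use assms in \<open>auto intro!: AE_I2 powr_mono2\<close>)
qed

lemma (in finite_measure) Lp_fun_antimono:
  assumes "Lp_fun M q h" "0 \<le> r" "r \<le> q"
  shows "Lp_fun M r h"
  unfolding Lp_fun_def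
proof
  show [measurable]: "h \<in> borel_measurable M" using assms by (simp add: Lp_fun_def)
  have [measurable]: "(\<lambda>x. norm (h x)) \<in> borel_measurable M" by measurable
  show "integrable M (\<lambda>x. norm (h x) powr r)"
  proof (rule Bochner_Integration.integrable_bound)
    show "integrable M (\<lambda>x. 1 + norm (h x) powr q)"
      using assms by (auto simp: Lp_fun_def)
    have "norm (h x) powr r \<le> 1 + norm (h x) powr q" for x
    proof (cases "norm (h x) \<le> 1")
      case True
      then have "norm (h x) powr r \<le> 1 powr r"
        using assms by (intro powr_mono2) auto
      then show ?thesis by (simp add: add_increasing2)
    next
      case False
      then show ?thesis using powr_mono[OF \<open>r \<le> q\<close>, of "norm (h x)"] by linarith
    qed
    then show "AE x in M. norm (norm (h x) powr r) \<le> norm (1 + norm (h x) powr q)"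
      by auto
  qed measurable
qed

text \<open>
  On a finite measure space convergence in \<open>L\<^sup>r\<close> with \<open>r \<ge> 1\<close> implies convergence in \<open>L\<^sup>1\<close>, because
  \<open>t \<le> \<epsilon> + \<epsilon>\<^sup>1\<^sup>-\<^sup>r t\<^sup>r\<close> for all \<open>t \<ge> 0\<close>.
\<close>

lemma (in finite_measure) Lp_tendsto_imp_L1_tendsto:
  fixes h :: "nat \<Rightarrow> 'a \<Rightarrow> 'b::{second_countable_topology,real_normed_vector}"
  assumes L: "\<And>n. Lp_fun M r (h n)" and r: "1 \<le> r"
    and lim: "(\<lambda>n. LINT x|M. norm (h n x) powr r) \<longlonglongrightarrow> 0"
  shows "(\<lambda>n. \<integral>\<^sup>+x. ennreal (norm (h n x)) \<partial>M) \<longlonglongrightarrow> 0"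
proof -
  have [measurable]: "\<And>n. h n \<in> borel_measurable M" using L by (auto simp: Lp_fun_def)
  have int: "integrable M (\<lambda>x. norm (h n x))" for n
    using Lp_fun_antimono[OF L[of n], of 1] r by (simp add: Lp_fun_def)
  have key: "t \<le> e + e powr (1 - r) * t powr r" if "0 \<le> t" "0 < e" for t e :: real
  proof (cases "t \<le> e")
    case True
    have "0 \<le> e powr (1 - r) * t powr r" by simp
    with True show ?thesis by linarith
  next
    case False
    with that have t: "e < t" "0 < t" by auto
    have "t = t powr (1 - r) * t powr r" using t by (simp flip: powr_add)
    also have "\<dots> \<le> e powr (1 - r) * t powr r"
      using t that r by (intro mult_right_mono powr_mono2') auto
    finally show ?thesis using that by linarith
  qed
  have "(\<lambda>n. LINT x|M. norm (h n x)) \<longlonglongrightarrow> 0"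
  proof (rule LIMSEQ_I)
    fix e :: real assume "0 < e"
    \<comment> \<open>The added 1 covers the case of total mass 0.\<close>
    define d where "d = e / 2 / (measure M (space M) + 1)"
    have d: "0 < d" using \<open>0 < e\<close> by (simp add: d_def add_nonneg_pos)
    have d': "d * measure M (space M) \<le> e / 2"
    proof -
      have "d * measure M (space M) \<le> d * (measure M (space M) + 1)"
        using d by (intro mult_left_mono) auto
      also have "\<dots> = e / 2"
        proof -
        have "measure M (space M) + 1 \<noteq> 0" using measure_nonneg[of M "space M"] by linarith
        then show ?thesis unfolding d_def by (metis nonzero_eq_divide_eq)
      qed
      finally show ?thesis .
    qed
    have "(\<lambda>n. d powr (1 - r) * (LINT x|M. norm (h n x) powr r)) \<longlonglongrightarrow> 0"
      using tendsto_mult_right_zero[OF lim] by blast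
    then obtain N where N: "\<And>n. n \<ge> N \<Longrightarrow> norm (d powr (1 - r) * (LINT x|M. norm (h n x) powr r) - 0) < e / 2"
      using LIMSEQ_D[of _ 0 "e/2"] \<open>0 < e\<close> half_gt_zero by blast
    have "norm ((LINT x|M. norm (h n x)) - 0) < e" if "n \<ge> N" for n
    proof -
      have i: "integrable M (\<lambda>x. norm (h n x) powr r)" using L by (auto simp: Lp_fun_def)
      have "(LINT x|M. norm (h n x)) \<le> (LINT x|M. d + d powr (1 - r) * norm (h n x) powr r)"
        using int i d by (intro integral_mono) (auto intro!: key)
      also have "\<dots> = d * measure M (space M) + d powr (1 - r) * (LINT x|M. norm (h n x) powr r)"
        using i by (simp add: mult.commute)
      also have "\<dots> < e" using d' N[OF that] by auto
      finally show ?thesis by (simp add: integral_nonneg_AE)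
    qed
    then show "\<exists>N. \<forall>n\<ge>N. norm ((LINT x|M. norm (h n x)) - 0) < e" by blast
  qed
  then have "(\<lambda>n. ennreal (LINT x|M. norm (h n x))) \<longlonglongrightarrow> ennreal 0"
    by (rule tendsto_ennrealI)
  then show ?thesis using int by (simp add: nn_integral_eq_integral)
qed


section \<open>Smooth functions and their gradients\<close>

definition gradient :: "('a::euclidean_space \<Rightarrow> real) \<Rightarrow> 'a \<Rightarrow> 'a" where
  "gradient v x = (\<Sum>i\<in>Basis. frechet_derivative v (at x) i *\<^sub>R i)"

definition C1_fun :: "('a::euclidean_space \<Rightarrow> real) \<Rightarrow> bool" where
  "C1_fun v \<longleftrightarrow> (\<forall>x. (v has_derivative (\<lambda>h. gradient v x \<bullet> h)) (at x)) \<and> continuous_on UNIV (gradient v)"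

lemma frechet_derivative_eq_gradient:
  assumes "v differentiable (at x)"
  shows "frechet_derivative v (at x) = (\<lambda>h. gradient v x \<bullet> h)"
proof
  fix h
  have *: "linear (frechet_derivative v (at x))"
    using assms frechet_derivative_works has_derivative_linear by blast
  have "frechet_derivative v (at x) h = frechet_derivative v (at x) (\<Sum>i\<in>Basis. (h \<bullet> i) *\<^sub>R i)"
    by (simp add: euclidean_representation)
  also have "\<dots> = (\<Sum>i\<in>Basis. (h \<bullet> i) * frechet_derivative v (at x) i)"
    using * by (simp add: linear_sum linear_cmul)
  also have "\<dots> = gradient v x \<bullet> h"
    unfolding gradient_def inner_sum_left by (intro sum.cong) (auto simp: inner_commute)
  finally show "frechet_derivative v (at x) h = gradient v x \<bullet> h" .
qed

lemma gradient_unique: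
  assumes "(v has_derivative (\<lambda>h. G \<bullet> h)) (at x)"
  shows "gradient v x = G"
proof -
  have "frechet_derivative v (at x) = (\<lambda>h. G \<bullet> h)"
    using assms frechet_derivative_at by metis
  then show ?thesis by (simp add: gradient_def euclidean_representation)
qed

lemma C1_fun_has_derivative:
  "C1_fun v \<Longrightarrow> (v has_derivative (\<lambda>h. gradient v x \<bullet> h)) (at x)"
  by (simp add: C1_fun_def)

lemma C1_fun_frechet:
  "C1_fun v \<Longrightarrow> frechet_derivative v (at x) h = gradient v x \<bullet> h"
  by (metis C1_fun_has_derivative differentiableI frechet_derivative_eq_gradient)

lemma C1_fun_continuous: "C1_fun v \<Longrightarrow> continuous_on UNIV v"
  by (intro continuous_at_imp_continuous_on ballI has_derivative_continuous[OF C1_fun_has_derivative])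

lemma C1_fun_continuous_gradient: "C1_fun v \<Longrightarrow> continuous_on UNIV (gradient v)"
  by (simp add: C1_fun_def)

lemma C1_funI:
  assumes "\<And>x. (v has_derivative (\<lambda>h. G x \<bullet> h)) (at x)" "continuous_on UNIV G"
  shows "C1_fun v" "gradient v = G"
proof -
  show "gradient v = G" using gradient_unique[OF assms(1)] by auto
  with assms show "C1_fun v" by (simp add: C1_fun_def)
qed

lemma C1_fun_linear_combination:
  assumes "C1_fun v" "C1_fun w"
  shows "C1_fun (\<lambda>x. a * v x + b * w x)"
    and "gradient (\<lambda>x. a * v x + b * w x) = (\<lambda>x. a *\<^sub>R gradient v x + b *\<^sub>R gradient w x)"
proof -
  have 1: "((\<lambda>x. a * v x + b * w x) has_derivative (\<lambda>h. (a *\<^sub>R gradient v x + b *\<^sub>R gradient w x) \<bullet> h)) (at x)" for x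
    by (auto intro!: derivative_eq_intros C1_fun_has_derivative assms simp: inner_add_left)
  have 2: "continuous_on UNIV (\<lambda>x. a *\<^sub>R gradient v x + b *\<^sub>R gradient w x)"
    using assms by (intro continuous_intros C1_fun_continuous_gradient)
  from C1_funI[OF 1 2] show "C1_fun (\<lambda>x. a * v x + b * w x)"
    and "gradient (\<lambda>x. a * v x + b * w x) = (\<lambda>x. a *\<^sub>R gradient v x + b *\<^sub>R gradient w x)" .
qed

lemma C1_fun_mult:
  assumes "C1_fun v" "C1_fun w"
  shows "C1_fun (\<lambda>x. v x * w x)"
    and "gradient (\<lambda>x. v x * w x) = (\<lambda>x. v x *\<^sub>R gradient w x + w x *\<^sub>R gradient v x)"
proof -
  have 1: "((\<lambda>x. v x * w x) has_derivative (\<lambda>h. (v x *\<^sub>R gradient w x + w x *\<^sub>R gradient v x) \<bullet> h)) (at x)" for x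
    by (auto intro!: derivative_eq_intros C1_fun_has_derivative assms simp: inner_add_left algebra_simps)
  have 2: "continuous_on UNIV (\<lambda>x. v x *\<^sub>R gradient w x + w x *\<^sub>R gradient v x)"
    using assms by (intro continuous_intros C1_fun_continuous_gradient C1_fun_continuous)
  from C1_funI[OF 1 2] show "C1_fun (\<lambda>x. v x * w x)"
    and "gradient (\<lambda>x. v x * w x) = (\<lambda>x. v x *\<^sub>R gradient w x + w x *\<^sub>R gradient v x)" .
qed

lemma C1_fun_const: "C1_fun (\<lambda>x. c)" "gradient (\<lambda>x. c) = (\<lambda>x. 0)"
  by (rule C1_funI[of _ "\<lambda>x. 0"]; simp)+

lemma smooth_imp_C1_fun:
  assumes "smooth v"
  shows "C1_fun v"
proof -
  have 1: "C_k (Suc 0) v" using assms by (auto simp: smooth_def simp del: C_k.simps)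
  then have d: "v differentiable (at x)" for x by (simp add: differentiable_on_def)
  show ?thesis
  proof (rule C1_funI)
    show "(v has_derivative (\<lambda>h. gradient v x \<bullet> h)) (at x)" for x
      using d frechet_derivative_eq_gradient[OF d] frechet_derivative_works by metis
    show "continuous_on UNIV (gradient v)"
      unfolding gradient_def using 1 by (intro continuous_intros) auto
  qed
qed

text \<open>
  A class of functions that is closed under partial derivatives and consists of differentiable
  functions consists of smooth functions; this replaces an induction on the order of differentiation
  in each concrete case.
\<close>

lemma smooth_if_closed_under_derivatives:
  assumes "v \<in> F"
    and "\<And>v x. v \<in> F \<Longrightarrow> v differentiable (at x)"
    and "\<And>v i. v \<in> F \<Longrightarrow> i \<in> Basis \<Longrightarrow> (\<lambda>x. frechet_derivative v (at x) i) \<in> F"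
  shows "smooth v"
proof -
  have "C_k k v" if "v \<in> F" for k v
    using that
  proof (induction k arbitrary: v)
    case 0
    then show ?case
      using assms(2) by (auto simp: differentiable_on_def intro!: differentiable_imp_continuous_on)
  next
    case (Suc k)
    then show ?case using assms(2,3) by (auto simp: differentiable_on_def)
  qed
  with assms(1) show ?thesis by (auto simp: smooth_def)
qed

lemma smooth_partial:
  assumes "smooth v" "i \<in> Basis"
  shows "smooth (\<lambda>x. frechet_derivative v (at x) i)"
  unfolding smooth_def
proof
  fix k
  have "C_k (Suc k) v" using assms(1) by (simp only: smooth_def)
  with assms(2) show "C_k k (\<lambda>x. frechet_derivative v (at x) i)" by simp
qed

lemma smooth_const: "smooth (\<lambda>x. c)"
  by (rule smooth_if_closed_under_derivatives[where F = "range (\<lambda>c x. c)"]) auto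

lemma smooth_linear_combination:
  assumes "smooth v" "smooth w"
  shows "smooth (\<lambda>x. a * v x + b * w x)"
proof (rule smooth_if_closed_under_derivatives[where F = "{\<lambda>x. a * v x + b * w x |v w. smooth v \<and> smooth w}"])
  show "(\<lambda>x. a * v x + b * w x) \<in> {\<lambda>x. a * v x + b * w x |v w. smooth v \<and> smooth w}"
    using assms by blast
  fix u :: "'a \<Rightarrow> real" assume "u \<in> {\<lambda>x. a * v x + b * w x |v w. smooth v \<and> smooth w}"
  then obtain v w where *: "u = (\<lambda>x. a * v x + b * w x)" "smooth v" "smooth w" by blast
  have C1: "C1_fun v" "C1_fun w" using * smooth_imp_C1_fun by auto
  note lc = C1_fun_linear_combination[OF C1, of a b]
  show "u differentiable (at x)" for x
    unfolding * by (rule differentiableI[OF C1_fun_has_derivative[OF lc(1)]])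
  fix i :: 'a assume i: "i \<in> Basis"
  have "(\<lambda>x. frechet_derivative u (at x) i) =
        (\<lambda>x. a * frechet_derivative v (at x) i + b * frechet_derivative w (at x) i)"
    unfolding * by (simp add: C1_fun_frechet[OF lc(1)] C1_fun_frechet[OF C1(1)] C1_fun_frechet[OF C1(2)]
        lc(2) inner_add_left)
  then show "(\<lambda>x. frechet_derivative u (at x) i) \<in> {\<lambda>x. a * v x + b * w x |v w. smooth v \<and> smooth w}"
    unfolding mem_Collect_eq using smooth_partial[OF *(2) i] smooth_partial[OF *(3) i]
    by (intro exI conjI) assumption+
qed


section \<open>Weak gradients\<close>

lemma integrable_continuous_compact_support:
  fixes h :: "'a::euclidean_space \<Rightarrow> 'b::euclidean_space"
  assumes "continuous_on UNIV h" "compact K" "\<And>x. x \<notin> K \<Longrightarrow> h x = 0"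
  shows "integrable lborel h"
proof -
  have "integrable lborel (\<lambda>x. indicator K x *\<^sub>R h x)"
    using assms by (intro borel_integrable_compact) (auto intro: continuous_on_subset)
  also have "(\<lambda>x. indicator K x *\<^sub>R h x) = h"
    using assms(3) by (auto simp: indicator_def)
  finally show ?thesis .
qed

lemma C1_fun_gradient_eq_0:
  assumes "C1_fun \<phi>" "closed K" "\<And>x. x \<notin> K \<Longrightarrow> \<phi> x = 0" "x \<notin> K"
  shows "gradient \<phi> x = 0"
proof (rule gradient_unique)
  have "((\<lambda>x. 0) has_derivative (\<lambda>h. 0 \<bullet> h)) (at x)" by simp
  then show "(\<phi> has_derivative (\<lambda>h. 0 \<bullet> h)) (at x)"
    by (rule has_derivative_transform_within_open[where s = "- K"]) (use assms in auto)
qed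

text \<open>
  The integral of the difference quotient \<open>n (\<phi>(x + i/n) - \<phi>(x))\<close> vanishes by translation invariance,
  and dominated convergence passes to the limit.
\<close>

lemma integral_gradient_compact_support:
  fixes \<phi> :: "'a::euclidean_space \<Rightarrow> real"
  assumes C1: "C1_fun \<phi>" and K: "compact K" "\<And>x. x \<notin> K \<Longrightarrow> \<phi> x = 0"
  shows "(LINT x|lborel. gradient \<phi> x \<bullet> i) = 0"
proof -
  have cont: "continuous_on UNIV \<phi>" using C1 by (rule C1_fun_continuous)
  have gcont: "continuous_on UNIV (gradient \<phi>)" using C1 by (rule C1_fun_continuous_gradient)
  have g0: "gradient \<phi> x = 0" if "x \<notin> K" for x
    using C1_fun_gradient_eq_0[OF C1 compact_imp_closed[OF K(1)] K(2)] that by blast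
  obtain B where B: "\<And>x. norm (gradient \<phi> x) \<le> B" "0 \<le> B"
  proof -
    have "compact (gradient \<phi> ` K)"
      using K gcont by (intro compact_continuous_image) (auto intro: continuous_on_subset)
    then obtain B where B: "\<And>y. y \<in> gradient \<phi> ` K \<Longrightarrow> norm y \<le> B"
      using bounded_iff compact_imp_bounded by metis
    have "norm (gradient \<phi> x) \<le> max B 0" for x
      using B[of "gradient \<phi> x"] g0[of x] by (cases "x \<in> K") auto
    then show ?thesis by (intro that[of "max B 0"]) auto
  qed
  have lip: "\<bar>\<phi> (x + h) - \<phi> x\<bar> \<le> B * norm h" for x h
  proof -
    have "norm (\<phi> (x + h) - \<phi> x) \<le> B * norm ((x + h) - x)"
    proof (rule differentiable_bound[where S = UNIV and f' = "\<lambda>x h. gradient \<phi> x \<bullet> h"])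
      show "onorm (\<lambda>h. gradient \<phi> x \<bullet> h) \<le> B" for x
      proof (rule onorm_le)
        fix h
        have "norm (gradient \<phi> x \<bullet> h) \<le> norm (gradient \<phi> x) * norm h"
          by (simp add: Cauchy_Schwarz_ineq2)
        also have "\<dots> \<le> B * norm h" using B by (intro mult_right_mono) auto
        finally show "norm (gradient \<phi> x \<bullet> h) \<le> B * norm h" .
      qed
    qed (use C1_fun_has_derivative[OF C1] in auto)
    then show ?thesis by simp
  qed
  obtain R where R: "0 < R" "\<And>x. x \<in> K \<Longrightarrow> norm x \<le> R"
    using K compact_imp_bounded bounded_pos by metis
  define C where "C = cball (0::'a) (R + norm i)"
  have int: "integrable lborel \<phi>"
    using cont K by (intro integrable_continuous_compact_support) auto
  have meas [measurable]: "\<phi> \<in> borel_measurable borel"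
    using cont by (intro borel_measurable_continuous_onI)
  have trans: "(LINT x|lborel. \<phi> (x + h)) = (LINT x|lborel. \<phi> x)"
    and int': "integrable lborel (\<lambda>x. \<phi> (x + h))" for h
  proof -
    have "(LINT x|lborel. \<phi> x) = (LINT x|distr lborel borel ((+) h). \<phi> x)"
      by (simp add: lborel_distr_plus)
    also have "\<dots> = (LINT x|lborel. \<phi> (h + x))"
      by (rule integral_distr) auto
    finally show "(LINT x|lborel. \<phi> (x + h)) = (LINT x|lborel. \<phi> x)"
      by (simp add: add.commute)
    have "integrable (distr lborel borel ((+) h)) \<phi>"
      using int by (simp add: lborel_distr_plus)
    then show "integrable lborel (\<lambda>x. \<phi> (x + h))"
      by (subst (asm) integrable_distr_eq) (auto simp: add.commute)
  qed
  define d where "d n x = real (Suc n) * (\<phi> (x + i /\<^sub>R real (Suc n)) - \<phi> x)" for n x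
  have "(\<lambda>n. LINT x|lborel. d n x) \<longlonglongrightarrow> (LINT x|lborel. gradient \<phi> x \<bullet> i)"
  proof (rule integral_dominated_convergence[where w = "\<lambda>x. indicator C x * (B * norm i)"])
    show "(\<lambda>x. gradient \<phi> x \<bullet> i) \<in> borel_measurable lborel"
      using gcont by (auto intro!: borel_measurable_continuous_onI continuous_intros)
    show "d n \<in> borel_measurable lborel" for n unfolding d_def by measurable
    show "integrable lborel (\<lambda>x. indicator C x * (B * norm i))"
      by (intro integrable_mult_left) (auto simp: C_def intro!: integrable_real_indicator emeasure_lborel_cball_finite)
    show "AE x in lborel. (\<lambda>n. d n x) \<longlonglongrightarrow> gradient \<phi> x \<bullet> i"
    proof (rule AE_I2)
      fix x
      have D: "((\<lambda>t. \<phi> (x + t *\<^sub>R i)) has_real_derivative (gradient \<phi> x \<bullet> i)) (at 0)"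
      proof -
        have "((\<lambda>t. \<phi> (x + t *\<^sub>R i)) has_derivative (\<lambda>t. gradient \<phi> (x + 0 *\<^sub>R i) \<bullet> (t *\<^sub>R i))) (at 0)"
          by (rule has_derivative_compose[OF _ C1_fun_has_derivative[OF C1]])
             (auto intro!: derivative_eq_intros)
        then show ?thesis
          by (simp add: has_field_derivative_def mult_commute_abs)
      qed
      have "((\<lambda>h. (\<phi> (x + h *\<^sub>R i) - \<phi> x) / h) \<longlongrightarrow> gradient \<phi> x \<bullet> i) (at 0)"
        using D unfolding DERIV_def by simp
      moreover have "filterlim (\<lambda>n. inverse (real (Suc n))) (at 0) sequentially"
        unfolding filterlim_at using LIMSEQ_inverse_real_of_nat by auto
      ultimately have "(\<lambda>n. (\<phi> (x + inverse (real (Suc n)) *\<^sub>R i) - \<phi> x) / inverse (real (Suc n)))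
          \<longlonglongrightarrow> gradient \<phi> x \<bullet> i"
        by (rule filterlim_compose)
      then show "(\<lambda>n. d n x) \<longlonglongrightarrow> gradient \<phi> x \<bullet> i"
        by (simp add: d_def field_simps del: of_nat_Suc)
    qed
    show "AE x in lborel. norm (d n x) \<le> indicator C x * (B * norm i)" for n
    proof (rule AE_I2)
      fix x
      show "norm (d n x) \<le> indicator C x * (B * norm i)"
      proof (cases "x \<in> C")
        case True
        have "\<bar>d n x\<bar> = real (Suc n) * \<bar>\<phi> (x + i /\<^sub>R real (Suc n)) - \<phi> x\<bar>"
          unfolding d_def abs_mult by simp
        also have "\<dots> \<le> real (Suc n) * (B * norm (i /\<^sub>R real (Suc n)))"
          by (intro mult_left_mono lip) auto
        also have "\<dots> = B * norm i" by (simp del: of_nat_Suc)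
        finally show ?thesis using True by simp
      next
        case False
        have *: "norm (i /\<^sub>R real (Suc n)) \<le> norm i"
          by (simp add: divide_simps mult_left_le_one_le del: of_nat_Suc) (simp add: mult_le_cancel_left1)
        have "x \<notin> K" using False R(2)[of x] norm_ge_zero[of i] by (force simp: C_def)
        moreover have "x + i /\<^sub>R real (Suc n) \<notin> K"
        proof
          assume "x + i /\<^sub>R real (Suc n) \<in> K"
          then have "norm (x + i /\<^sub>R real (Suc n)) \<le> R" by (rule R)
          then have "norm x \<le> R + norm i"
            using * norm_triangle_ineq4[of "x + i /\<^sub>R real (Suc n)" "i /\<^sub>R real (Suc n)"] by simp
          then show False using False by (simp add: C_def)
        qed
        ultimately show ?thesis using K(2) B(2) by (simp add: d_def del: of_nat_Suc)
      qed
    qed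
  qed
  moreover have "(LINT x|lborel. d n x) = 0" for n
    unfolding d_def using int int' trans by simp
  ultimately show ?thesis by (simp add: LIMSEQ_const_iff)
qed

lemma test_fun_C1_fun: "test_fun \<Omega> \<phi> \<Longrightarrow> C1_fun \<phi>"
  by (simp add: test_fun_def smooth_imp_C1_fun)

lemma test_fun_support:
  assumes "test_fun \<Omega> \<phi>"
  shows "\<exists>K. compact K \<and> K \<subseteq> \<Omega> \<and> (\<forall>x. x \<notin> K \<longrightarrow> \<phi> x = 0 \<and> gradient \<phi> x = 0)"
proof -
  let ?K = "closure {x. \<phi> x \<noteq> 0}"
  have 1: "\<phi> x = 0" if "x \<notin> ?K" for x using that closure_subset[of "{x. \<phi> x \<noteq> 0}"] by auto
  have 2: "gradient \<phi> x = 0" if "x \<notin> ?K" for x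
    by (rule C1_fun_gradient_eq_0[OF test_fun_C1_fun[OF assms] closed_closure 1 that])
  have 3: "compact ?K" "?K \<subseteq> \<Omega>"
    using assms by (auto simp only: test_fun_def)
  show ?thesis
    by (intro exI[of _ ?K] conjI allI impI 3) (erule 1, erule 2)
qed

lemma integral_lebesgue_on_eq_lborel:
  fixes h :: "'a::euclidean_space \<Rightarrow> real"
  assumes "open \<Omega>" "h \<in> borel_measurable borel" "\<And>x. x \<notin> \<Omega> \<Longrightarrow> h x = 0"
  shows "(LINT x|lebesgue_on \<Omega>. h x) = (LINT x|lborel. h x)"
proof -
  have "(LINT x|lebesgue_on \<Omega>. h x) = (LINT x|lebesgue. indicator \<Omega> x *\<^sub>R h x)"
    using assms by (intro integral_restrict_space) auto
  also have "(\<lambda>x. indicator \<Omega> x *\<^sub>R h x) = h"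
    using assms(3) by (force simp: indicator_def)
  also have "(LINT x|lebesgue. h x) = (LINT x|lborel. h x)"
    using assms by (intro integral_completion) auto
  finally show ?thesis .
qed

lemma locally_integrable_continuous:
  fixes h :: "'a::euclidean_space \<Rightarrow> 'b::euclidean_space"
  assumes "continuous_on UNIV h"
  shows "locally_integrable \<Omega> h"
  unfolding locally_integrable_def
proof (intro allI impI)
  fix K :: "'a set" assume "compact K \<and> K \<subseteq> \<Omega>"
  then have "integrable lborel (\<lambda>x. indicator K x *\<^sub>R h x)"
    using assms by (intro borel_integrable_compact) (auto intro: continuous_on_subset)
  then show "set_integrable lebesgue K h"
    unfolding set_integrable_def
    by (subst integrable_completion) (auto dest: borel_measurable_integrable)
qed

text \<open>
  Integration by parts: the gradient of the compactly supported product \<open>v \<phi>\<close> has integral 0.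
\<close>

lemma C1_fun_has_weak_gradient:
  fixes v :: "'a::euclidean_space \<Rightarrow> real"
  assumes "open \<Omega>" "C1_fun v"
  shows "has_weak_gradient \<Omega> v (gradient v)"
  unfolding has_weak_gradient_def
proof (intro conjI allI impI ballI)
  have vc: "continuous_on UNIV v" and gc: "continuous_on UNIV (gradient v)"
    using assms C1_fun_continuous C1_fun_continuous_gradient by auto
  then show "locally_integrable \<Omega> v" "locally_integrable \<Omega> (gradient v)"
    by (auto intro: locally_integrable_continuous)
  fix \<phi> and i :: 'a assume T: "test_fun \<Omega> \<phi>" and i: "i \<in> Basis"
  note \<phi> = test_fun_C1_fun[OF T]
  obtain K where K: "compact K" "K \<subseteq> \<Omega>" "\<And>x. x \<notin> K \<Longrightarrow> \<phi> x = 0"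
    "\<And>x. x \<notin> K \<Longrightarrow> gradient \<phi> x = 0"
    using test_fun_support[OF T] by auto
  have pc: "continuous_on UNIV \<phi>" "continuous_on UNIV (gradient \<phi>)"
    using \<phi> C1_fun_continuous C1_fun_continuous_gradient by auto
  have c1: "continuous_on UNIV (\<lambda>x. v x * (gradient \<phi> x \<bullet> i))"
    and c2: "continuous_on UNIV (\<lambda>x. (gradient v x \<bullet> i) * \<phi> x)"
    using vc gc pc by (auto intro!: continuous_intros)
  have i1: "integrable lborel (\<lambda>x. v x * (gradient \<phi> x \<bullet> i))"
    and i2: "integrable lborel (\<lambda>x. (gradient v x \<bullet> i) * \<phi> x)"
    using K by (auto intro: integrable_continuous_compact_support[OF c1, of K]
        integrable_continuous_compact_support[OF c2, of K])
  have "(LINT x|lborel. gradient (\<lambda>x. v x * \<phi> x) x \<bullet> i) = 0"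
    by (rule integral_gradient_compact_support[OF C1_fun_mult(1)[OF assms(2) \<phi>] K(1)]) (use K in auto)
  then have "(LINT x|lborel. v x * (gradient \<phi> x \<bullet> i) + (gradient v x \<bullet> i) * \<phi> x) = 0"
    unfolding C1_fun_mult(2)[OF assms(2) \<phi>] by (simp add: inner_add_left mult.commute[of "\<phi> _"])
  then have *: "(LINT x|lborel. v x * (gradient \<phi> x \<bullet> i)) = - (LINT x|lborel. (gradient v x \<bullet> i) * \<phi> x)"
    using i1 i2 by simp
  have K0: "\<phi> x = 0" "gradient \<phi> x = 0" if "x \<notin> \<Omega>" for x
    using K that by auto
  have l1: "(LINT x|lebesgue_on \<Omega>. v x * (gradient \<phi> x \<bullet> i)) = (LINT x|lborel. v x * (gradient \<phi> x \<bullet> i))"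
    by (rule integral_lebesgue_on_eq_lborel)
       (use assms c1 K0 in \<open>auto intro: borel_measurable_continuous_onI\<close>)
  have l2: "(LINT x|lebesgue_on \<Omega>. (gradient v x \<bullet> i) * \<phi> x) = (LINT x|lborel. (gradient v x \<bullet> i) * \<phi> x)"
    by (rule integral_lebesgue_on_eq_lborel)
       (use assms c2 K0 in \<open>auto intro: borel_measurable_continuous_onI\<close>)
  show "(LINT x|lebesgue_on \<Omega>. v x * frechet_derivative \<phi> (at x) i) =
        - (LINT x|lebesgue_on \<Omega>. (gradient v x \<bullet> i) * \<phi> x)"
    using l1 l2 * by (simp add: C1_fun_frechet[OF \<phi>])
qed

lemma locally_integrable_mult_integrable:
  fixes h :: "'a::euclidean_space \<Rightarrow> 'b::euclidean_space" and D :: "'a \<Rightarrow> real"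
  assumes "open \<Omega>" "locally_integrable \<Omega> h" "compact K" "K \<subseteq> \<Omega>"
    and D: "continuous_on UNIV D" "\<And>x. x \<notin> K \<Longrightarrow> D x = 0"
  shows "integrable (lebesgue_on \<Omega>) (\<lambda>x. D x *\<^sub>R h x)"
proof -
  have int: "integrable lebesgue (\<lambda>x. indicator K x *\<^sub>R h x)"
    using assms by (auto simp: locally_integrable_def set_integrable_def)
  have "compact (D ` K)"
    using assms by (intro compact_continuous_image) (auto intro: continuous_on_subset)
  then obtain B where B: "\<And>y. y \<in> D ` K \<Longrightarrow> norm y \<le> B"
    using bounded_iff compact_imp_bounded by metis
  have Dm: "D \<in> borel_measurable lebesgue"
    using D(1) by (intro measurable_completion) (auto intro: borel_measurable_continuous_onI)
  have "integrable lebesgue (\<lambda>x. D x *\<^sub>R (indicator K x *\<^sub>R h x))"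
  proof (rule Bochner_Integration.integrable_bound)
    show "integrable lebesgue (\<lambda>x. B *\<^sub>R (indicator K x *\<^sub>R h x))"
      using int by (rule integrable_scaleR_right)
    show "(\<lambda>x. D x *\<^sub>R (indicator K x *\<^sub>R h x)) \<in> borel_measurable lebesgue"
      using Dm borel_measurable_integrable[OF int] by (rule borel_measurable_scaleR)
    show "AE x in lebesgue. norm (D x *\<^sub>R (indicator K x *\<^sub>R h x)) \<le> norm (B *\<^sub>R (indicator K x *\<^sub>R h x))"
    proof (rule AE_I2)
      fix x
      show "norm (D x *\<^sub>R (indicator K x *\<^sub>R h x)) \<le> norm (B *\<^sub>R (indicator K x *\<^sub>R h x))"
        using B[of "D x"] by (cases "x \<in> K") (auto intro!: mult_right_mono)
    qed
  qed
  also have "(\<lambda>x. D x *\<^sub>R (indicator K x *\<^sub>R h x)) = (\<lambda>x. indicator \<Omega> x *\<^sub>R (D x *\<^sub>R h x))"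
    using assms(4) D(2) by (auto simp: indicator_def fun_eq_iff)
  finally show ?thesis
    using assms(1) by (subst integrable_restrict_space) auto
qed

lemma has_weak_gradient_integrable:
  assumes "open \<Omega>" "has_weak_gradient \<Omega> u G" "test_fun \<Omega> \<phi>" "i \<in> Basis"
  shows "integrable (lebesgue_on \<Omega>) (\<lambda>x. u x * frechet_derivative \<phi> (at x) i)"
    and "integrable (lebesgue_on \<Omega>) (\<lambda>x. (G x \<bullet> i) * \<phi> x)"
proof -
  note \<phi> = test_fun_C1_fun[OF assms(3)]
  obtain K where K: "compact K" "K \<subseteq> \<Omega>" "\<And>x. x \<notin> K \<Longrightarrow> \<phi> x = 0"
    "\<And>x. x \<notin> K \<Longrightarrow> gradient \<phi> x = 0"
    using test_fun_support[OF assms(3)] by auto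
  have pc: "continuous_on UNIV \<phi>" "continuous_on UNIV (\<lambda>x. gradient \<phi> x \<bullet> i)"
    using \<phi> C1_fun_continuous C1_fun_continuous_gradient by (auto intro!: continuous_intros)
  have "integrable (lebesgue_on \<Omega>) (\<lambda>x. (gradient \<phi> x \<bullet> i) *\<^sub>R u x)"
    by (rule locally_integrable_mult_integrable[OF assms(1) _ K(1,2) pc(2)])
       (use assms K in \<open>auto simp: has_weak_gradient_def\<close>)
  then show "integrable (lebesgue_on \<Omega>) (\<lambda>x. u x * frechet_derivative \<phi> (at x) i)"
    by (simp add: C1_fun_frechet[OF \<phi>] mult.commute)
  have "integrable (lebesgue_on \<Omega>) (\<lambda>x. \<phi> x *\<^sub>R G x)"
    by (rule locally_integrable_mult_integrable[OF assms(1) _ K(1,2) pc(1)])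
       (use assms K in \<open>auto simp: has_weak_gradient_def\<close>)
  then have "integrable (lebesgue_on \<Omega>) (\<lambda>x. (\<phi> x *\<^sub>R G x) \<bullet> i)"
    by (rule integrable_inner_left)
  then show "integrable (lebesgue_on \<Omega>) (\<lambda>x. (G x \<bullet> i) * \<phi> x)"
    by (simp add: mult.commute)
qed

lemma locally_integrable_linear_combination:
  fixes g h :: "'a::euclidean_space \<Rightarrow> 'b::euclidean_space"
  assumes "locally_integrable \<Omega> g" "locally_integrable \<Omega> h"
  shows "locally_integrable \<Omega> (\<lambda>x. a *\<^sub>R g x + b *\<^sub>R h x)"
  using assms unfolding locally_integrable_def
  by (auto intro!: set_integral_add set_integrable_scaleR_right)

lemma has_weak_gradient_linear_combination:
  assumes "open \<Omega>" "has_weak_gradient \<Omega> u G" "has_weak_gradient \<Omega> v H"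
  shows "has_weak_gradient \<Omega> (\<lambda>x. a * u x + b * v x) (\<lambda>x. a *\<^sub>R G x + b *\<^sub>R H x)"
  unfolding has_weak_gradient_def
proof (intro conjI allI impI ballI)
  show "locally_integrable \<Omega> (\<lambda>x. a * u x + b * v x)"
    using locally_integrable_linear_combination[of \<Omega> u v a b] assms by (simp add: has_weak_gradient_def)
  show "locally_integrable \<Omega> (\<lambda>x. a *\<^sub>R G x + b *\<^sub>R H x)"
    using locally_integrable_linear_combination assms by (auto simp: has_weak_gradient_def)
  fix \<phi> and i :: 'a assume \<phi>: "test_fun \<Omega> \<phi>" and i: "i \<in> Basis"
  note iu = has_weak_gradient_integrable[OF assms(1,2) \<phi> i]
  note iv = has_weak_gradient_integrable[OF assms(1,3) \<phi> i]
  have e1: "(a * u x + b * v x) * frechet_derivative \<phi> (at x) i =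
    a * (u x * frechet_derivative \<phi> (at x) i) + b * (v x * frechet_derivative \<phi> (at x) i)" for x
    by (simp add: algebra_simps)
  have e2: "((a *\<^sub>R G x + b *\<^sub>R H x) \<bullet> i) * \<phi> x = a * ((G x \<bullet> i) * \<phi> x) + b * ((H x \<bullet> i) * \<phi> x)" for x
    by (simp add: algebra_simps inner_add_left)
  have "(LINT x|lebesgue_on \<Omega>. u x * frechet_derivative \<phi> (at x) i) = - (LINT x|lebesgue_on \<Omega>. (G x \<bullet> i) * \<phi> x)"
    "(LINT x|lebesgue_on \<Omega>. v x * frechet_derivative \<phi> (at x) i) = - (LINT x|lebesgue_on \<Omega>. (H x \<bullet> i) * \<phi> x)"
    using assms \<phi> i by (auto simp: has_weak_gradient_def)
  then show "(LINT x|lebesgue_on \<Omega>. (a * u x + b * v x) * frechet_derivative \<phi> (at x) i) =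
        - (LINT x|lebesgue_on \<Omega>. ((a *\<^sub>R G x + b *\<^sub>R H x) \<bullet> i) * \<phi> x)"
    unfolding e1 e2 using iu iv by simp
qed


section \<open>Uniqueness of weak gradients\<close>

text \<open>
  The functions \<open>t\<^sup>-\<^sup>k exp(-1/t)\<close>, extended by 0 to the left half-line, are differentiable at 0 with
  derivative 0, and their derivatives are linear combinations of functions of the same kind.
\<close>

definition flat_exp :: "nat \<Rightarrow> real \<Rightarrow> real" where
  "flat_exp k t = (if t > 0 then exp (- 1 / t) / t ^ k else 0)"

lemma flat_exp_tendsto_0: "(flat_exp k \<longlongrightarrow> 0) (at_right 0)"
proof -
  have "((\<lambda>t::real. inverse t ^ k / exp (inverse t)) \<longlongrightarrow> 0) (at_right 0)"
    by (rule filterlim_compose[OF tendsto_power_div_exp_0 filterlim_inverse_at_top_right])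
  moreover have "eventually (\<lambda>t. inverse t ^ k / exp (inverse t) = flat_exp k t) (at_right 0)"
    using eventually_at_right_less[of "0::real"]
    by eventually_elim (simp add: flat_exp_def field_simps exp_minus)
  ultimately show ?thesis by (rule Lim_transform_eventually)
qed

lemma flat_exp_has_derivative:
  "(flat_exp k has_real_derivative (flat_exp (k + 2) t - real k * flat_exp (k + 1) t)) (at t)"
proof -
  consider "t < 0" | "t = 0" | "t > 0" by linarith
  then show ?thesis
  proof cases
    case 1
    have "((\<lambda>t. 0) has_real_derivative 0) (at t)" by simp
    then have "(flat_exp k has_real_derivative 0) (at t)"
      by (rule has_field_derivative_transform_within_open[where S = "{..<0}"])
         (use 1 in \<open>auto simp: flat_exp_def\<close>)
    then show ?thesis using 1 by (simp add: flat_exp_def)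
  next
    case 2
    have "((\<lambda>h. flat_exp k h / h) \<longlongrightarrow> 0) (at_right 0)"
    proof (rule Lim_transform_eventually[OF flat_exp_tendsto_0[of "Suc k"]])
      show "eventually (\<lambda>h. flat_exp (Suc k) h = flat_exp k h / h) (at_right 0)"
        using eventually_at_right_less[of "0::real"]
        by eventually_elim (simp add: flat_exp_def field_simps)
    qed
    moreover have "((\<lambda>h. flat_exp k h / h) \<longlongrightarrow> 0) (at_left 0)"
    proof (rule Lim_transform_eventually[OF tendsto_const])
      show "eventually (\<lambda>h. 0 = flat_exp k h / h) (at_left 0)"
        unfolding eventually_at_left_field by (intro exI[of _ "-1"]) (simp add: flat_exp_def)
    qed
    ultimately have "((\<lambda>h. flat_exp k h / h) \<longlongrightarrow> 0) (at 0)"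
      by (simp add: filterlim_at_split)
    then have "(flat_exp k has_real_derivative 0) (at 0)"
      unfolding DERIV_def by (simp add: flat_exp_def)
    then show ?thesis using 2 by (simp add: flat_exp_def)
  next
    case 3
    have "((\<lambda>t. exp (- 1 / t) * inverse t ^ k) has_real_derivative
        (flat_exp (k + 2) t - real k * flat_exp (k + 1) t)) (at t)"
    proof -
      have k: "real k * inverse t ^ (k - Suc 0) * (inverse t * inverse t) = real k * inverse t ^ (k + 1)"
        using 3 by (cases k) auto
      have "((\<lambda>t. exp (- 1 / t) * inverse t ^ k) has_real_derivative
        (exp (- 1 / t) * (inverse t * inverse t) * inverse t ^ k +
         exp (- 1 / t) * (real k * inverse t ^ (k - Suc 0) * - (inverse t * inverse t)))) (at t)"
        using 3 by (auto intro!: derivative_eq_intros simp: divide_inverse mult_ac)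
      also have "exp (- 1 / t) * (inverse t * inverse t) * inverse t ^ k +
         exp (- 1 / t) * (real k * inverse t ^ (k - Suc 0) * - (inverse t * inverse t))
         = exp (- 1 / t) * (inverse t * inverse t) * inverse t ^ k - exp (- 1 / t) * (real k * inverse t ^ (k + 1))"
        unfolding k[symmetric] by simp
      also have "\<dots> = flat_exp (k + 2) t - real k * flat_exp (k + 1) t"
        using 3 by (simp add: flat_exp_def divide_inverse power_inverse mult_ac)
      finally show ?thesis .
    qed
    then show ?thesis
      by (rule has_field_derivative_transform_within_open[where S = "{0<..}"])
         (use 3 in \<open>auto simp: flat_exp_def divide_inverse power_inverse\<close>)
  qed
qed

text \<open>
  The algebra generated by the functions \<open>x \<mapsto> flat_exp k (l \<bullet> x + c)\<close> is closed under partial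
  derivatives, so that its elements are smooth; it contains functions with support in a given box.
\<close>

inductive_set flat_algebra :: "('a::euclidean_space \<Rightarrow> real) set" where
  base: "(\<lambda>x. flat_exp k (l \<bullet> x + c)) \<in> flat_algebra"
| const: "(\<lambda>x. c) \<in> flat_algebra"
| add: "v \<in> flat_algebra \<Longrightarrow> w \<in> flat_algebra \<Longrightarrow> (\<lambda>x. v x + w x) \<in> flat_algebra"
| mult: "v \<in> flat_algebra \<Longrightarrow> w \<in> flat_algebra \<Longrightarrow> (\<lambda>x. v x * w x) \<in> flat_algebra"

lemma flat_algebra_derivative:
  assumes "v \<in> flat_algebra"
  shows "\<exists>D. (\<forall>x. (v has_derivative D x) (at x)) \<and> (\<forall>h. (\<lambda>x. D x h) \<in> flat_algebra)"
  using assms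
proof induction
  case (base k l c)
  let ?D = "\<lambda>x h. (flat_exp (k + 2) (l \<bullet> x + c) + (- real k) * flat_exp (k + 1) (l \<bullet> x + c)) * (l \<bullet> h)"
  have "((\<lambda>x. flat_exp k (l \<bullet> x + c)) has_derivative ?D x) (at x)" for x
  proof -
    have "(flat_exp k has_derivative (\<lambda>h. (flat_exp (k + 2) (l \<bullet> x + c) - real k * flat_exp (k + 1) (l \<bullet> x + c)) * h))
       (at (l \<bullet> x + c))"
      using flat_exp_has_derivative by (simp add: has_field_derivative_def)
    then have "((\<lambda>x. flat_exp k (l \<bullet> x + c)) has_derivative
       (\<lambda>h. (flat_exp (k + 2) (l \<bullet> x + c) - real k * flat_exp (k + 1) (l \<bullet> x + c)) * (l \<bullet> h))) (at x)"
      by (rule has_derivative_compose[rotated]) (auto intro!: derivative_eq_intros)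
    then show ?thesis by simp
  qed
  moreover have "(\<lambda>x. ?D x h) \<in> flat_algebra" for h
    by (intro flat_algebra.intros)
  ultimately show ?case by (intro exI[of _ ?D] conjI allI)
next
  case (const c)
  show ?case by (intro exI[of _ "\<lambda>x h. 0"] conjI allI flat_algebra.const) simp
next
  case (add v w)
  then obtain D E where "\<And>x. (v has_derivative D x) (at x)" "\<And>h. (\<lambda>x. D x h) \<in> flat_algebra"
     "\<And>x. (w has_derivative E x) (at x)" "\<And>h. (\<lambda>x. E x h) \<in> flat_algebra" by auto
  then show ?case
    by (intro exI[of _ "\<lambda>x h. D x h + E x h"] conjI allI flat_algebra.add has_derivative_add)
next
  case (mult v w)
  then obtain D E where "\<And>x. (v has_derivative D x) (at x)" "\<And>h. (\<lambda>x. D x h) \<in> flat_algebra"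
     "\<And>x. (w has_derivative E x) (at x)" "\<And>h. (\<lambda>x. E x h) \<in> flat_algebra" by auto
  with mult.hyps show ?case
    by (intro exI[of _ "\<lambda>x h. v x * E x h + D x h * w x"] conjI allI
        flat_algebra.add flat_algebra.mult has_derivative_mult)
qed

lemma flat_algebra_smooth:
  assumes "v \<in> flat_algebra"
  shows "smooth v"
proof (rule smooth_if_closed_under_derivatives[OF assms])
  fix v :: "'a \<Rightarrow> real" assume "v \<in> flat_algebra"
  then obtain D where D: "\<And>x. (v has_derivative D x) (at x)" "\<And>h. (\<lambda>x. D x h) \<in> flat_algebra"
    using flat_algebra_derivative by blast
  show "v differentiable (at x)" for x using D(1) by (rule differentiableI)
  have "frechet_derivative v (at x) = D x" for x
    using frechet_derivative_at[OF D(1)] by simp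
  then show "(\<lambda>x. frechet_derivative v (at x) i) \<in> flat_algebra" for i
    using D(2)[of i] by simp
qed

text \<open>
  The arguments are spelled as affine functions \<open>l \<bullet> x + c\<close> to match the generators of the algebra. The
  factor \<open>n + 1\<close> turns \<open>exp(-1/t)\<close> into \<open>exp(-1/((n + 1) t))\<close>, which tends to 1 for every \<open>t > 0\<close>.
\<close>

definition box_bump :: "'a::euclidean_space \<Rightarrow> 'a \<Rightarrow> nat \<Rightarrow> 'a \<Rightarrow> real" where
  "box_bump a b n x =
     (\<Prod>i\<in>Basis. flat_exp 0 ((real (Suc n) *\<^sub>R i) \<bullet> x + - (real (Suc n) * (a \<bullet> i)))
               * flat_exp 0 (((- real (Suc n)) *\<^sub>R i) \<bullet> x + real (Suc n) * (b \<bullet> i)))"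

lemma box_bump_smooth: "smooth (box_bump a b n)"
proof -
  have "(\<lambda>x. \<Prod>i\<in>A. flat_exp 0 ((real (Suc n) *\<^sub>R i) \<bullet> x + - (real (Suc n) * (a \<bullet> i)))
               * flat_exp 0 (((- real (Suc n)) *\<^sub>R i) \<bullet> x + real (Suc n) * (b \<bullet> i))) \<in> flat_algebra"
    if "finite A" for A
    using that
  proof induction
    case empty
    then show ?case by (simp add: flat_algebra.const)
  next
    case (insert j A)
    then show ?case
      by (simp only: prod.insert flat_algebra.intros not_False_eq_True)
  qed
  then show ?thesis
    unfolding box_bump_def by (intro flat_algebra_smooth) auto
qed

lemma flat_exp_0_range: "0 \<le> flat_exp 0 t" "flat_exp 0 t \<le> 1" "flat_exp 0 t = 0 \<longleftrightarrow> t \<le> 0"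
  by (auto simp: flat_exp_def)

lemma box_bump_range: "0 \<le> box_bump a b n x" "box_bump a b n x \<le> 1"
  unfolding box_bump_def
  by (auto intro!: prod_nonneg prod_le_1 mult_nonneg_nonneg mult_le_one flat_exp_0_range)

lemma box_bump_eq: 
  "box_bump a b n x =
     (\<Prod>i\<in>Basis. flat_exp 0 (real (Suc n) * (x \<bullet> i - a \<bullet> i)) * flat_exp 0 (real (Suc n) * (b \<bullet> i - x \<bullet> i)))"
  unfolding box_bump_def by (simp add: algebra_simps inner_commute del: of_nat_Suc)

lemma box_bump_eq_0_iff: "box_bump a b n x = 0 \<longleftrightarrow> x \<notin> box a b"
proof -
  have "real (Suc n) * t \<le> 0 \<longleftrightarrow> t \<le> 0" for t
    by (simp add: mult_le_0_iff del: of_nat_Suc)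
  then show ?thesis
    unfolding box_bump_eq mem_box by (auto simp: flat_exp_0_range(3) not_less simp del: of_nat_Suc)
qed

lemma box_bump_tendsto: "(\<lambda>n. box_bump a b n x) \<longlonglongrightarrow> indicator (box a b) x"
proof (cases "x \<in> box a b")
  case True
  have lim: "(\<lambda>n. flat_exp 0 (real (Suc n) * t)) \<longlonglongrightarrow> 1" if "0 < t" for t
  proof -
    have "(\<lambda>n. exp (- (inverse (real (Suc n)) * inverse t))) \<longlonglongrightarrow> exp (- (0 * inverse t))"
      by (intro tendsto_intros LIMSEQ_inverse_real_of_nat)
    then show ?thesis using that
      by (simp add: flat_exp_def divide_inverse zero_less_mult_iff del: of_nat_Suc)
  qed
  have "(\<lambda>n. box_bump a b n x) \<longlonglongrightarrow> (\<Prod>i\<in>(Basis::'a set). 1 * 1)"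
    unfolding box_bump_eq using True
    by (intro tendsto_prod tendsto_mult lim) (auto simp: mem_box)
  then show ?thesis using True by simp
next
  case False
  then have "box_bump a b n x = 0" for n by (simp add: box_bump_eq_0_iff)
  then show ?thesis using False by simp
qed

lemma box_bump_test_fun:
  assumes "cbox a b \<subseteq> \<Omega>"
  shows "test_fun \<Omega> (box_bump a b n)"
proof -
  have "{x. box_bump a b n x \<noteq> 0} = box a b" by (auto simp: box_bump_eq_0_iff)
  moreover have *: "closure (box a b) \<subseteq> cbox a b"
    by (rule closure_minimal) (auto simp: box_subset_cbox)
  moreover have "compact (closure (box a b))"
    using bounded_box by (simp add: compact_closure)
  ultimately show ?thesis
    using assms by (auto simp: test_fun_def box_bump_smooth)
qed

text \<open>
  The positive and the negative part of \<open>H\<close> are densities of two finite measures that agree on the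
  open boxes, which form an intersection-stable generator of the Borel sets.
\<close>

lemma integrable_eq_0_if_integral_boxes_0:
  fixes H :: "'a::euclidean_space \<Rightarrow> real"
  assumes int: "integrable lebesgue H"
    and box: "\<And>a b. (LINT x|lebesgue. indicator (box a b) x * H x) = 0"
  shows "AE x in lebesgue. H x = 0"
proof -
  obtain h where h [measurable]: "h \<in> borel_measurable borel" and hH: "AE x in lborel. H x = h x"
    using completion_ex_borel_measurable_real[of H lborel] borel_measurable_integrable[OF int] by auto
  have hH': "AE x in lebesgue. H x = h x" using AE_completion[OF hH] .
  have ih: "integrable lborel h"
  proof -
    have "integrable lebesgue h"
      by (rule integrable_cong_AE_imp[OF int _ hH']) (auto intro: measurable_completion)
    then show ?thesis by (simp add: integrable_completion)
  qed
  have Hm: "H \<in> borel_measurable lebesgue" using int by (rule borel_measurable_integrable)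
  have hm: "h \<in> borel_measurable lebesgue" by (rule measurable_completion) simp
  have bm: "(indicator (box a b) :: 'a \<Rightarrow> real) \<in> borel_measurable lebesgue" for a b
    by (intro borel_measurable_indicator) simp
  have bh: "(LINT x|lborel. indicator (box a b) x * h x) = 0" for a b
  proof -
    have "(LINT x|lborel. indicator (box a b) x * h x) = (LINT x|lebesgue. indicator (box a b) x * h x)"
      by (rule integral_completion[symmetric]) measurable
    also have "\<dots> = (LINT x|lebesgue. indicator (box a b) x * H x)"
      using hH' by (intro integral_cong_AE borel_measurable_times Hm hm bm) auto
    finally show ?thesis using box by simp
  qed
  define M where "M s = density lborel (\<lambda>x. ennreal (s * h x))" for s :: real
  have fin: "emeasure (M s) A \<noteq> \<infinity>" if "A \<in> sets borel" for A s
  proof -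
    have "emeasure (M s) A = (\<integral>\<^sup>+x. ennreal (s * h x) * indicator A x \<partial>lborel)"
      unfolding M_def using that by (intro emeasure_density) auto
    also have "\<dots> \<le> (\<integral>\<^sup>+x. ennreal (norm (s * h x)) \<partial>lborel)"
      by (intro nn_integral_mono) (auto simp: indicator_def intro!: ennreal_leI)
    also have "\<dots> < \<infinity>"
      using ih by (intro integrable_iff_bounded[THEN iffD1, THEN conjunct2] integrable_mult_right) 
    finally show ?thesis by simp
  qed
  \<comment> \<open>\<open>M 1\<close> and \<open>M (-1)\<close> have the positive and the negative part of \<open>h\<close> as densities.\<close>
  have eqbox: "emeasure (M 1) (box a b) = emeasure (M (-1)) (box a b)" for a b
  proof -
    have i: "integrable lborel (\<lambda>x. indicator (box a b) x * h x)"
      using integrable_real_mult_indicator[OF _ ih, of "box a b"] by (simp add: mult.commute)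
    have e: "emeasure (M s) (box a b) = (\<integral>\<^sup>+x. ennreal (s * (indicator (box a b) x * h x)) \<partial>lborel)" for s
      unfolding M_def by (subst emeasure_density) (auto intro!: nn_integral_cong simp: indicator_def)
    have f: "emeasure (M s) (box a b) = ennreal (measure (M s) (box a b))" for s
      using fin[of "box a b" s] by (intro emeasure_eq_ennreal_measure) auto
    have "(LINT x|lborel. indicator (box a b) x * h x) =
        measure (M 1) (box a b) - measure (M (-1)) (box a b)"
      unfolding real_lebesgue_integral_def[OF i] using e[of 1] e[of "-1"] by (simp add: measure_def)
    then show ?thesis using bh f by simp
  qed
  have "M 1 = M (-1)"
  proof (rule measure_eqI_generator_eq)
    let ?E = "range (\<lambda>(a, b). box a b::'a set)"
    show "Int_stable ?E"
      by (auto simp: Int_stable_def box_Int_box)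
    show "?E \<subseteq> Pow UNIV" "sets (M 1) = sigma_sets UNIV ?E" "sets (M (-1)) = sigma_sets UNIV ?E"
      by (simp_all add: borel_eq_box M_def)
    let ?A = "\<lambda>n::nat. box (- (real n *\<^sub>R One)) (real n *\<^sub>R One) :: 'a set"
    show "range ?A \<subseteq> ?E" "(\<Union>i. ?A i) = UNIV"
      unfolding UN_box_eq_UNIV by auto
    show "emeasure (M 1) (?A i) \<noteq> \<infinity>" for i using fin by auto
    show "emeasure (M 1) X = emeasure (M (-1)) X" if "X \<in> ?E" for X
      using that eqbox by auto
  qed
  then have "AE x in lborel. ennreal (1 * h x) = ennreal (-1 * h x)"
    unfolding M_def by (intro sigma_finite_measure.density_unique[OF sigma_finite_lborel]) auto
  then have "AE x in lborel. h x = 0"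
  proof eventually_elim
    case (elim x)
    then show ?case by (cases "h x" "0::real" rule: linorder_cases) (auto simp: ennreal_neg ennreal_eq_0_iff)
  qed
  then have "AE x in lebesgue. h x = 0" by (rule AE_completion)
  with hH' show ?thesis by eventually_elim simp
qed


lemma integral_box_eq_0_if_test_fun:
  fixes H :: "'a::euclidean_space \<Rightarrow> real"
  assumes \<Omega>: "open \<Omega>" and H: "locally_integrable \<Omega> H"
    and test: "\<And>\<phi>. test_fun \<Omega> \<phi> \<Longrightarrow> (LINT x|lebesgue_on \<Omega>. H x * \<phi> x) = 0"
    and ab: "cbox a b \<subseteq> \<Omega>"
  shows "(LINT x|lebesgue. indicator (box a b) x * H x) = 0"
proof -
  have i: "integrable lebesgue (\<lambda>x. indicator (cbox a b) x * H x)"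
    using H ab by (auto simp: locally_integrable_def set_integrable_def compact_cbox)
  have e: "H x * box_bump a b n x = box_bump a b n x * (indicator (cbox a b) x * H x)" for n x
    using box_subset_cbox[of a b] box_bump_eq_0_iff[of a b n x]
    by (cases "x \<in> cbox a b") auto
  have bm: "box_bump a b n \<in> borel_measurable lebesgue" for n
    by (intro measurable_completion)
       (auto intro!: borel_measurable_continuous_onI C1_fun_continuous smooth_imp_C1_fun box_bump_smooth)
  have bm': "(indicator (box a b) :: 'a \<Rightarrow> real) \<in> borel_measurable lebesgue"
    by (intro borel_measurable_indicator) simp
  have "(\<lambda>n. LINT x|lebesgue. box_bump a b n x * (indicator (cbox a b) x * H x))
     \<longlonglongrightarrow> (LINT x|lebesgue. indicator (box a b) x * (indicator (cbox a b) x * H x))"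
  proof (rule integral_dominated_convergence[where w = "\<lambda>x. norm (indicator (cbox a b) x * H x)"])
    show "integrable lebesgue (\<lambda>x. norm (indicator (cbox a b) x * H x))"
      using i by (rule integrable_norm)
    show "(\<lambda>x. indicator (box a b) x * (indicator (cbox a b) x * H x)) \<in> borel_measurable lebesgue"
      "(\<lambda>x. box_bump a b n x * (indicator (cbox a b) x * H x)) \<in> borel_measurable lebesgue" for n
      by (intro borel_measurable_times bm bm' borel_measurable_integrable[OF i])+
    show "AE x in lebesgue. (\<lambda>n. box_bump a b n x * (indicator (cbox a b) x * H x))
       \<longlonglongrightarrow> indicator (box a b) x * (indicator (cbox a b) x * H x)"
      by (intro AE_I2 tendsto_mult_right box_bump_tendsto)
    show "AE x in lebesgue. norm (box_bump a b n x * (indicator (cbox a b) x * H x))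
        \<le> norm (indicator (cbox a b) x * H x)" for n
    proof (rule AE_I2)
      fix x
      have "\<bar>box_bump a b n x\<bar> \<le> 1" using box_bump_range[of a b n x] by simp
      then show "norm (box_bump a b n x * (indicator (cbox a b) x * H x)) \<le> norm (indicator (cbox a b) x * H x)"
        unfolding norm_mult by (intro mult_left_le_one_le) auto
    qed
  qed
  moreover have "(LINT x|lebesgue. box_bump a b n x * (indicator (cbox a b) x * H x)) = 0" for n
  proof -
    have "(LINT x|lebesgue_on \<Omega>. H x * box_bump a b n x) = (LINT x|lebesgue. indicator \<Omega> x *\<^sub>R (H x * box_bump a b n x))"
      using \<Omega> by (intro integral_restrict_space) auto
    also have "(\<lambda>x. indicator \<Omega> x *\<^sub>R (H x * box_bump a b n x)) = (\<lambda>x. box_bump a b n x * (indicator (cbox a b) x * H x))"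
      unfolding e using ab by (auto simp: indicator_def fun_eq_iff)
    finally show ?thesis using test[OF box_bump_test_fun[OF ab]] by simp
  qed
  ultimately have "(LINT x|lebesgue. indicator (box a b) x * (indicator (cbox a b) x * H x)) = 0"
    by (simp add: LIMSEQ_const_iff)
  moreover have "indicator (box a b) x * (indicator (cbox a b) x * H x) = indicator (box a b) x * H x" for x
    using box_subset_cbox[of a b] by (auto simp: indicator_def)
  ultimately show ?thesis by simp
qed

text \<open>
  The fundamental lemma of the calculus of variations: the test functions approximate indicator
  functions of boxes boundedly and pointwise, and boxes generate the Borel sets.
\<close>

lemma AE_eq_0_if_test_fun:
  fixes H :: "'a::euclidean_space \<Rightarrow> real"
  assumes \<Omega>: "open \<Omega>" and H: "locally_integrable \<Omega> H"
    and test: "\<And>\<phi>. test_fun \<Omega> \<phi> \<Longrightarrow> (LINT x|lebesgue_on \<Omega>. H x * \<phi> x) = 0"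
  shows "AE x in lebesgue_on \<Omega>. H x = 0"
proof -
  obtain \<D> where D: "countable \<D>" "\<D> \<subseteq> Pow \<Omega>" "\<And>X. X \<in> \<D> \<Longrightarrow> \<exists>a b. X = cbox a b" "\<Union>\<D> = \<Omega>"
    using open_countable_Union_open_cbox[OF \<Omega>] by metis
  have "AE x in lebesgue. x \<in> X \<longrightarrow> H x = 0" if X: "X \<in> \<D>" for X
  proof -
    obtain c d where X': "X = cbox c d" "cbox c d \<subseteq> \<Omega>" using D X by blast
    have i: "integrable lebesgue (\<lambda>x. indicator (cbox c d) x * H x)"
      using H X' by (auto simp: locally_integrable_def set_integrable_def compact_cbox)
    have e: "indicator (box c d) x * (indicator (cbox c d) x * H x) = indicator (box c d) x * H x" for x
      using box_subset_cbox[of c d] by (auto simp: indicator_def)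
    have i': "integrable lebesgue (\<lambda>x. indicator (box c d) x * H x)"
    proof -
      have "integrable lebesgue (\<lambda>x. (indicator (cbox c d) x * H x) * indicator (box c d) x)"
        using i by (rule integrable_real_mult_indicator[rotated]) simp
      then show ?thesis unfolding mult.commute[of _ "indicator (box c d) _"] e .
    qed
    have "AE x in lebesgue. indicator (box c d) x * H x = 0"
    proof (rule integrable_eq_0_if_integral_boxes_0[OF i'])
      fix a b :: 'a
      obtain a' b' where *: "box a b \<inter> box c d = box a' b'" "cbox a b \<inter> cbox c d = cbox a' b'"
        using box_Int_box Int_interval by blast
      have "(LINT x|lebesgue. indicator (box a' b') x * H x) = 0"
        using integral_box_eq_0_if_test_fun[OF \<Omega> H test] *(2) X'(2) by blast
      also have "(\<lambda>x. indicator (box a' b') x * H x) = (\<lambda>x. indicator (box a b) x * (indicator (box c d) x * H x))"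
        unfolding *(1)[symmetric] by (auto simp: indicator_def)
      finally show "(LINT x|lebesgue. indicator (box a b) x * (indicator (box c d) x * H x)) = 0" .
    qed
    moreover have "AE x in lebesgue. x \<notin> cbox c d - box c d"
      using negligible_frontier_interval[of c d] negligible_iff_null_sets AE_not_in by blast
    ultimately show ?thesis
      unfolding X' by eventually_elim (auto simp: indicator_def split: if_splits)
  qed
  then have "AE x in lebesgue. \<forall>X\<in>\<D>. x \<in> X \<longrightarrow> H x = 0"
    using D(1) by (intro AE_ball_countable[THEN iffD2] ballI) auto
  then have "AE x in lebesgue. x \<in> \<Omega> \<longrightarrow> H x = 0"
    by eventually_elim (use D(4) in blast)
  then show ?thesis using \<Omega> by (simp add: AE_restrict_space_iff)
qed

lemma has_weak_gradient_unique:
  assumes \<Omega>: "open \<Omega>" and G: "has_weak_gradient \<Omega> u G" and H: "has_weak_gradient \<Omega> u H"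
  shows "AE x in lebesgue_on \<Omega>. G x = H x"
proof -
  have "AE x in lebesgue_on \<Omega>. (G x - H x) \<bullet> i = 0" if i: "i \<in> Basis" for i
  proof (rule AE_eq_0_if_test_fun[OF \<Omega>])
    have "locally_integrable \<Omega> (\<lambda>x. 1 *\<^sub>R G x + (-1) *\<^sub>R H x)"
      using G H by (intro locally_integrable_linear_combination) (auto simp: has_weak_gradient_def)
    then show "locally_integrable \<Omega> (\<lambda>x. (G x - H x) \<bullet> i)"
      unfolding locally_integrable_def set_integrable_def
      by (auto dest!: spec intro!: integrable_inner_left simp flip: inner_scaleR_left)
    fix \<phi> assume \<phi>: "test_fun \<Omega> \<phi>"
    have "(LINT x|lebesgue_on \<Omega>. ((G x - H x) \<bullet> i) * \<phi> x) =
      (LINT x|lebesgue_on \<Omega>. (G x \<bullet> i) * \<phi> x) - (LINT x|lebesgue_on \<Omega>. (H x \<bullet> i) * \<phi> x)"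
      using has_weak_gradient_integrable(2)[OF \<Omega> G \<phi> i] has_weak_gradient_integrable(2)[OF \<Omega> H \<phi> i]
      by (simp add: inner_diff_left left_diff_distrib)
    also have "\<dots> = 0" using G H \<phi> i by (auto simp: has_weak_gradient_def)
    finally show "(LINT x|lebesgue_on \<Omega>. ((G x - H x) \<bullet> i) * \<phi> x) = 0" .
  qed
  then have "AE x in lebesgue_on \<Omega>. \<forall>i\<in>Basis. (G x - H x) \<bullet> i = 0"
    by (intro AE_finite_allI) auto
  then show ?thesis
    by eventually_elim (auto simp: euclidean_eq_iff[of "G _"] inner_diff_left)
qed

text \<open>
  Local integrability gives measurability on compact subsets, and countably many boxes exhaust the
  open set.
\<close>

lemma locally_integrable_measurable:
  fixes h :: "'a::euclidean_space \<Rightarrow> 'b::euclidean_space"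
  assumes \<Omega>: "open \<Omega>" and h: "locally_integrable \<Omega> h"
  shows "h \<in> borel_measurable (lebesgue_on \<Omega>)"
proof -
  obtain \<D> where D: "countable \<D>" "\<D> \<subseteq> Pow \<Omega>" "\<And>X. X \<in> \<D> \<Longrightarrow> \<exists>a b. X = cbox a b" "\<Union>\<D> = \<Omega>"
    using open_countable_Union_open_cbox[OF \<Omega>] by metis
  show ?thesis
  proof (rule measurable_piecewise_restrict[OF D(1)])
    fix X assume X: "X \<in> \<D>"
    then obtain c d where X': "X = cbox c d" "cbox c d \<subseteq> \<Omega>" using D by blast
    show "X \<inter> space (lebesgue_on \<Omega>) \<in> sets (lebesgue_on \<Omega>)"
      using X' \<Omega> by (auto simp: sets_restrict_space_iff)
    have "set_integrable lebesgue (cbox c d) h"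
      using h X' by (auto simp: locally_integrable_def compact_cbox)
    then have "h \<in> borel_measurable (lebesgue_on (cbox c d))"
      by (simp add: borel_measurable_restrict_space_iff borel_measurable_integrable set_integrable_def)
    moreover have "restrict_space (lebesgue_on \<Omega>) X = lebesgue_on (cbox c d)"
      using X' \<Omega> by (subst restrict_restrict_space) (auto simp: Int_absorb1)
    ultimately show "h \<in> borel_measurable (restrict_space (lebesgue_on \<Omega>) X)" by simp
  qed (use D in auto)
qed


section \<open>The space \<open>W\<^sup>1\<^sup>,\<^sup>p\<close> and traces\<close>

lemma sobolev_W1_has_weak_gradient:
  "u \<in> sobolev_W1 \<Omega> p \<Longrightarrow> has_weak_gradient \<Omega> u (weak_gradient \<Omega> u)"
  unfolding sobolev_W1_def weak_gradient_def by (auto intro: someI[of "has_weak_gradient \<Omega> u"])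

lemma Lp_fun_AE_cong:
  assumes "Lp_fun M r g" "h \<in> borel_measurable M" "AE x in M. g x = h x"
  shows "Lp_fun M r h"
  unfolding Lp_fun_def
proof
  show "integrable M (\<lambda>x. norm (h x) powr r)"
  proof (rule integrable_cong_AE_imp)
    show "integrable M (\<lambda>x. norm (g x) powr r)" using assms(1) by (simp add: Lp_fun_def)
    show "(\<lambda>x. norm (h x) powr r) \<in> borel_measurable M"
      using assms(2) by measurable
    show "AE x in M. norm (g x) powr r = norm (h x) powr r"
      using assms(3) by eventually_elim simp
  qed
qed fact

text \<open>
  The chosen weak gradient agrees almost everywhere with the integrable one that membership provides.
\<close>

lemma sobolev_W1_gradient_Lp:
  assumes "open \<Omega>" "u \<in> sobolev_W1 \<Omega> p"
  shows "Lp_fun (lebesgue_on \<Omega>) p (weak_gradient \<Omega> u)"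
proof -
  obtain G where G: "has_weak_gradient \<Omega> u G" "Lp_fun (lebesgue_on \<Omega>) p G"
    using assms(2) by (auto simp: sobolev_W1_def)
  have W: "has_weak_gradient \<Omega> u (weak_gradient \<Omega> u)"
    using assms(2) by (rule sobolev_W1_has_weak_gradient)
  show ?thesis
  proof (rule Lp_fun_AE_cong[OF G(2)])
    show "weak_gradient \<Omega> u \<in> borel_measurable (lebesgue_on \<Omega>)"
      using W by (intro locally_integrable_measurable assms) (simp add: has_weak_gradient_def)
    show "AE x in lebesgue_on \<Omega>. G x = weak_gradient \<Omega> u x"
      by (rule has_weak_gradient_unique[OF assms(1) G(1) W])
  qed
qed

lemma sobolev_W1_Lp: "u \<in> sobolev_W1 \<Omega> p \<Longrightarrow> Lp_fun (lebesgue_on \<Omega>) p u"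
  by (simp add: sobolev_W1_def)

lemma Lp_fun_linear_combination:
  fixes g h :: "'a \<Rightarrow> 'b::{second_countable_topology,real_normed_vector}"
  assumes "Lp_fun M r g" "Lp_fun M r h" "0 \<le> r"
  shows "Lp_fun M r (\<lambda>x. a *\<^sub>R g x + b *\<^sub>R h x)"
  using assms by (intro Lp_fun_add Lp_fun_scaleR)

lemma sobolev_W1_linear_combination:
  assumes \<Omega>: "open \<Omega>" and u: "u \<in> sobolev_W1 \<Omega> p" and v: "v \<in> sobolev_W1 \<Omega> p" and p: "0 \<le> p"
  shows "(\<lambda>x. a * u x + b * v x) \<in> sobolev_W1 \<Omega> p"
    and "AE x in lebesgue_on \<Omega>. weak_gradient \<Omega> (\<lambda>x. a * u x + b * v x) x =
           a *\<^sub>R weak_gradient \<Omega> u x + b *\<^sub>R weak_gradient \<Omega> v x"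
proof -
  let ?G = "\<lambda>x. a *\<^sub>R weak_gradient \<Omega> u x + b *\<^sub>R weak_gradient \<Omega> v x"
  have G: "has_weak_gradient \<Omega> (\<lambda>x. a * u x + b * v x) ?G"
    by (intro has_weak_gradient_linear_combination sobolev_W1_has_weak_gradient[OF u]
        sobolev_W1_has_weak_gradient[OF v] \<Omega>)
  moreover have "Lp_fun (lebesgue_on \<Omega>) p ?G"
    by (intro Lp_fun_linear_combination sobolev_W1_gradient_Lp assms)
  moreover have "Lp_fun (lebesgue_on \<Omega>) p (\<lambda>x. a * u x + b * v x)"
    using Lp_fun_linear_combination[OF sobolev_W1_Lp[OF u] sobolev_W1_Lp[OF v] p, of a b] by simp
  ultimately show *: "(\<lambda>x. a * u x + b * v x) \<in> sobolev_W1 \<Omega> p"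
    by (auto simp: sobolev_W1_def)
  show "AE x in lebesgue_on \<Omega>. weak_gradient \<Omega> (\<lambda>x. a * u x + b * v x) x = ?G x"
    by (rule has_weak_gradient_unique[OF \<Omega> sobolev_W1_has_weak_gradient[OF *] G])
qed

lemma continuous_bounded_on_bounded:
  fixes h :: "'a::euclidean_space \<Rightarrow> 'b::real_normed_vector"
  assumes "continuous_on UNIV h" "bounded A"
  obtains B where "\<And>x. x \<in> A \<Longrightarrow> norm (h x) \<le> B"
proof -
  have "compact (h ` closure A)"
    using assms by (intro compact_continuous_image) (auto intro: continuous_on_subset simp: compact_closure)
  then obtain B where "\<And>y. y \<in> h ` closure A \<Longrightarrow> norm y \<le> B"
    using bounded_iff compact_imp_bounded by metis
  then show ?thesis using that closure_subset[of A] by blast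
qed

lemma finite_measure_lebesgue_on_open:
  fixes \<Omega> :: "'a::euclidean_space set"
  assumes "open \<Omega>" "bounded \<Omega>"
  shows "finite_measure (lebesgue_on \<Omega>)"
proof (rule finite_measure_lebesgue_on)
  show "\<Omega> \<in> lmeasurable" using assms by (simp add: lmeasurable_open)
qed

lemma Lp_fun_continuous_lebesgue_on:
  fixes h :: "'a::euclidean_space \<Rightarrow> 'b::euclidean_space"
  assumes "open \<Omega>" "bounded \<Omega>" "continuous_on UNIV h" "0 \<le> p"
  shows "Lp_fun (lebesgue_on \<Omega>) p h"
proof -
  obtain B where B: "\<And>x. x \<in> \<Omega> \<Longrightarrow> norm (h x) \<le> B"
    using continuous_bounded_on_bounded[OF assms(3,2)] by blast
  interpret finite_measure "lebesgue_on \<Omega>" using assms by (intro finite_measure_lebesgue_on_open)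
  show ?thesis
    using assms B by (intro Lp_fun_bounded[of _ B])
      (auto intro!: measurable_restrict_space1 measurable_completion borel_measurable_continuous_onI)
qed

lemma C1_fun_sobolev_W1:
  fixes v :: "'a::euclidean_space \<Rightarrow> real"
  assumes "open \<Omega>" "bounded \<Omega>" "C1_fun v" "0 \<le> p"
  shows "v \<in> sobolev_W1 \<Omega> p"
    and "AE x in lebesgue_on \<Omega>. weak_gradient \<Omega> v x = gradient v x"
proof -
  have G: "has_weak_gradient \<Omega> v (gradient v)"
    using assms by (intro C1_fun_has_weak_gradient)
  show *: "v \<in> sobolev_W1 \<Omega> p"
    unfolding sobolev_W1_def using assms G
      Lp_fun_continuous_lebesgue_on[OF assms(1,2) C1_fun_continuous[OF assms(3)] assms(4)]
      Lp_fun_continuous_lebesgue_on[OF assms(1,2) C1_fun_continuous_gradient[OF assms(3)] assms(4)]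
    by blast
  show "AE x in lebesgue_on \<Omega>. weak_gradient \<Omega> v x = gradient v x"
    by (rule has_weak_gradient_unique[OF assms(1) sobolev_W1_has_weak_gradient[OF *] G])
qed

text \<open>
  Convergence to 0 in \<open>L\<^sup>p\<close>. Membership in \<open>L\<^sup>p\<close> is included, since the Bochner integral of a function
  that fails to be integrable is 0.
\<close>

definition Lp_null :: "'a measure \<Rightarrow> real \<Rightarrow> (nat \<Rightarrow> 'a \<Rightarrow> 'b::real_normed_vector) \<Rightarrow> bool" where
  "Lp_null M p h \<longleftrightarrow> (\<forall>n. Lp_fun M p (h n)) \<and> (\<lambda>n. LINT x|M. norm (h n x) powr p) \<longlonglongrightarrow> 0"

lemma Lp_null_linear_combination:
  fixes g h :: "nat \<Rightarrow> 'a \<Rightarrow> 'b::{second_countable_topology,real_normed_vector}"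
  assumes g: "Lp_null M p g" and h: "Lp_null M p h" and p: "0 \<le> p"
  shows "Lp_null M p (\<lambda>n x. a *\<^sub>R g n x + b *\<^sub>R h n x)"
  unfolding Lp_null_def
proof (intro conjI allI)
  have L: "Lp_fun M p (g n)" "Lp_fun M p (h n)" for n using g h by (auto simp: Lp_null_def)
  then show lc: "Lp_fun M p (\<lambda>x. a *\<^sub>R g n x + b *\<^sub>R h n x)" for n
    using p by (intro Lp_fun_linear_combination)
  let ?I = "\<lambda>f. LINT x|M. norm (f x) powr p"
  have le: "?I (\<lambda>x. a *\<^sub>R g n x + b *\<^sub>R h n x) \<le> 2 powr p * (\<bar>a\<bar> powr p * ?I (g n) + \<bar>b\<bar> powr p * ?I (h n))" for n
  proof -
    have i: "integrable M (\<lambda>x. norm (g n x) powr p)" "integrable M (\<lambda>x. norm (h n x) powr p)"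
      using L[of n] by (auto simp: Lp_fun_def)
    have "?I (\<lambda>x. a *\<^sub>R g n x + b *\<^sub>R h n x) \<le>
       (LINT x|M. 2 powr p * (\<bar>a\<bar> powr p * norm (g n x) powr p + \<bar>b\<bar> powr p * norm (h n x) powr p))"
    proof (rule integral_mono)
      show "integrable M (\<lambda>x. norm (a *\<^sub>R g n x + b *\<^sub>R h n x) powr p)"
        using lc by (simp add: Lp_fun_def)
      show "integrable M (\<lambda>x. 2 powr p * (\<bar>a\<bar> powr p * norm (g n x) powr p + \<bar>b\<bar> powr p * norm (h n x) powr p))"
        using i by simp
      show "norm (a *\<^sub>R g n x + b *\<^sub>R h n x) powr p \<le>
         2 powr p * (\<bar>a\<bar> powr p * norm (g n x) powr p + \<bar>b\<bar> powr p * norm (h n x) powr p)" for x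
        using norm_add_powr_le[OF p, of "a *\<^sub>R g n x" "b *\<^sub>R h n x"] by (simp add: powr_mult)
    qed
    also have "\<dots> = 2 powr p * (\<bar>a\<bar> powr p * ?I (g n) + \<bar>b\<bar> powr p * ?I (h n))"
      using i by simp
    finally show ?thesis .
  qed
  have "(\<lambda>n. 2 powr p * (\<bar>a\<bar> powr p * ?I (g n) + \<bar>b\<bar> powr p * ?I (h n))) \<longlonglongrightarrow>
      2 powr p * (\<bar>a\<bar> powr p * 0 + \<bar>b\<bar> powr p * 0)"
    using g h by (intro tendsto_intros) (auto simp: Lp_null_def)
  then have *: "(\<lambda>n. 2 powr p * (\<bar>a\<bar> powr p * ?I (g n) + \<bar>b\<bar> powr p * ?I (h n))) \<longlonglongrightarrow> 0"
    by simp
  show "(\<lambda>n. ?I (\<lambda>x. a *\<^sub>R g n x + b *\<^sub>R h n x)) \<longlonglongrightarrow> 0"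
    by (rule tendsto_sandwich[OF _ _ tendsto_const *]) (auto intro!: always_eventually le integral_nonneg_AE)
qed

lemma sobolev_norm_tendsto_0_iff:
  assumes \<Omega>: "open \<Omega>" and p: "0 < p" and w: "\<And>n. w n \<in> sobolev_W1 \<Omega> p"
  shows "(\<lambda>n. sobolev_norm \<Omega> p (w n)) \<longlonglongrightarrow> 0 \<longleftrightarrow>
    Lp_null (lebesgue_on \<Omega>) p w \<and> Lp_null (lebesgue_on \<Omega>) p (\<lambda>n. weak_gradient \<Omega> (w n))"
proof -
  let ?U = "\<lambda>n. LINT x|lebesgue_on \<Omega>. \<bar>w n x\<bar> powr p"
  let ?V = "\<lambda>n. LINT x|lebesgue_on \<Omega>. norm (weak_gradient \<Omega> (w n) x) powr p"
  have nn: "0 \<le> ?U n" "0 \<le> ?V n" for n by (auto intro!: integral_nonneg_AE)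
  have "(\<lambda>n. sobolev_norm \<Omega> p (w n)) \<longlonglongrightarrow> 0 \<longleftrightarrow> (\<lambda>n. ?U n + ?V n) \<longlonglongrightarrow> 0"
  proof
    assume "(\<lambda>n. sobolev_norm \<Omega> p (w n)) \<longlonglongrightarrow> 0"
    then have "(\<lambda>n. sobolev_norm \<Omega> p (w n) powr p) \<longlonglongrightarrow> 0 powr p"
      using p by (intro tendsto_powr2) (auto simp: sobolev_norm_def)
    then show "(\<lambda>n. ?U n + ?V n) \<longlonglongrightarrow> 0"
      using p nn by (simp add: sobolev_norm_def powr_powr)
  next
    assume "(\<lambda>n. ?U n + ?V n) \<longlonglongrightarrow> 0"
    then have "(\<lambda>n. (?U n + ?V n) powr (1/p)) \<longlonglongrightarrow> 0 powr (1/p)"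
      using p nn by (intro tendsto_powr2) auto
    then show "(\<lambda>n. sobolev_norm \<Omega> p (w n)) \<longlonglongrightarrow> 0"
      by (simp add: sobolev_norm_def)
  qed
  also have "\<dots> \<longleftrightarrow> ?U \<longlonglongrightarrow> 0 \<and> ?V \<longlonglongrightarrow> 0"
  proof safe
    assume *: "(\<lambda>n. ?U n + ?V n) \<longlonglongrightarrow> 0"
    show "?U \<longlonglongrightarrow> 0" by (rule tendsto_sandwich[OF _ _ tendsto_const *]) (use nn in auto)
    show "?V \<longlonglongrightarrow> 0" by (rule tendsto_sandwich[OF _ _ tendsto_const *]) (use nn in auto)
  next
    assume "?U \<longlonglongrightarrow> 0" "?V \<longlonglongrightarrow> 0"
    from tendsto_add[OF this] show "(\<lambda>n. ?U n + ?V n) \<longlonglongrightarrow> 0" by simp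
  qed
  also have "\<dots> \<longleftrightarrow> Lp_null (lebesgue_on \<Omega>) p w \<and> Lp_null (lebesgue_on \<Omega>) p (\<lambda>n. weak_gradient \<Omega> (w n))"
    using sobolev_W1_Lp[OF w] sobolev_W1_gradient_Lp[OF \<Omega> w] by (simp add: Lp_null_def)
  finally show ?thesis .
qed

lemma Lp_null_AE_cong:
  assumes g: "Lp_null M p g" and h: "\<And>n. h n \<in> borel_measurable M" "\<And>n. AE x in M. h n x = g n x"
  shows "Lp_null M p h"
  unfolding Lp_null_def
proof (intro conjI allI)
  have g': "Lp_fun M p (g n)" for n using g by (simp add: Lp_null_def)
  have h': "AE x in M. g n x = h n x" for n using h(2)[of n] by eventually_elim simp
  show L: "Lp_fun M p (h n)" for n
    by (rule Lp_fun_AE_cong[OF g' h(1) h'])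
  have "(LINT x|M. norm (h n x) powr p) = (LINT x|M. norm (g n x) powr p)" for n
    using L[of n] g'[of n] h'[of n]
    by (intro integral_cong_AE) (auto simp: Lp_fun_def)
  then show "(\<lambda>n. LINT x|M. norm (h n x) powr p) \<longlonglongrightarrow> 0"
    using g by (simp add: Lp_null_def)
qed

lemma sobolev_null_linear_combination:
  assumes \<Omega>: "open \<Omega>" and p: "0 < p"
    and v: "\<And>n. v n \<in> sobolev_W1 \<Omega> p" "(\<lambda>n. sobolev_norm \<Omega> p (v n)) \<longlonglongrightarrow> 0"
    and w: "\<And>n. w n \<in> sobolev_W1 \<Omega> p" "(\<lambda>n. sobolev_norm \<Omega> p (w n)) \<longlonglongrightarrow> 0"
  shows "(\<lambda>n. sobolev_norm \<Omega> p (\<lambda>x. a * v n x + b * w n x)) \<longlonglongrightarrow> 0"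
proof -
  have lc: "(\<lambda>x. a * v n x + b * w n x) \<in> sobolev_W1 \<Omega> p" for n
    using p by (intro sobolev_W1_linear_combination \<Omega> v w) auto
  have V: "Lp_null (lebesgue_on \<Omega>) p v" "Lp_null (lebesgue_on \<Omega>) p (\<lambda>n. weak_gradient \<Omega> (v n))"
    using sobolev_norm_tendsto_0_iff[OF \<Omega> p v(1)] v(2) by auto
  have W: "Lp_null (lebesgue_on \<Omega>) p w" "Lp_null (lebesgue_on \<Omega>) p (\<lambda>n. weak_gradient \<Omega> (w n))"
    using sobolev_norm_tendsto_0_iff[OF \<Omega> p w(1)] w(2) by auto
  have "Lp_null (lebesgue_on \<Omega>) p (\<lambda>n x. a * v n x + b * w n x)"
    using Lp_null_linear_combination[OF V(1) W(1), of a b] p by simp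
  moreover have "Lp_null (lebesgue_on \<Omega>) p (\<lambda>n. weak_gradient \<Omega> (\<lambda>x. a * v n x + b * w n x))"
  proof (rule Lp_null_AE_cong[OF Lp_null_linear_combination[OF V(2) W(2), of a b]])
    show "0 \<le> p" using p by simp
    show "weak_gradient \<Omega> (\<lambda>x. a * v n x + b * w n x) \<in> borel_measurable (lebesgue_on \<Omega>)" for n
      using sobolev_W1_gradient_Lp[OF \<Omega> lc] by (simp add: Lp_fun_def)
    show "AE x in lebesgue_on \<Omega>. weak_gradient \<Omega> (\<lambda>x. a * v n x + b * w n x) x =
        a *\<^sub>R weak_gradient \<Omega> (v n) x + b *\<^sub>R weak_gradient \<Omega> (w n) x" for n
      using p by (intro sobolev_W1_linear_combination(2)[OF \<Omega> v(1) w(1)]) auto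
  qed
  ultimately show ?thesis using sobolev_norm_tendsto_0_iff[OF \<Omega> p lc] by simp
qed


section \<open>Surface measure of a Lipschitz graph\<close>

lemma sets_hausdorff_measure [simp, measurable_cong]: "sets (hausdorff_measure k) = sets borel"
  unfolding hausdorff_measure_def using sets.sigma_sets_eq[of borel] by (simp add: sets.space_closed)

text \<open>
  The measure equals the outer measure on Borel sets or, should countable additivity fail, is zero by
  convention. The inequality holds either way.
\<close>

lemma emeasure_hausdorff_measure_le: "emeasure (hausdorff_measure k) E \<le> hausdorff_outer k E"
  unfolding hausdorff_measure_def by (subst emeasure_measure_of_conv) auto

text \<open>
  A finite Borel measure whose mass on small balls around the points of \<open>E\<close> is at least
  \<open>c \<rho>\<^sup>k\<close> dominates the \<open>k\<close>-dimensional Hausdorff measure on \<open>E\<close> up to a constant factor: by Vitali's lemma \<open>E\<close> is covered by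
  five times enlarged disjoint balls inside an open neighbourhood of almost the same mass.
\<close>

lemma hausdorff_outer_le_if_density:
  fixes \<nu> :: "'a::euclidean_space measure"
  assumes fin: "finite_measure \<nu>" and sets: "sets \<nu> = sets borel" and E: "E \<in> sets borel"
    and c: "0 < c" and \<rho>0: "0 < \<rho>\<^sub>0"
    and dens: "\<And>y \<rho>. y \<in> E \<Longrightarrow> 0 < \<rho> \<Longrightarrow> \<rho> \<le> \<rho>\<^sub>0 \<Longrightarrow> ennreal (c * \<rho> ^ k) \<le> emeasure \<nu> (cball y \<rho>)"
  shows "hausdorff_outer k E \<le> ennreal (unit_ball_vol (real k) * 5 ^ k / c) * emeasure \<nu> E"
proof -
  define K where "K = unit_ball_vol (real k) * 5 ^ k / c"
  have K: "0 \<le> K" using c by (simp add: K_def)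
  interpret finite_measure \<nu> by (rule fin)
  have content: "hausdorff_content k \<delta> E \<le> ennreal K * emeasure \<nu> U"
    if "0 < \<delta>" "open U" "E \<subseteq> U" for \<delta> U
  proof -
    have "\<exists>r. 0 < r \<and> r \<le> min \<rho>\<^sub>0 (\<delta> / 10) \<and> cball y r \<subseteq> U" if yE: "y \<in> E" for y
    proof -
      obtain e where "0 < e" "cball y e \<subseteq> U"
        using open_contains_cball_eq[OF \<open>open U\<close>] \<open>E \<subseteq> U\<close> yE by blast
      then show ?thesis
        using \<rho>0 \<open>0 < \<delta>\<close> by (intro exI[of _ "min e (min \<rho>\<^sub>0 (\<delta> / 10))"]) auto
    qed
    then obtain r where r: "\<And>y. y \<in> E \<Longrightarrow> 0 < r y \<and> r y \<le> min \<rho>\<^sub>0 (\<delta> / 10) \<and> cball y (r y) \<subseteq> U"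
      by metis
    have cov: "E \<subseteq> (\<Union>y\<in>E. cball y (r y))" using r by force
    obtain C where C: "countable C" "C \<subseteq> E"
        "pairwise (\<lambda>i j. disjnt (cball i (r i)) (cball j (r j))) C"
        "E \<subseteq> (\<Union>i\<in>C. cball i (5 * r i))"
      using Vitali_covering_lemma_cballs[OF cov, of "min \<rho>\<^sub>0 (\<delta> / 10)"] r by blast
    define J where "J = to_nat_on C ` C"
    define y where "y i = inv_into C (to_nat_on C) i" for i
    have yC: "y i \<in> C" if "i \<in> J" for i using that by (simp add: J_def y_def inv_into_into)
    have yinj: "y i \<noteq> y j" if "i \<in> J" "j \<in> J" "i \<noteq> j" for i j
      using that unfolding J_def y_def by (metis f_inv_into_f)
    have ysurj: "\<exists>i\<in>J. y i = x" if "x \<in> C" for x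
      using that C(1) unfolding J_def y_def
      by (intro bexI[of _ "to_nat_on C x"]) (auto simp: inv_into_f_f inj_on_to_nat_on)
    define V where "V i = (if i \<in> J then cball (y i) (5 * r (y i)) else {})" for i
    define B where "B i = (if i \<in> J then cball (y i) (r (y i)) else {})" for i
    have rpos: "0 < r (y i)" "r (y i) \<le> \<rho>\<^sub>0" "r (y i) \<le> \<delta> / 10" "cball (y i) (r (y i)) \<subseteq> U" if "i \<in> J" for i
      using r[of "y i"] yC[OF that] C(2) by auto
    have "E \<subseteq> (\<Union>i. V i)"
    proof
      fix x assume "x \<in> E"
      then obtain z where "z \<in> C" "x \<in> cball z (5 * r z)" using C(4) by blast
      then show "x \<in> (\<Union>i. V i)" using ysurj[of z] by (auto simp: V_def)
    qed
    moreover have "\<forall>i. bounded (V i) \<and> diameter (V i) \<le> \<delta>"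
      using rpos \<open>0 < \<delta>\<close> by (fastforce simp: V_def)
    ultimately have "hausdorff_content k \<delta> E \<le>
        (\<Sum>i. if V i = {} then 0 else ennreal (unit_ball_vol (real k) * (diameter (V i) / 2) ^ k))"
      unfolding hausdorff_content_def by (intro INF_lower) auto
    also have "\<dots> \<le> (\<Sum>i. ennreal K * emeasure \<nu> (B i))"
    proof (intro suminf_le summableI)
      fix i
      show "(if V i = {} then 0 else ennreal (unit_ball_vol (real k) * (diameter (V i) / 2) ^ k))
         \<le> ennreal K * emeasure \<nu> (B i)"
      proof (cases "i \<in> J")
        case True
        note rp = rpos[OF True]
        have "unit_ball_vol (real k) * (diameter (V i) / 2) ^ k = K * (c * r (y i) ^ k)"
          using True rp c by (simp add: V_def K_def power_mult_distrib)
        also have "ennreal \<dots> = ennreal K * ennreal (c * r (y i) ^ k)"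
          using K c rp by (intro ennreal_mult) auto
        also have "\<dots> \<le> ennreal K * emeasure \<nu> (B i)"
          using dens[of "y i" "r (y i)"] rp yC[OF True] C(2) True
          by (intro mult_left_mono) (auto simp: B_def)
        finally show ?thesis by auto
      qed (simp add: V_def)
    qed
    also have "\<dots> = ennreal K * (\<Sum>i. emeasure \<nu> (B i))" by simp
    also have "(\<Sum>i. emeasure \<nu> (B i)) = emeasure \<nu> (\<Union>i. B i)"
    proof (rule suminf_emeasure)
      show "range B \<subseteq> sets \<nu>" by (auto simp: sets B_def)
      show "disjoint_family B"
        unfolding disjoint_family_on_def
      proof (intro ballI impI)
        fix i j :: nat assume "i \<noteq> j"
        show "B i \<inter> B j = {}"
        proof (cases "i \<in> J \<and> j \<in> J")
          case True
          then have "disjnt (cball (y i) (r (y i))) (cball (y j) (r (y j)))"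
            using C(3) yC yinj \<open>i \<noteq> j\<close> by (auto simp: pairwise_def)
          then show ?thesis using True by (simp add: B_def disjnt_def)
        qed (auto simp: B_def)
      qed
    qed
    also have "ennreal K * emeasure \<nu> (\<Union>i. B i) \<le> ennreal K * emeasure \<nu> U"
    proof (intro mult_left_mono emeasure_mono)
      show "(\<Union>i. B i) \<subseteq> U" using rpos(4) by (auto simp: B_def split: if_splits)
      show "U \<in> sets \<nu>" using \<open>open U\<close> by (simp add: sets)
    qed simp
    finally show ?thesis .
  qed
  have "hausdorff_content k \<delta> E \<le> ennreal K * emeasure \<nu> E" if "0 < \<delta>" for \<delta>
  proof (rule ennreal_le_epsilon)
    fix e :: real assume "0 < e"
    \<comment> \<open>The denominator exceeds \<open>K\<close> to cover the case \<open>K = 0\<close>.\<close>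
    define e' where "e' = e / (K + 1)"
    have e': "0 < e'" using K \<open>0 < e\<close> by (simp add: e'_def)
    have inf: "emeasure \<nu> E = (INF U \<in> {U. E \<subseteq> U \<and> open U}. emeasure \<nu> U)"
      using sets E by (intro outer_regular) auto
    have "emeasure \<nu> E < emeasure \<nu> E + ennreal e'"
      using e' by (simp add: emeasure_eq_measure ennreal_less_iff flip: ennreal_plus)
    then obtain U where U: "E \<subseteq> U" "open U" "emeasure \<nu> U < emeasure \<nu> E + ennreal e'"
      unfolding inf INF_less_iff by (auto simp flip: inf)
    have "hausdorff_content k \<delta> E \<le> ennreal K * (emeasure \<nu> E + ennreal e')"
      using content[OF that U(2,1)] U(3) by (meson less_imp_le mult_left_mono order_trans zero_le)
    also have "\<dots> = ennreal K * emeasure \<nu> E + ennreal (K * e')"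
      using K e' by (simp add: distrib_left ennreal_mult)
    also have "\<dots> \<le> ennreal K * emeasure \<nu> E + ennreal e"
    proof (intro add_left_mono ennreal_leI)
      have "K * e' \<le> (K + 1) * e'" using e' by (simp add: distrib_right)
      also have "\<dots> = e" using K by (simp add: e'_def)
      finally show "K * e' \<le> e" .
    qed
    finally show "hausdorff_content k \<delta> E \<le> ennreal K * emeasure \<nu> E + ennreal e" .
  qed
  then show ?thesis
    unfolding hausdorff_outer_def K_def by (intro SUP_least) auto
qed

locale lipschitz_chart =
  fixes \<Omega> :: "'a::euclidean_space set" and x\<^sub>0 e :: 'a and r L :: real and \<gamma> :: "'a \<Rightarrow> real"
  assumes open_domain: "open \<Omega>" and center: "x\<^sub>0 \<in> frontier \<Omega>" and radius: "0 < r"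
    and dir: "norm e = 1" and lip: "L-lipschitz_on {z. z \<bullet> e = 0} \<gamma>"
    and epigraph: "\<Omega> \<inter> ball x\<^sub>0 r = {y \<in> ball x\<^sub>0 r. \<gamma> (y - (y \<bullet> e) *\<^sub>R e) < y \<bullet> e}"
begin

abbreviation perp :: "'a \<Rightarrow> 'a" where "perp z \<equiv> z - (z \<bullet> e) *\<^sub>R e"

definition height :: "'a \<Rightarrow> real" where "height z = \<gamma> (perp z)"

definition graph_proj :: "'a \<Rightarrow> 'a" where
  "graph_proj z = perp z + height z *\<^sub>R e"

definition width :: real where "width = r / (4 * (1 + L))"

definition depth :: real where "depth = r / 4"

text \<open>
  The vertical segments of length \<open>depth\<close> above the part of the graph over a disc of radius \<open>width\<close>. Both
  sizes are so small compared with \<open>r\<close> and \<open>L\<close> that the collar stays in the ball of the chart.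
\<close>

definition collar :: "'a set" where
  "collar = {z. norm (perp z - perp x\<^sub>0) < width \<and> height z < z \<bullet> e \<and> z \<bullet> e < height z + depth}"

lemma ee: "e \<bullet> e = 1" using dir by (simp add: dot_square_norm)

lemma L_nonneg: "0 \<le> L" using lip lipschitz_on_nonneg by blast

lemma width_pos: "0 < width" and depth_pos: "0 < depth"
  using radius L_nonneg by (auto simp: width_def depth_def)

lemma perp_add: "perp (z + t *\<^sub>R e) = perp z"
  by (simp add: inner_add_left ee algebra_simps)

lemma height_add [simp]: "height (z + t *\<^sub>R e) = height z"
  unfolding height_def perp_add ..

lemma perp_norm_le: "norm (perp z) \<le> norm z"
proof -
  have "(norm (perp z))\<^sup>2 = (norm z)\<^sup>2 - (z \<bullet> e)\<^sup>2"
    unfolding power2_norm_eq_inner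
    by (simp add: inner_diff_left inner_diff_right ee inner_commute[of e z] power2_eq_square)
  also have "\<dots> \<le> (norm z)\<^sup>2" by simp
  finally show ?thesis by (rule power2_le_imp_le) simp
qed

lemma height_lipschitz:
  "\<bar>height z - height y\<bar> \<le> L * norm (perp z - perp y)"
  using lipschitz_onD[OF lip, of "perp z" "perp y"]
  by (simp add: height_def dist_real_def dist_norm inner_diff_left ee)

lemma perp_diff: "perp z - perp y = perp (z - y)"
  by (simp add: inner_diff_left algebra_simps)

lemma height_lipschitz': "\<bar>height z - height y\<bar> \<le> L * norm (z - y)"
  using height_lipschitz[of z y] perp_norm_le[of "z - y"] L_nonneg
  unfolding perp_diff by (meson mult_left_mono order_trans)

lemma continuous_height: "continuous_on UNIV height"
proof (rule lipschitz_on_continuous_on)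
  show "L-lipschitz_on UNIV height"
    using height_lipschitz' L_nonneg by (auto intro!: lipschitz_onI simp: dist_real_def dist_norm)
qed

lemma continuous_graph_proj: "continuous_on UNIV graph_proj"
  unfolding graph_proj_def by (intro continuous_intros continuous_height)

lemma measurable_graph_proj [measurable]: "graph_proj \<in> borel_measurable borel"
  using continuous_graph_proj by (rule borel_measurable_continuous_onI)

lemma domain_iff: "y \<in> ball x\<^sub>0 r \<Longrightarrow> y \<in> \<Omega> \<longleftrightarrow> height y < y \<bullet> e"
  using arg_cong[OF epigraph, of "\<lambda>A. y \<in> A"] unfolding Int_iff mem_Collect_eq height_def by blast

lemma frontier_height:
  assumes "y \<in> frontier \<Omega>" "y \<in> ball x\<^sub>0 r"
  shows "height y = y \<bullet> e"
proof (rule ccontr)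
  assume ne: "height y \<noteq> y \<bullet> e"
  have "y \<notin> \<Omega>" using assms open_domain by (simp add: frontier_def interior_open)
  then have gt: "y \<bullet> e < height y" using ne domain_iff[OF assms(2)] by auto
  define N where "N = ball x\<^sub>0 r \<inter> {z. z \<bullet> e < height z}"
  have "open {z. z \<bullet> e < height z}"
    by (intro open_Collect_less continuous_intros continuous_height)
  then have "open N" "y \<in> N" using gt assms by (auto simp: N_def)
  moreover have "y \<in> closure \<Omega>" using assms by (simp add: frontier_def)
  ultimately obtain z where "z \<in> \<Omega>" "z \<in> N" by (meson closure_iff_nhds_not_empty disjoint_iff order_refl)
  then show False using domain_iff[of z] by (auto simp: N_def)
qed

lemma open_collar: "open collar"
proof -
  have "open {z. norm (perp z - perp x\<^sub>0) < width}"
    "open {z. height z < z \<bullet> e}" "open {z. z \<bullet> e < height z + depth}"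
    by (intro open_Collect_less continuous_intros continuous_height)+
  then have "open ({z. norm (perp z - perp x\<^sub>0) < width} \<inter>
     {z. height z < z \<bullet> e} \<inter> {z. z \<bullet> e < height z + depth})"
    by (intro open_Int)
  also have "\<dots> = collar" by (auto simp: collar_def)
  finally show ?thesis .
qed

lemma collar_subset_ball: "collar \<subseteq> ball x\<^sub>0 r"
proof
  fix z assume z: "z \<in> collar"
  let ?d = "perp z - perp x\<^sub>0"
  have d: "norm ?d < width" using z by (simp add: collar_def)
  have h0: "height x\<^sub>0 = x\<^sub>0 \<bullet> e" using frontier_height center radius by simp
  have Ld: "L * norm ?d \<le> L * width" using d L_nonneg by (intro mult_left_mono) auto
  have "\<bar>z \<bullet> e - x\<^sub>0 \<bullet> e\<bar> < depth + L * width"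
    using z height_lipschitz[of z x\<^sub>0] h0 Ld unfolding collar_def by (auto simp: abs_if split: if_splits)
  moreover have "norm (z - x\<^sub>0) \<le> norm ?d + \<bar>z \<bullet> e - x\<^sub>0 \<bullet> e\<bar>"
  proof -
    have eq: "z - x\<^sub>0 = ?d + (z \<bullet> e - x\<^sub>0 \<bullet> e) *\<^sub>R e" by (simp add: algebra_simps)
    show ?thesis
      unfolding eq by (rule order_trans[OF norm_triangle_ineq]) (simp add: dir)
  qed
  ultimately have "norm (z - x\<^sub>0) < (1 + L) * width + depth" using d by (simp add: distrib_right)
  also have "(1 + L) * width = r / 4" using L_nonneg by (simp add: width_def field_simps)
  finally show "z \<in> ball x\<^sub>0 r" using radius by (simp add: depth_def dist_norm norm_minus_commute)
qed

lemma collar_subset: "collar \<subseteq> \<Omega>"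
  using collar_subset_ball domain_iff by (auto simp: collar_def)

text \<open>
  The volume of the collar, pushed down to the graph. It dominates the surface measure up to a factor,
  which turns boundary integrals into volume integrals.
\<close>

definition collar_measure :: "'a measure" where
  "collar_measure = distr (restrict_space lborel collar) borel graph_proj"

lemma sets_collar_measure [simp]: "sets collar_measure = sets borel"
  by (simp add: collar_measure_def)

lemma graph_proj_measurable_collar: "graph_proj \<in> measurable (restrict_space lborel collar) borel"
  by (intro measurable_restrict_space1) simp

lemma emeasure_collar_measure:
  assumes "A \<in> sets borel"
  shows "emeasure collar_measure A = emeasure lborel {z \<in> collar. graph_proj z \<in> A}"
proof -
  have "emeasure collar_measure A = emeasure (restrict_space lborel collar) (graph_proj -` A \<inter> collar)"
    unfolding collar_measure_def using assms open_collar
    by (subst emeasure_distr[OF graph_proj_measurable_collar]) (auto simp: space_restrict_space)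
  also have "\<dots> = emeasure lborel (graph_proj -` A \<inter> collar)"
    using open_collar by (intro emeasure_restrict_space) auto
  also have "graph_proj -` A \<inter> collar = {z \<in> collar. graph_proj z \<in> A}" by auto
  finally show ?thesis .
qed

lemma finite_collar_measure: "finite_measure collar_measure"
proof (rule finite_measureI)
  have "emeasure collar_measure (space collar_measure) = emeasure lborel collar"
    using emeasure_collar_measure[of UNIV] by (simp add: collar_measure_def)
  also have "\<dots> \<le> emeasure lborel (ball x\<^sub>0 r)"
    by (intro emeasure_mono collar_subset_ball) simp
  also have "\<dots> < \<infinity>" using emeasure_lborel_ball_finite by blast
  finally show "emeasure collar_measure (space collar_measure) \<noteq> \<infinity>" by simp
qed

text \<open>
  The preimage in the collar of a small ball around a point of the graph contains a vertical
  stack of disjoint balls of comparable radius, whose number is inversely proportional to the radius.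
\<close>

lemma collar_measure_density:
  assumes y: "y \<in> frontier \<Omega>" "y \<in> ball x\<^sub>0 (width / 2)"
    and \<rho>: "0 < \<rho>" "\<rho> \<le> width / 2" "\<rho> \<le> depth / 8"
  shows "ennreal (depth / 8 * unit_ball_vol DIM('a) / (1 + L) ^ (DIM('a) - 1) * \<rho> ^ (DIM('a) - 1))
    \<le> emeasure collar_measure (cball y \<rho>)"
proof -
  define \<sigma> where "\<sigma> = \<rho> / (1 + L)"
  have \<sigma>: "0 < \<sigma>" "(1 + L) * \<sigma> = \<rho>" using \<rho> L_nonneg by (auto simp: \<sigma>_def field_simps)
  have \<sigma>le: "\<sigma> \<le> depth / 8" "L * \<sigma> \<le> depth / 8"
  proof -
    have "0 \<le> L * \<sigma>" using L_nonneg \<sigma> by simp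
    moreover have "\<sigma> + L * \<sigma> \<le> depth / 8" using \<sigma>(2) \<rho> by (simp add: distrib_right)
    ultimately show "\<sigma> \<le> depth / 8" "L * \<sigma> \<le> depth / 8" using \<sigma>(1) by linarith+
  qed
  have yr: "y \<in> ball x\<^sub>0 r"
  proof -
    have "width \<le> r / 4"
      unfolding width_def using radius L_nonneg by (intro divide_left_mono) auto
    then show ?thesis using y radius width_pos by auto
  qed
  have hy: "height y = y \<bullet> e" using frontier_height[OF y(1) yr] .
  \<comment> \<open>The number of balls of diameter \<open>2 \<sigma>\<close> that fit into a segment of half the depth.\<close>
  define m where "m = nat \<lfloor>depth / (4 * \<sigma>)\<rfloor>"
  have m_le: "2 * real m * \<sigma> \<le> depth / 2"
  proof -
    have "real m \<le> depth / (4 * \<sigma>)" using depth_pos \<sigma> by (simp add: m_def)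
    then show ?thesis using \<sigma> by (simp add: field_simps)
  qed
  have m_ge: "depth / 8 \<le> real m * \<sigma>"
  proof -
    have "depth / (4 * \<sigma>) - 1 \<le> real m" using depth_pos \<sigma> unfolding m_def by linarith
    then have "(depth / (4 * \<sigma>) - 1) * \<sigma> \<le> real m * \<sigma>" using \<sigma> by (intro mult_right_mono) auto
    moreover have "(depth / (4 * \<sigma>) - 1) * \<sigma> = depth / 4 - \<sigma>" using \<sigma> by (simp add: field_simps)
    ultimately show ?thesis using \<sigma>le by linarith
  qed
  \<comment> \<open>The balls are stacked between a quarter and three quarters of the depth, with centres \<open>2 \<sigma>\<close> apart.\<close>
  define F where "F j = ball (y + (depth / 4 + (2 * real j + 1) * \<sigma>) *\<^sub>R e) \<sigma>" for j :: nat
  have F_sub: "F j \<subseteq> {z \<in> collar. graph_proj z \<in> cball y \<rho>}" if "j < m" for j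
  proof
    fix z assume z: "z \<in> F j"
    define \<tau> where "\<tau> = depth / 4 + (2 * real j + 1) * \<sigma>"
    have \<tau>: "depth / 4 + \<sigma> \<le> \<tau>" "\<tau> + \<sigma> \<le> 3 * depth / 4"
    proof -
      have "0 \<le> 2 * real j * \<sigma>" using \<sigma> by simp
      then show "depth / 4 + \<sigma> \<le> \<tau>" by (simp add: \<tau>_def distrib_right)
      have "(2 * real j + 2) * \<sigma> \<le> 2 * real m * \<sigma>" using that \<sigma> by (intro mult_right_mono) auto
      then show "\<tau> + \<sigma> \<le> 3 * depth / 4" using m_le by (simp add: \<tau>_def algebra_simps)
    qed
    define d where "d = z - (y + \<tau> *\<^sub>R e)"
    have d: "norm d < \<sigma>" using z by (simp add: F_def \<tau>_def d_def dist_norm norm_minus_commute)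
    have zd: "z = (y + d) + \<tau> *\<^sub>R e" by (simp add: d_def)
    let ?p = "perp z - perp y"
    have p: "?p = perp d"
      unfolding zd perp_add by (simp add: inner_add_left algebra_simps)
    have np: "norm ?p < \<sigma>" unfolding p using perp_norm_le[of d] d by simp
    have hh: "\<bar>height z - y \<bullet> e\<bar> \<le> L * \<sigma>"
    proof -
      have "L * norm ?p \<le> L * \<sigma>" using np L_nonneg by (intro mult_left_mono) auto
      then show ?thesis using height_lipschitz[of z y] unfolding hy by linarith
    qed
    have de: "\<bar>d \<bullet> e\<bar> < \<sigma>" using Cauchy_Schwarz_ineq2[of d e] d dir by simp
    have ze: "z \<bullet> e = y \<bullet> e + d \<bullet> e + \<tau>" unfolding zd by (simp add: inner_add_left ee)
    have "height z < z \<bullet> e"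
    proof -
      have "height z \<le> y \<bullet> e + L * \<sigma>" using hh by linarith
      also have "\<dots> < y \<bullet> e + depth / 4" using \<sigma>le depth_pos by linarith
      also have "\<dots> < z \<bullet> e" using ze de \<tau> by linarith
      finally show ?thesis .
    qed
    moreover have "z \<bullet> e < height z + depth"
    proof -
      have "z \<bullet> e < y \<bullet> e + 3 * depth / 4" using ze de \<tau> by linarith
      also have "\<dots> < height z + depth" using hh \<sigma>le depth_pos by linarith
      finally show ?thesis .
    qed
    moreover have gp: "norm (graph_proj z - y) \<le> \<rho>"
    proof -
      have "graph_proj z - y = ?p + (height z - y \<bullet> e) *\<^sub>R e"
        by (simp add: graph_proj_def algebra_simps)
      then have "norm (graph_proj z - y) = norm (?p + (height z - y \<bullet> e) *\<^sub>R e)" by (rule arg_cong)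
      also have "\<dots> \<le> norm ?p + \<bar>height z - y \<bullet> e\<bar>"
        by (rule order_trans[OF norm_triangle_ineq]) (simp add: dir)
      also have "\<dots> \<le> \<sigma> + L * \<sigma>" using np hh by simp
      finally show ?thesis using \<sigma>(2) by (simp add: distrib_right)
    qed
    moreover have "norm (perp z - perp x\<^sub>0) < width"
    proof -
      have "perp z - perp x\<^sub>0 = ?p + (perp (y - x\<^sub>0))"
        by (simp add: inner_diff_left algebra_simps)
      then have "norm (perp z - perp x\<^sub>0) =
          norm (?p + (perp (y - x\<^sub>0)))" by (rule arg_cong)
      also have "\<dots> \<le> norm ?p + norm (y - x\<^sub>0)"
        by (rule order_trans[OF norm_triangle_ineq add_left_mono[OF perp_norm_le]])
      finally have "norm (perp z - perp x\<^sub>0) \<le> norm ?p + norm (y - x\<^sub>0)" .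
      moreover have "norm (y - x\<^sub>0) < width / 2" using y by (simp add: dist_norm norm_minus_commute)
      moreover have "\<sigma> \<le> \<rho>" using \<sigma> L_nonneg by (simp add: distrib_right flip: \<sigma>(2))
      ultimately show ?thesis using np \<rho> by linarith
    qed
    ultimately show "z \<in> {z \<in> collar. graph_proj z \<in> cball y \<rho>}"
      by (simp add: collar_def dist_norm norm_minus_commute)
  qed
  have F_disj: "disjoint_family_on F {..<m}"
    unfolding disjoint_family_on_def
  proof (intro ballI impI)
    fix i j :: nat assume "i \<noteq> j"
    have "dist (y + (depth / 4 + (2 * real i + 1) * \<sigma>) *\<^sub>R e) (y + (depth / 4 + (2 * real j + 1) * \<sigma>) *\<^sub>R e)
       = \<bar>2 * (real i - real j) * \<sigma>\<bar>"
    proof -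
      have "(y + (depth / 4 + (2 * real i + 1) * \<sigma>) *\<^sub>R e) - (y + (depth / 4 + (2 * real j + 1) * \<sigma>) *\<^sub>R e)
         = (2 * (real i - real j) * \<sigma>) *\<^sub>R e" by (simp add: algebra_simps)
      then show ?thesis using dir by (simp add: dist_norm)
    qed
    also have "\<dots> \<ge> 2 * \<sigma>"
    proof -
      have "1 \<le> \<bar>real i - real j\<bar>" using \<open>i \<noteq> j\<close> by linarith
      then show ?thesis using \<sigma> by (simp add: abs_mult)
    qed
    finally show "F i \<inter> F j = {}"
      unfolding F_def by (intro disjoint_ballI) simp
  qed
  have "ennreal (depth / 8 * unit_ball_vol DIM('a) / (1 + L) ^ (DIM('a) - 1) * \<rho> ^ (DIM('a) - 1))
    \<le> ennreal (real m * (unit_ball_vol DIM('a) * \<sigma> ^ DIM('a)))"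
  proof (rule ennreal_leI)
    have "\<sigma> ^ DIM('a) = \<sigma> * \<sigma> ^ (DIM('a) - 1)"
      by (metis DIM_positive Suc_diff_1 power_Suc)
    then have "real m * (unit_ball_vol DIM('a) * \<sigma> ^ DIM('a)) =
       (real m * \<sigma>) * (unit_ball_vol DIM('a) * \<sigma> ^ (DIM('a) - 1))" by simp
    also have "\<dots> \<ge> (depth / 8) * (unit_ball_vol DIM('a) * \<sigma> ^ (DIM('a) - 1))"
      using m_ge \<sigma> by (intro mult_right_mono) auto
    finally show "depth / 8 * unit_ball_vol DIM('a) / (1 + L) ^ (DIM('a) - 1) * \<rho> ^ (DIM('a) - 1)
       \<le> real m * (unit_ball_vol DIM('a) * \<sigma> ^ DIM('a))"
      by (simp add: \<sigma>_def power_divide)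
  qed
  also have "\<dots> = (\<Sum>j<m. emeasure lborel (F j))"
    using \<sigma> by (simp add: F_def emeasure_ball ennreal_mult' ennreal_of_nat_eq_real_of_nat)
  also have "\<dots> = emeasure lborel (\<Union>j<m. F j)"
    by (intro sum_emeasure F_disj) (auto simp: F_def)
  also have "\<dots> \<le> emeasure lborel {z \<in> collar. graph_proj z \<in> cball y \<rho>}"
  proof (intro emeasure_mono)
    show "(\<Union>j<m. F j) \<subseteq> {z \<in> collar. graph_proj z \<in> cball y \<rho>}" using F_sub by auto
    have "{z \<in> collar. graph_proj z \<in> cball y \<rho>} = collar \<inter> (graph_proj -` cball y \<rho> \<inter> space borel)" by auto
    also have "\<dots> \<in> sets borel"
      using open_collar by (intro sets.Int measurable_sets[OF measurable_graph_proj]) auto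
    finally show "{z \<in> collar. graph_proj z \<in> cball y \<rho>} \<in> sets lborel" by simp
  qed
  also have "\<dots> = emeasure collar_measure (cball y \<rho>)"
    by (simp add: emeasure_collar_measure)
  finally show ?thesis .
qed

lemma nn_integral_surface_chart_le:
  obtains C :: real where "0 \<le> C"
    "\<And>f :: 'a \<Rightarrow> ennreal. f \<in> borel_measurable borel \<Longrightarrow>
      (\<integral>\<^sup>+y. f y * indicator (frontier \<Omega> \<inter> ball x\<^sub>0 (width / 2)) y \<partial>hausdorff_measure (DIM('a) - 1))
       \<le> ennreal C * (\<integral>\<^sup>+z. f (graph_proj z) * indicator collar z \<partial>lborel)"
proof -
  define k where "k = DIM('a) - 1"
  define c where "c = depth / 8 * unit_ball_vol DIM('a) / (1 + L) ^ k"
  have c: "0 < c" using depth_pos L_nonneg by (simp add: c_def)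
  define C where "C = unit_ball_vol (real k) * 5 ^ k / c"
  have C: "0 \<le> C" using c by (simp add: C_def)
  define B where "B = frontier \<Omega> \<inter> ball x\<^sub>0 (width / 2)"
  have B: "B \<in> sets borel" by (simp add: B_def)
  have le: "emeasure (hausdorff_measure k) E \<le> ennreal C * emeasure collar_measure E"
    if "E \<in> sets borel" "E \<subseteq> B" for E
  proof -
    have "hausdorff_outer k E \<le> ennreal (unit_ball_vol (real k) * 5 ^ k / c) * emeasure collar_measure E"
    proof (rule hausdorff_outer_le_if_density[OF finite_collar_measure sets_collar_measure that(1) c])
      show "0 < min (width / 2) (depth / 8)" using width_pos depth_pos by simp
      show "ennreal (c * \<rho> ^ k) \<le> emeasure collar_measure (cball y \<rho>)"
        if "y \<in> E" "0 < \<rho>" "\<rho> \<le> min (width / 2) (depth / 8)" for y \<rho>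
        unfolding c_def k_def using that \<open>E \<subseteq> B\<close> by (intro collar_measure_density) (auto simp: B_def)
    qed
    then show ?thesis
      using emeasure_hausdorff_measure_le[of k E] by (simp add: C_def)
  qed
  have main: "(\<integral>\<^sup>+y. f y * indicator B y \<partial>hausdorff_measure k)
       \<le> ennreal C * (\<integral>\<^sup>+z. f (graph_proj z) * indicator collar z \<partial>lborel)"
    if f [measurable]: "f \<in> borel_measurable borel" for f :: "'a \<Rightarrow> ennreal"
  proof -
    have "(\<integral>\<^sup>+y. f y * indicator B y \<partial>hausdorff_measure k) =
       (\<integral>\<^sup>+y. indicator B y * f y \<partial>hausdorff_measure k)" by (simp add: mult.commute)
    also have "\<dots> = (\<integral>\<^sup>+y. f y \<partial>density (hausdorff_measure k) (indicator B))"
      using B by (intro nn_integral_density[symmetric]) auto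
    also have "\<dots> \<le> (\<integral>\<^sup>+y. f y \<partial>scale_measure (ennreal C) collar_measure)"
    proof (rule nn_integral_mono_measure)
      show s: "sets (density (hausdorff_measure k) (indicator B)) = sets (scale_measure (ennreal C) collar_measure)"
        by simp
      show "density (hausdorff_measure k) (indicator B) \<le> scale_measure (ennreal C) collar_measure"
        unfolding le_measure[OF s]
      proof
        fix A :: "'a set" assume "A \<in> sets (density (hausdorff_measure k) (indicator B))"
        then have A: "A \<in> sets borel" by simp
        have "emeasure (density (hausdorff_measure k) (indicator B)) A =
            (\<integral>\<^sup>+y. indicator B y * indicator A y \<partial>hausdorff_measure k)"
          using A B by (intro emeasure_density) auto
        also have "\<dots> = (\<integral>\<^sup>+y. indicator (A \<inter> B) y \<partial>hausdorff_measure k)"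
          by (intro nn_integral_cong) (auto simp: indicator_def)
        also have "\<dots> = emeasure (hausdorff_measure k) (A \<inter> B)" using A B by simp
        also have "\<dots> \<le> ennreal C * emeasure collar_measure (A \<inter> B)" using A B by (intro le) auto
        also have "\<dots> \<le> ennreal C * emeasure collar_measure A"
          using A by (intro mult_left_mono emeasure_mono) auto
        finally show "emeasure (density (hausdorff_measure k) (indicator B)) A
           \<le> emeasure (scale_measure (ennreal C) collar_measure) A" by simp
      qed
    qed
    also have "\<dots> = ennreal C * (\<integral>\<^sup>+y. f y \<partial>collar_measure)"
      by (intro nn_integral_scale_measure) (simp add: measurable_cong_sets[OF sets_collar_measure refl])
    also have "(\<integral>\<^sup>+y. f y \<partial>collar_measure) = (\<integral>\<^sup>+z. f (graph_proj z) \<partial>restrict_space lborel collar)"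
      unfolding collar_measure_def by (intro nn_integral_distr graph_proj_measurable_collar) simp
    also have "\<dots> = (\<integral>\<^sup>+z. f (graph_proj z) * indicator collar z \<partial>lborel)"
      using open_collar by (intro nn_integral_restrict_space) auto
    finally show ?thesis .
  qed
  show ?thesis
    by (rule that[OF C]) (use main in \<open>simp add: B_def k_def\<close>)
qed

end


section \<open>Estimates along translations\<close>

abbreviation gradient_L1 :: "'a::euclidean_space set \<Rightarrow> ('a \<Rightarrow> real) \<Rightarrow> ennreal" where
  "gradient_L1 \<Omega> w \<equiv> \<integral>\<^sup>+z\<in>\<Omega>. ennreal (norm (gradient w z)) \<partial>lborel"

lemma measurable_C1_fun [measurable (raw)]:
  "C1_fun w \<Longrightarrow> w \<in> borel_measurable borel" "C1_fun w \<Longrightarrow> gradient w \<in> borel_measurable borel"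
  by (auto intro: borel_measurable_continuous_onI C1_fun_continuous C1_fun_continuous_gradient)

lemma C1_fun_line_estimate:
  fixes w :: "'a::euclidean_space \<Rightarrow> real"
  assumes w: "C1_fun w" and T: "0 \<le> T"
  shows "ennreal \<bar>w (z + T *\<^sub>R h) - w z\<bar> \<le>
    (\<integral>\<^sup>+s\<in>{0..T}. ennreal (norm h * norm (gradient w (z + s *\<^sub>R h))) \<partial>lborel)"
proof -
  have c: "continuous_on {0..T} (\<lambda>s. gradient w (z + s *\<^sub>R h) \<bullet> h)"
    by (intro continuous_intros continuous_on_compose2[OF C1_fun_continuous_gradient[OF w]]) auto
  have d: "((\<lambda>s. w (z + s *\<^sub>R h)) has_vector_derivative (gradient w (z + s *\<^sub>R h) \<bullet> h)) (at s within {0..T})" for s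
  proof -
    have "((\<lambda>s. w (z + s *\<^sub>R h)) has_derivative (\<lambda>t. gradient w (z + s *\<^sub>R h) \<bullet> (t *\<^sub>R h))) (at s within {0..T})"
      by (rule has_derivative_compose[OF _ C1_fun_has_derivative[OF w]]) (auto intro!: derivative_eq_intros)
    then show ?thesis by (simp add: has_vector_derivative_def)
  qed
  have eq: "(LINT s|lborel. indicator {0..T} s *\<^sub>R (gradient w (z + s *\<^sub>R h) \<bullet> h)) = w (z + T *\<^sub>R h) - w (z + 0 *\<^sub>R h)"
    by (rule integral_FTC_Icc[OF T d c])
  have i: "integrable lborel (\<lambda>s. indicator {0..T} s *\<^sub>R (gradient w (z + s *\<^sub>R h) \<bullet> h))"
    by (rule borel_integrable_compact[OF compact_Icc c])
  have "ennreal \<bar>w (z + T *\<^sub>R h) - w z\<bar> \<le>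
     (\<integral>\<^sup>+s. ennreal (norm (indicator {0..T} s *\<^sub>R (gradient w (z + s *\<^sub>R h) \<bullet> h))) \<partial>lborel)"
    using integral_norm_bound_ennreal[OF i] unfolding eq by simp
  also have "\<dots> \<le> (\<integral>\<^sup>+s\<in>{0..T}. ennreal (norm h * norm (gradient w (z + s *\<^sub>R h))) \<partial>lborel)"
    by (intro nn_integral_mono)
       (auto simp: indicator_def mult.commute[of "norm h"] intro!: ennreal_leI Cauchy_Schwarz_ineq2)
  finally show ?thesis .
qed

lemma nn_integral_lborel_translation:
  fixes f :: "'a::euclidean_space \<Rightarrow> ennreal"
  assumes [measurable]: "f \<in> borel_measurable borel"
  shows "(\<integral>\<^sup>+z. f (z + h) \<partial>lborel) = (\<integral>\<^sup>+z. f z \<partial>lborel)"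
proof -
  have "(\<integral>\<^sup>+z. f z \<partial>lborel) = (\<integral>\<^sup>+z. f z \<partial>distr lborel borel ((+) h))"
    by (simp add: lborel_distr_plus)
  also have "\<dots> = (\<integral>\<^sup>+z. f (h + z) \<partial>lborel)" by (rule nn_integral_distr) auto
  finally show ?thesis by (simp add: add.commute)
qed

text \<open>Tonelli's theorem for an average of \<open>F\<close> over translations by \<open>s h\<close> with \<open>0 \<le> s \<le> T\<close>.\<close>

lemma nn_integral_translation_average:
  fixes F :: "'a::euclidean_space \<Rightarrow> ennreal"
  assumes [measurable]: "F \<in> borel_measurable borel" and T: "0 \<le> T"
  shows "(\<integral>\<^sup>+z. (\<integral>\<^sup>+s\<in>{0..T}. F (z + s *\<^sub>R h) \<partial>lborel) \<partial>lborel) = ennreal T * (\<integral>\<^sup>+z. F z \<partial>lborel)"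
proof -
  have "(\<integral>\<^sup>+z. (\<integral>\<^sup>+s\<in>{0..T}. F (z + s *\<^sub>R h) \<partial>lborel) \<partial>lborel) =
     (\<integral>\<^sup>+s. (\<integral>\<^sup>+z. F (z + s *\<^sub>R h) * indicator {0..T} s \<partial>lborel) \<partial>lborel)"
    by (rule lborel_pair.Fubini'[symmetric]) measurable
  also have "\<dots> = (\<integral>\<^sup>+s. (\<integral>\<^sup>+z. F z \<partial>lborel) * indicator {0..T} s \<partial>lborel)"
    by (intro nn_integral_cong) (simp add: nn_integral_multc nn_integral_lborel_translation)
  also have "\<dots> = ennreal T * (\<integral>\<^sup>+z. F z \<partial>lborel)"
    using T by (simp add: nn_integral_cmult mult.commute)
  finally show ?thesis .
qed

text \<open>
  The increment \<open>w(z + h) - w(z)\<close> is an integral of the gradient over a segment, and Tonelli's theorem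
  replaces the average over the segment by an average over translates of the domain.
\<close>

lemma translation_estimate:
  fixes w :: "'a::euclidean_space \<Rightarrow> real"
  assumes \<Omega>: "\<Omega> \<in> sets borel" and w: "C1_fun w"
    and A: "\<And>z t. z \<in> A \<Longrightarrow> 0 \<le> t \<Longrightarrow> t \<le> 1 \<Longrightarrow> z + t *\<^sub>R h \<in> \<Omega>"
  shows "(\<integral>\<^sup>+z\<in>A. ennreal \<bar>w (z + h) - w z\<bar> \<partial>lborel) \<le>
    ennreal (norm h) * gradient_L1 \<Omega> w"
proof -
  note [measurable] = \<Omega> measurable_C1_fun[OF w]
  define F where "F z = ennreal (norm h * norm (gradient w z)) * indicator \<Omega> z" for z
  have [measurable]: "F \<in> borel_measurable borel" unfolding F_def by measurable
  have "(\<integral>\<^sup>+z\<in>A. ennreal \<bar>w (z + h) - w z\<bar> \<partial>lborel) \<le>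
    (\<integral>\<^sup>+z. (\<integral>\<^sup>+s\<in>{0..1}. F (z + s *\<^sub>R h) \<partial>lborel) \<partial>lborel)"
  proof (intro nn_integral_mono)
    fix z
    show "ennreal \<bar>w (z + h) - w z\<bar> * indicator A z \<le> (\<integral>\<^sup>+s\<in>{0..1}. F (z + s *\<^sub>R h) \<partial>lborel)"
    proof (cases "z \<in> A")
      case True
      have "ennreal \<bar>w (z + h) - w z\<bar> \<le>
         (\<integral>\<^sup>+s\<in>{0..1}. ennreal (norm h * norm (gradient w (z + s *\<^sub>R h))) \<partial>lborel)"
        using C1_fun_line_estimate[OF w, of 1 z h] by simp
      also have "\<dots> = (\<integral>\<^sup>+s\<in>{0..1}. F (z + s *\<^sub>R h) \<partial>lborel)"
        using A[OF True] by (intro nn_integral_cong) (auto simp: F_def indicator_def)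
      finally show ?thesis using True by simp
    qed simp
  qed
  also have "\<dots> = (\<integral>\<^sup>+z. F z \<partial>lborel)"
    by (subst nn_integral_translation_average) auto
  also have "\<dots> = ennreal (norm h) * gradient_L1 \<Omega> w"
    unfolding F_def by (simp add: ennreal_mult nn_integral_cmult[symmetric] mult.assoc)
  finally show ?thesis .
qed


section \<open>The trace inequality\<close>

text \<open>
  Descending from a point of the collar to the graph, the value changes by at most the integral of the
  gradient along the vertical segment, whose points other than the foot lie in the collar.
\<close>

lemma (in lipschitz_chart) collar_estimate:
  assumes w: "C1_fun w"
  shows "(\<integral>\<^sup>+z\<in>collar. ennreal \<bar>w (graph_proj z)\<bar> \<partial>lborel) \<le>
     (\<integral>\<^sup>+z\<in>\<Omega>. ennreal \<bar>w z\<bar> \<partial>lborel) + ennreal depth * gradient_L1 \<Omega> w"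
proof -
  note [measurable] = measurable_C1_fun[OF w]
  have [measurable]: "\<Omega> \<in> sets borel" "collar \<in> sets borel" using open_domain open_collar by auto
  define F where "F z = ennreal (norm (gradient w z)) * indicator \<Omega> z" for z
  have [measurable]: "F \<in> borel_measurable borel" unfolding F_def by measurable
  have pt: "ennreal \<bar>w (graph_proj z)\<bar> * indicator collar z \<le>
     ennreal \<bar>w z\<bar> * indicator \<Omega> z + (\<integral>\<^sup>+s\<in>{0..depth}. F (z + s *\<^sub>R (- e)) \<partial>lborel)" for z
  proof (cases "z \<in> collar")
    case True
    define t where "t = z \<bullet> e - height z"
    have t: "0 < t" "t < depth" using True by (auto simp: collar_def t_def)
    have p: "graph_proj z = z + t *\<^sub>R (- e)"
      by (simp add: graph_proj_def t_def algebra_simps)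
    have in_collar: "z + s *\<^sub>R (- e) \<in> collar" if "0 \<le> s" "s < t" for s
    proof -
      have P: "perp (z + s *\<^sub>R (- e)) = perp z"
        using perp_add[of z "- s"] unfolding scaleR_minus_left scaleR_minus_right .
      have H: "height (z + s *\<^sub>R (- e)) = height z"
        using height_add[of z "- s"] unfolding scaleR_minus_left scaleR_minus_right .
      have I: "(z + s *\<^sub>R (- e)) \<bullet> e = z \<bullet> e - s" by (simp add: inner_diff_left ee)
      have c: "norm (perp z - perp x\<^sub>0) < width"
          "height z < z \<bullet> e - s" "z \<bullet> e - s < height z + depth"
        using True that by (auto simp only: collar_def mem_Collect_eq t_def)
      show ?thesis
        unfolding collar_def mem_Collect_eq I H P[unfolded I] using c by blast
    qed
    have "ennreal \<bar>w (graph_proj z)\<bar> \<le> ennreal \<bar>w z\<bar> + ennreal \<bar>w (z + t *\<^sub>R (- e)) - w z\<bar>"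
      unfolding p by (subst ennreal_plus[symmetric]) (simp_all only: abs_ge_zero, intro ennreal_leI, linarith)
    also have "ennreal \<bar>w (z + t *\<^sub>R (- e)) - w z\<bar> \<le>
        (\<integral>\<^sup>+s\<in>{0..t}. ennreal (norm (- e) * norm (gradient w (z + s *\<^sub>R (- e)))) \<partial>lborel)"
      using t by (intro C1_fun_line_estimate w) auto
    also have "\<dots> \<le> (\<integral>\<^sup>+s\<in>{0..depth}. F (z + s *\<^sub>R (- e)) \<partial>lborel)"
    proof (rule nn_integral_mono_AE)
      \<comment> \<open>The foot of the segment lies on the boundary, outside the domain, but is a single point.\<close>
      have "AE s in lborel. s \<noteq> t" by (rule AE_lborel_singleton)
      then show "AE s in lborel. ennreal (norm (- e) * norm (gradient w (z + s *\<^sub>R (- e)))) * indicator {0..t} s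
          \<le> F (z + s *\<^sub>R (- e)) * indicator {0..depth} s"
      proof eventually_elim
        case (elim s)
        show ?case
        proof (cases "0 \<le> s \<and> s < t")
          case True
          then have "z + s *\<^sub>R (- e) \<in> \<Omega>" using in_collar collar_subset by blast
          then show ?thesis using True t dir by (simp add: F_def)
        next
          case False
          then have "s \<notin> {0..t}" using elim by auto
          then show ?thesis by simp
        qed
      qed
    qed
    finally show ?thesis using True collar_subset by (auto simp: add_left_mono subset_iff)
  qed simp
  have "(\<integral>\<^sup>+z\<in>collar. ennreal \<bar>w (graph_proj z)\<bar> \<partial>lborel) \<le>
     (\<integral>\<^sup>+z. ennreal \<bar>w z\<bar> * indicator \<Omega> z + (\<integral>\<^sup>+s\<in>{0..depth}. F (z + s *\<^sub>R (- e)) \<partial>lborel) \<partial>lborel)"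
    by (intro nn_integral_mono pt)
  also have "\<dots> = (\<integral>\<^sup>+z\<in>\<Omega>. ennreal \<bar>w z\<bar> \<partial>lborel) +
     (\<integral>\<^sup>+z. (\<integral>\<^sup>+s\<in>{0..depth}. F (z + s *\<^sub>R (- e)) \<partial>lborel) \<partial>lborel)"
    by (intro nn_integral_add) measurable
  also have "(\<integral>\<^sup>+z. (\<integral>\<^sup>+s\<in>{0..depth}. F (z + s *\<^sub>R (- e)) \<partial>lborel) \<partial>lborel) = ennreal depth * (\<integral>\<^sup>+z. F z \<partial>lborel)"
    using depth_pos by (intro nn_integral_translation_average) auto
  finally show ?thesis by (simp add: F_def)
qed

lemma lipschitz_boundary_chart:
  assumes "open \<Omega>" "lipschitz_boundary \<Omega>" "x \<in> frontier \<Omega>"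
  obtains r e \<gamma> L where "lipschitz_chart \<Omega> x e r L \<gamma>"
  using assms unfolding lipschitz_boundary_def lipschitz_chart_def by blast

definition W11_norm :: "'a::euclidean_space set \<Rightarrow> ('a \<Rightarrow> real) \<Rightarrow> ennreal" where
  "W11_norm \<Omega> w = (\<integral>\<^sup>+z\<in>\<Omega>. ennreal \<bar>w z\<bar> \<partial>lborel) + gradient_L1 \<Omega> w"

lemma trace_inequality_local:
  fixes \<Omega> :: "'a::euclidean_space set"
  assumes "open \<Omega>" "lipschitz_boundary \<Omega>" "x \<in> frontier \<Omega>"
  shows "\<exists>\<rho> C. 0 < \<rho> \<and> 0 \<le> C \<and> (\<forall>w. C1_fun w \<longrightarrow>
    (\<integral>\<^sup>+y. ennreal \<bar>w y\<bar> * indicator (frontier \<Omega> \<inter> ball x \<rho>) y \<partial>hausdorff_measure (DIM('a) - 1))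
      \<le> ennreal C * W11_norm \<Omega> w)"
proof -
  obtain r e \<gamma> L where "lipschitz_chart \<Omega> x e r L \<gamma>"
    using lipschitz_boundary_chart[OF assms] by blast
  then interpret lipschitz_chart \<Omega> x e r L \<gamma> .
  obtain C :: real where C: "0 \<le> C" "\<And>f :: 'a \<Rightarrow> ennreal. f \<in> borel_measurable borel \<Longrightarrow>
      (\<integral>\<^sup>+y. f y * indicator (frontier \<Omega> \<inter> ball x (width / 2)) y \<partial>hausdorff_measure (DIM('a) - 1))
       \<le> ennreal C * (\<integral>\<^sup>+z. f (graph_proj z) * indicator collar z \<partial>lborel)"
    by (rule nn_integral_surface_chart_le) blast
  show ?thesis
  proof (rule exI[of _ "width / 2"], rule exI[of _ "C * (1 + depth)"], intro conjI allI impI)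
    fix w :: "'a \<Rightarrow> real" assume w: "C1_fun w"
    note [measurable] = measurable_C1_fun[OF w]
    have "(\<integral>\<^sup>+y. ennreal \<bar>w y\<bar> * indicator (frontier \<Omega> \<inter> ball x (width / 2)) y \<partial>hausdorff_measure (DIM('a) - 1))
       \<le> ennreal C * (\<integral>\<^sup>+z. ennreal \<bar>w (graph_proj z)\<bar> * indicator collar z \<partial>lborel)"
      by (rule C(2)) measurable
    also have "\<dots> \<le> ennreal C * ((\<integral>\<^sup>+z\<in>\<Omega>. ennreal \<bar>w z\<bar> \<partial>lborel) + ennreal depth * gradient_L1 \<Omega> w)"
      by (intro mult_left_mono collar_estimate w) auto
    also have "\<dots> \<le> ennreal C * (ennreal (1 + depth) * W11_norm \<Omega> w)"
    proof (intro mult_left_mono)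
      have 1: "(1::ennreal) \<le> ennreal (1 + depth)" "ennreal depth \<le> ennreal (1 + depth)"
        using depth_pos by (auto simp: ennreal_leI simp flip: ennreal_1)
      show "(\<integral>\<^sup>+z\<in>\<Omega>. ennreal \<bar>w z\<bar> \<partial>lborel) + ennreal depth * gradient_L1 \<Omega> w
          \<le> ennreal (1 + depth) * W11_norm \<Omega> w"
        unfolding W11_norm_def distrib_left
        using mult_right_mono[OF 1(1), of "\<integral>\<^sup>+z\<in>\<Omega>. ennreal \<bar>w z\<bar> \<partial>lborel"]
        by (intro add_mono mult_right_mono 1) auto
    qed simp
    also have "\<dots> = ennreal (C * (1 + depth)) * W11_norm \<Omega> w"
      using C(1) depth_pos by (simp add: ennreal_mult' mult.assoc)
    finally show "(\<integral>\<^sup>+y. ennreal \<bar>w y\<bar> * indicator (frontier \<Omega> \<inter> ball x (width / 2)) y \<partial>hausdorff_measure (DIM('a) - 1))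
       \<le> ennreal (C * (1 + depth)) * W11_norm \<Omega> w" .
  qed (use width_pos depth_pos C in auto)
qed

lemma space_surface_measure: "space (surface_measure \<Omega>) = frontier \<Omega>"
  by (simp add: surface_measure_def space_restrict_space)

lemma borel_measurable_surface:
  "f \<in> borel_measurable borel \<Longrightarrow> f \<in> borel_measurable (surface_measure \<Omega>)"
  unfolding surface_measure_def
  by (intro measurable_restrict_space1) (simp add: measurable_cong_sets[OF sets_hausdorff_measure refl])

lemma nn_integral_surface_measure:
  fixes f :: "'a::euclidean_space \<Rightarrow> ennreal"
  shows "(\<integral>\<^sup>+y. f y \<partial>surface_measure \<Omega>) = (\<integral>\<^sup>+y. f y * indicator (frontier \<Omega>) y \<partial>hausdorff_measure (DIM('a) - 1))"
  unfolding surface_measure_def by (intro nn_integral_restrict_space) simp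

lemma nn_integral_le_finite_cover:
  fixes f :: "'a \<Rightarrow> ennreal"
  assumes [measurable]: "f \<in> borel_measurable M" and fin: "finite F" and A: "\<And>i. i \<in> F \<Longrightarrow> A i \<in> sets M"
    and sub: "B \<subseteq> (\<Union>i\<in>F. A i)"
  shows "(\<integral>\<^sup>+y. f y * indicator B y \<partial>M) \<le> (\<Sum>i\<in>F. \<integral>\<^sup>+y. f y * indicator (A i) y \<partial>M)"
proof -
  have "(\<integral>\<^sup>+y. f y * indicator B y \<partial>M) \<le> (\<integral>\<^sup>+y. (\<Sum>i\<in>F. f y * indicator (A i) y) \<partial>M)"
  proof (intro nn_integral_mono)
    fix y
    show "f y * indicator B y \<le> (\<Sum>i\<in>F. f y * indicator (A i) y)"
    proof (cases "y \<in> B")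
      case True
      then obtain i where i: "i \<in> F" "y \<in> A i" using sub by auto
      then have "f y * indicator B y = f y * indicator (A i) y" using True by simp
      also have "\<dots> \<le> (\<Sum>i\<in>F. f y * indicator (A i) y)"
        using i fin by (intro member_le_sum) auto
      finally show ?thesis .
    qed simp
  qed
  also have "\<dots> = (\<Sum>i\<in>F. \<integral>\<^sup>+y. f y * indicator (A i) y \<partial>M)"
    by (intro nn_integral_sum borel_measurable_times_ennreal borel_measurable_indicator A assms)
  finally show ?thesis .
qed

text \<open>
  Every boundary value is the value at a nearby point of a collar plus an integral of the gradient
  along the segment in between; averaging over the collar yields the trace inequality in \<open>L\<^sup>1\<close>.
\<close>

lemma trace_inequality:
  fixes \<Omega> :: "'a::euclidean_space set"
  assumes "open \<Omega>" "bounded \<Omega>" "lipschitz_boundary \<Omega>"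
  obtains C :: real where "0 \<le> C"
    "\<And>w. C1_fun w \<Longrightarrow> (\<integral>\<^sup>+y. ennreal \<bar>w y\<bar> \<partial>surface_measure \<Omega>) \<le> ennreal C * W11_norm \<Omega> w"
proof -
  have "\<forall>x\<in>frontier \<Omega>. \<exists>\<rho> C. 0 < \<rho> \<and> 0 \<le> C \<and> (\<forall>w. C1_fun w \<longrightarrow>
    (\<integral>\<^sup>+y. ennreal \<bar>w y\<bar> * indicator (frontier \<Omega> \<inter> ball x \<rho>) y \<partial>hausdorff_measure (DIM('a) - 1))
      \<le> ennreal C * W11_norm \<Omega> w)"
    by (intro ballI trace_inequality_local assms)
  then obtain \<rho> C where \<rho>: "\<And>x. x \<in> frontier \<Omega> \<Longrightarrow> 0 < \<rho> x" and C: "\<And>x. x \<in> frontier \<Omega> \<Longrightarrow> 0 \<le> C x"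
    and le: "\<And>x w. x \<in> frontier \<Omega> \<Longrightarrow> C1_fun w \<Longrightarrow>
    (\<integral>\<^sup>+y. ennreal \<bar>w y\<bar> * indicator (frontier \<Omega> \<inter> ball x (\<rho> x)) y \<partial>hausdorff_measure (DIM('a) - 1))
      \<le> ennreal (C x) * W11_norm \<Omega> w"
    by (simp only: bchoice_iff) auto
  have "compact (frontier \<Omega>)" using assms by (simp add: compact_frontier_bounded)
  then obtain F where F: "F \<subseteq> frontier \<Omega>" "finite F" "frontier \<Omega> \<subseteq> (\<Union>x\<in>F. ball x (\<rho> x))"
    by (rule compactE_image[of _ "frontier \<Omega>" "\<lambda>x. ball x (\<rho> x)"]) (use \<rho> in auto)
  have sum: "0 \<le> (\<Sum>x\<in>F. C x)" using C F by (intro sum_nonneg) auto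
  show ?thesis
  proof (rule that[OF sum])
    fix w :: "'a \<Rightarrow> real" assume w: "C1_fun w"
    note [measurable] = measurable_C1_fun[OF w]
    have "(\<integral>\<^sup>+y. ennreal \<bar>w y\<bar> \<partial>surface_measure \<Omega>) \<le>
      (\<Sum>x\<in>F. \<integral>\<^sup>+y. ennreal \<bar>w y\<bar> * indicator (frontier \<Omega> \<inter> ball x (\<rho> x)) y \<partial>hausdorff_measure (DIM('a) - 1))"
      unfolding nn_integral_surface_measure
      using F by (intro nn_integral_le_finite_cover) auto
    also have "\<dots> \<le> (\<Sum>x\<in>F. ennreal (C x) * W11_norm \<Omega> w)"
      using F w by (intro sum_mono le) auto
    also have "\<dots> = ennreal (\<Sum>x\<in>F. C x) * W11_norm \<Omega> w"
      using C F by (simp add: sum_distrib_right[symmetric] sum_ennreal subset_iff)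
    finally show "(\<integral>\<^sup>+y. ennreal \<bar>w y\<bar> \<partial>surface_measure \<Omega>) \<le> ennreal (\<Sum>x\<in>F. C x) * W11_norm \<Omega> w" .
  qed
qed

lemma finite_measure_surface_measure:
  fixes \<Omega> :: "'a::euclidean_space set"
  assumes "open \<Omega>" "bounded \<Omega>" "lipschitz_boundary \<Omega>"
  shows "finite_measure (surface_measure \<Omega>)"
proof (rule finite_measureI)
  obtain C :: real where C: "0 \<le> C"
    "\<And>w. C1_fun w \<Longrightarrow> (\<integral>\<^sup>+y. ennreal \<bar>w y\<bar> \<partial>surface_measure \<Omega>) \<le> ennreal C * W11_norm \<Omega> w"
    using trace_inequality[OF assms] by blast
  have "emeasure lborel \<Omega> \<noteq> \<infinity>"
    using emeasure_bounded_finite[OF assms(2)] by simp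
  moreover have "emeasure (surface_measure \<Omega>) (space (surface_measure \<Omega>)) \<le> ennreal C * emeasure lborel \<Omega>"
    using C(2)[OF C1_fun_const(1), of 1] assms(1) by (simp add: W11_norm_def C1_fun_const(2))
  ultimately show "emeasure (surface_measure \<Omega>) (space (surface_measure \<Omega>)) \<noteq> \<infinity>"
    by (metis ennreal_mult_eq_top_iff ennreal_neq_top infinity_ennreal_def neq_top_trans)
qed


section \<open>A Poincare inequality by sequences\<close>

lemma nn_integral_translate_estimate:
  fixes w :: "'a::euclidean_space \<Rightarrow> real"
  assumes \<Omega>: "\<Omega> \<in> sets borel" and w: "C1_fun w" and N: "N \<in> sets borel" and B: "B \<in> sets borel"
    and sub: "\<And>z t. z \<in> N \<Longrightarrow> 0 \<le> t \<Longrightarrow> t \<le> 1 \<Longrightarrow> z + t *\<^sub>R h \<in> \<Omega>"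
    and NB: "\<And>z. z \<in> N \<Longrightarrow> z + h \<in> B"
  shows "(\<integral>\<^sup>+z\<in>N. ennreal \<bar>w z - c\<bar> \<partial>lborel) \<le> (\<integral>\<^sup>+z\<in>B. ennreal \<bar>w z - c\<bar> \<partial>lborel)
    + ennreal (norm h) * gradient_L1 \<Omega> w"
proof -
  note [measurable] = measurable_C1_fun[OF w] \<Omega> N B
  have "(\<integral>\<^sup>+z\<in>N. ennreal \<bar>w z - c\<bar> \<partial>lborel) \<le>
    (\<integral>\<^sup>+z. ennreal \<bar>w (z + h) - c\<bar> * indicator B (z + h) + ennreal \<bar>w (z + h) - w z\<bar> * indicator N z \<partial>lborel)"
  proof (intro nn_integral_mono)
    fix z
    have "ennreal \<bar>w z - c\<bar> \<le> ennreal \<bar>w (z + h) - c\<bar> + ennreal \<bar>w (z + h) - w z\<bar>"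
      by (subst ennreal_plus[symmetric]) (simp_all only: abs_ge_zero, intro ennreal_leI, linarith)
    then show "ennreal \<bar>w z - c\<bar> * indicator N z \<le>
        ennreal \<bar>w (z + h) - c\<bar> * indicator B (z + h) + ennreal \<bar>w (z + h) - w z\<bar> * indicator N z"
      using NB[of z] by (cases "z \<in> N") auto
  qed
  also have "\<dots> = (\<integral>\<^sup>+z. ennreal \<bar>w (z + h) - c\<bar> * indicator B (z + h) \<partial>lborel) +
     (\<integral>\<^sup>+z\<in>N. ennreal \<bar>w (z + h) - w z\<bar> \<partial>lborel)"
    by (intro nn_integral_add) measurable
  also have "(\<integral>\<^sup>+z. ennreal \<bar>w (z + h) - c\<bar> * indicator B (z + h) \<partial>lborel) = (\<integral>\<^sup>+z\<in>B. ennreal \<bar>w z - c\<bar> \<partial>lborel)"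
    by (rule nn_integral_lborel_translation[where f = "\<lambda>z. ennreal \<bar>w z - c\<bar> * indicator B z"]) measurable
  also have "(\<integral>\<^sup>+z\<in>N. ennreal \<bar>w (z + h) - w z\<bar> \<partial>lborel) \<le>
      ennreal (norm h) * gradient_L1 \<Omega> w"
    by (intro translation_estimate \<Omega> w sub)
  finally show ?thesis by (simp add: add_left_mono)
qed

text \<open>
  The mean oscillation over a convex set is controlled by translating the set by the difference of
  two of its points.
\<close>

lemma mean_oscillation_estimate:
  fixes w :: "'a::euclidean_space \<Rightarrow> real"
  assumes w: "C1_fun w"
  shows "(\<integral>\<^sup>+y\<in>ball x \<rho>. (\<integral>\<^sup>+z\<in>ball x \<rho>. ennreal \<bar>w y - w z\<bar> \<partial>lborel) \<partial>lborel) \<le>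
    ennreal (2 * \<rho>) * emeasure lborel (ball (0::'a) (2 * \<rho>)) *
      gradient_L1 (ball x \<rho>) w"
proof -
  note [measurable] = measurable_C1_fun[OF w]
  define B where "B = ball x \<rho>"
  have [measurable]: "B \<in> sets borel" by (simp add: B_def)
  define G where "G = gradient_L1 B w"
  have "(\<integral>\<^sup>+y\<in>B. (\<integral>\<^sup>+z\<in>B. ennreal \<bar>w y - w z\<bar> \<partial>lborel) \<partial>lborel) =
     (\<integral>\<^sup>+y. (\<integral>\<^sup>+z. ennreal \<bar>w y - w z\<bar> * indicator B z * indicator B y \<partial>lborel) \<partial>lborel)"
    by (intro nn_integral_cong) (simp add: nn_integral_multc)
  also have "\<dots> = (\<integral>\<^sup>+z. (\<integral>\<^sup>+y. ennreal \<bar>w y - w z\<bar> * indicator B z * indicator B y \<partial>lborel) \<partial>lborel)"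
    by (rule lborel_pair.Fubini') measurable
  also have "\<dots> = (\<integral>\<^sup>+z. (\<integral>\<^sup>+h. ennreal \<bar>w (h + z) - w z\<bar> * indicator B z * indicator B (h + z) \<partial>lborel) \<partial>lborel)"
    by (intro nn_integral_cong nn_integral_lborel_translation[symmetric]) measurable
  also have "\<dots> = (\<integral>\<^sup>+h. (\<integral>\<^sup>+z. ennreal \<bar>w (h + z) - w z\<bar> * indicator B z * indicator B (h + z) \<partial>lborel) \<partial>lborel)"
    by (rule lborel_pair.Fubini') measurable
  also have "\<dots> \<le> (\<integral>\<^sup>+h. ennreal (2 * \<rho>) * G * indicator (ball (0::'a) (2 * \<rho>)) h \<partial>lborel)"
  proof (intro nn_integral_mono)
    fix h :: 'a
    define N where "N = {z \<in> B. z + h \<in> B}"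
    have eq: "ennreal \<bar>w (h + z) - w z\<bar> * indicator B z * indicator B (h + z) =
        ennreal \<bar>w (z + h) - w z\<bar> * indicator N z" for z
      by (simp add: N_def indicator_def add.commute)
    have seg: "z + t *\<^sub>R h \<in> B" if "z \<in> N" "0 \<le> t" "t \<le> 1" for z t
    proof -
      have "(1 - t) *\<^sub>R z + t *\<^sub>R (z + h) \<in> B"
        using that unfolding N_def B_def by (intro convexD[OF convex_ball]) auto
      then show ?thesis by (simp add: algebra_simps)
    qed
    have "(\<integral>\<^sup>+z\<in>N. ennreal \<bar>w (z + h) - w z\<bar> \<partial>lborel) \<le> ennreal (norm h) * G"
      unfolding G_def by (intro translation_estimate w seg) simp
    also have "\<dots> \<le> ennreal (2 * \<rho>) * G" if "h \<in> ball 0 (2 * \<rho>)"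
      using that by (intro mult_right_mono ennreal_leI) auto
    finally have 1: "(\<integral>\<^sup>+z\<in>N. ennreal \<bar>w (z + h) - w z\<bar> \<partial>lborel) \<le> ennreal (2 * \<rho>) * G"
      if "h \<in> ball 0 (2 * \<rho>)" using that .
    have 2: "N = {}" if "h \<notin> ball 0 (2 * \<rho>)"
    proof (rule ccontr)
      assume "N \<noteq> {}"
      then obtain z where z: "z \<in> ball x \<rho>" "z + h \<in> ball x \<rho>" by (auto simp: N_def B_def)
      have "norm h \<le> dist x z + dist x (z + h)"
        using dist_triangle[of z "z + h" x] by (simp add: dist_norm norm_minus_commute)
      then show False using z that by simp
    qed
    show "(\<integral>\<^sup>+z. ennreal \<bar>w (h + z) - w z\<bar> * indicator B z * indicator B (h + z) \<partial>lborel)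
       \<le> ennreal (2 * \<rho>) * G * indicator (ball 0 (2 * \<rho>)) h"
      unfolding eq using 1 2 by (cases "h \<in> ball 0 (2 * \<rho>)") auto
  qed
  also have "\<dots> = ennreal (2 * \<rho>) * emeasure lborel (ball (0::'a) (2 * \<rho>)) * G"
    by (subst nn_integral_cmult_indicator) (auto simp: mult_ac)
  finally show ?thesis by (simp add: B_def G_def)
qed

text \<open>
  If every value exceeded the average, so would the integral over the ball; the slack \<open>\<epsilon>\<close> makes the
  inequality strict after integration.
\<close>

lemma ex_value_le_average:
  fixes F :: "'a::euclidean_space \<Rightarrow> ennreal"
  assumes [measurable]: "F \<in> borel_measurable borel" and \<rho>: "0 < \<rho>" and \<epsilon>: "0 < (\<epsilon>::real)"
  shows "\<exists>y. F y * emeasure lborel (ball x \<rho>) \<le> (\<integral>\<^sup>+y\<in>ball x \<rho>. F y \<partial>lborel) + ennreal \<epsilon>"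
proof (rule ccontr)
  define v where "v = emeasure lborel (ball x \<rho>)"
  define I where "I = (\<integral>\<^sup>+y\<in>ball x \<rho>. F y \<partial>lborel)"
  have v: "0 < v" "v < \<infinity>"
    using \<rho> by (simp_all add: v_def emeasure_ball)
  assume "\<nexists>y. F y * emeasure lborel (ball x \<rho>) \<le> (\<integral>\<^sup>+y\<in>ball x \<rho>. F y \<partial>lborel) + ennreal \<epsilon>"
  then have lt: "I + ennreal \<epsilon> < F y * v" for y unfolding v_def I_def by (auto simp: not_le)
  have I: "I < \<infinity>" using lt[of 0] less_top[of "I"] by (cases "I = \<infinity>") (auto simp: less_top)
  have "(I + ennreal \<epsilon>) * v = (\<integral>\<^sup>+y\<in>ball x \<rho>. (I + ennreal \<epsilon>) \<partial>lborel)"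
    by (simp add: nn_integral_cmult_indicator v_def)
  also have "\<dots> \<le> (\<integral>\<^sup>+y\<in>ball x \<rho>. F y * v \<partial>lborel)"
    using lt by (intro nn_integral_mono mult_right_mono) (auto intro: less_imp_le)
  also have "\<dots> = I * v"
  proof -
    have [measurable]: "ball x \<rho> \<in> sets borel" by simp
    have "I * v = (\<integral>\<^sup>+y. F y * indicator (ball x \<rho>) y * v \<partial>lborel)"
      unfolding I_def
      by (intro nn_integral_multc[symmetric] borel_measurable_times_ennreal borel_measurable_indicator) auto
    then show ?thesis by (simp add: mult_ac)
  qed
  finally have "I * v + ennreal \<epsilon> * v \<le> I * v + 0" by (simp add: distrib_right)
  moreover have "I * v \<noteq> \<infinity>" using I v by (auto simp: ennreal_mult_eq_top_iff)
  ultimately have "ennreal \<epsilon> * v \<le> 0" by (subst (asm) ennreal_add_left_cancel_le) auto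
  then show False using \<epsilon> v by (simp add: ennreal_eq_0_iff)
qed

text \<open>
  The Poincare inequality is used only for sequences: if the gradients tend to 0 in \<open>L\<^sup>1\<close>, there are
  constants \<open>c n\<close> such that \<open>w n - c n\<close> tends to 0 in \<open>L\<^sup>1\<close>. The constants are found on one small ball. The
  property then spreads over the domain, since translating a set inside the domain preserves it, and
  compactness of the closure makes it global.
\<close>

locale vanishing_gradients =
  fixes \<Omega> :: "'a::euclidean_space set" and w :: "nat \<Rightarrow> 'a \<Rightarrow> real"
  assumes open_domain: "open \<Omega>" and bounded_domain: "bounded \<Omega>"
    and connected_domain: "connected \<Omega>" and lipschitz_domain: "lipschitz_boundary \<Omega>"
    and C1: "\<And>n. C1_fun (w n)"
    and vanish: "(\<lambda>n. gradient_L1 \<Omega> (w n)) \<longlonglongrightarrow> 0"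
begin

definition settles :: "(nat \<Rightarrow> real) \<Rightarrow> 'a set \<Rightarrow> bool" where
  "settles c B \<longleftrightarrow> (\<lambda>n. \<integral>\<^sup>+z\<in>B. ennreal \<bar>w n z - c n\<bar> \<partial>lborel) \<longlonglongrightarrow> 0"

lemma settles_subset:
  assumes "settles c B" "A \<subseteq> B"
  shows "settles c A"
  unfolding settles_def
proof (rule tendsto_sandwich[OF _ _ tendsto_const assms(1)[unfolded settles_def]])
  show "eventually (\<lambda>n. (\<integral>\<^sup>+z\<in>A. ennreal \<bar>w n z - c n\<bar> \<partial>lborel) \<le> (\<integral>\<^sup>+z\<in>B. ennreal \<bar>w n z - c n\<bar> \<partial>lborel)) sequentially"
    using assms(2) by (intro always_eventually allI nn_integral_mono) (auto simp: indicator_def)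
qed simp

lemma settles_translate:
  assumes "settles c B" "N \<in> sets borel" "B \<in> sets borel"
    and "\<And>z t. z \<in> N \<Longrightarrow> 0 \<le> t \<Longrightarrow> t \<le> 1 \<Longrightarrow> z + t *\<^sub>R h \<in> \<Omega>"
    and "\<And>z. z \<in> N \<Longrightarrow> z + h \<in> B"
  shows "settles c N"
  unfolding settles_def
proof (rule tendsto_sandwich[OF _ _ tendsto_const])
  show "eventually (\<lambda>n. (\<integral>\<^sup>+z\<in>N. ennreal \<bar>w n z - c n\<bar> \<partial>lborel) \<le>
      (\<integral>\<^sup>+z\<in>B. ennreal \<bar>w n z - c n\<bar> \<partial>lborel) +
      ennreal (norm h) * gradient_L1 \<Omega> (w n)) sequentially"
    using assms open_domain C1
    by (intro always_eventually allI nn_integral_translate_estimate) auto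
  have "(\<lambda>n. (\<integral>\<^sup>+z\<in>B. ennreal \<bar>w n z - c n\<bar> \<partial>lborel) +
      ennreal (norm h) * gradient_L1 \<Omega> (w n)) \<longlonglongrightarrow> 0 + ennreal (norm h) * 0"
    using assms(1) vanish unfolding settles_def by (intro tendsto_add ennreal_tendsto_cmult) auto
  then show "(\<lambda>n. (\<integral>\<^sup>+z\<in>B. ennreal \<bar>w n z - c n\<bar> \<partial>lborel) +
      ennreal (norm h) * gradient_L1 \<Omega> (w n)) \<longlonglongrightarrow> 0" by simp
qed simp

text \<open>
  The constant is the value of the function at a point where the mean distance to the values on the
  ball is at most its own average, up to an error that tends to 0.
\<close>

lemma settles_in_ball:
  assumes "0 < \<rho>" "ball x \<rho> \<subseteq> \<Omega>"
  obtains c where "settles c (ball x \<rho>)"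
proof -
  define v where "v = emeasure lborel (ball x \<rho>)"
  have v: "0 < v" "v < \<infinity>" using assms by (simp_all add: v_def emeasure_ball)
  define F where "F n y = (\<integral>\<^sup>+z\<in>ball x \<rho>. ennreal \<bar>w n y - w n z\<bar> \<partial>lborel)" for n y
  have [measurable]: "F n \<in> borel_measurable borel" for n
  proof -
    note [measurable] = measurable_C1_fun[OF C1]
    define B where "B = ball x \<rho>"
    have [measurable]: "B \<in> sets borel" by (simp add: B_def)
    show ?thesis unfolding F_def B_def[symmetric] by measurable
  qed
  define K where "K = ennreal (2 * \<rho>) * emeasure lborel (ball (0::'a) (2 * \<rho>))"
  have K: "K < \<infinity>"
    using emeasure_lborel_ball_finite[of "0::'a" "2 * \<rho>"] unfolding K_def by (simp add: ennreal_mult_less_top)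
  have "\<forall>n. \<exists>y. F n y * v \<le> (\<integral>\<^sup>+y\<in>ball x \<rho>. F n y \<partial>lborel) + ennreal (1 / real (Suc n))"
    unfolding v_def by (intro allI ex_value_le_average) (use assms in auto)
  then obtain y where y: "\<And>n. F n (y n) * v \<le> (\<integral>\<^sup>+y\<in>ball x \<rho>. F n y \<partial>lborel) + ennreal (1 / real (Suc n))"
    by metis
  let ?G = "\<lambda>n. gradient_L1 \<Omega> (w n)"
  have bound: "F n (y n) \<le> (1 / v) * (K * ?G n + ennreal (1 / real (Suc n)))" for n
  proof -
    have "F n (y n) * v \<le> K * ?G n + ennreal (1 / real (Suc n))"
    proof (rule order_trans[OF y add_right_mono])
      have "(\<integral>\<^sup>+y\<in>ball x \<rho>. F n y \<partial>lborel) \<le> K * gradient_L1 (ball x \<rho>) (w n)"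
        unfolding F_def K_def by (rule mean_oscillation_estimate[OF C1])
      also have "\<dots> \<le> K * ?G n"
        using assms(2) by (intro mult_left_mono nn_integral_mono) (auto simp: indicator_def)
      finally show "(\<integral>\<^sup>+y\<in>ball x \<rho>. F n y \<partial>lborel) \<le> K * ?G n" .
    qed
    then have "(1 / v) * (F n (y n) * v) \<le> (1 / v) * (K * ?G n + ennreal (1 / real (Suc n)))"
      by (rule mult_left_mono) simp
    moreover have "(1 / v) * (F n (y n) * v) = F n (y n)"
      using mult_divide_eq_ennreal[of v "F n (y n)"] v by (simp add: divide_ennreal_def mult_ac)
    ultimately show ?thesis by simp
  qed
  have "settles (\<lambda>n. w n (y n)) (ball x \<rho>)"
    unfolding settles_def
  proof (rule tendsto_sandwich[OF _ _ tendsto_const])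
    show "eventually (\<lambda>n. (\<integral>\<^sup>+z\<in>ball x \<rho>. ennreal \<bar>w n z - w n (y n)\<bar> \<partial>lborel) \<le>
        (1 / v) * (K * ?G n + ennreal (1 / real (Suc n)))) sequentially"
      using bound unfolding F_def by (intro always_eventually allI) (simp add: abs_minus_commute)
    have "(\<lambda>n. (1 / v) * (K * ?G n + ennreal (1 / real (Suc n)))) \<longlonglongrightarrow> (1 / v) * (K * 0 + ennreal 0)"
    proof (intro ennreal_tendsto_cmult tendsto_add tendsto_ennrealI vanish)
      show "1 / v < top" using v by (simp add: ennreal_divide_eq_top_iff less_top[symmetric])
      show "(\<lambda>n. 1 / real (Suc n)) \<longlonglongrightarrow> 0"
        using LIMSEQ_inverse_real_of_nat by (simp add: inverse_eq_divide)
    qed (use K in auto)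
    then show "(\<lambda>n. (1 / v) * (K * ?G n + ennreal (1 / real (Suc n)))) \<longlonglongrightarrow> 0" by simp
  qed simp
  then show ?thesis by (rule that)
qed

text \<open>
  If \<open>w n - c n\<close> tends to 0 near one point of a ball in the domain, then near every point of that
  ball, because the two neighbourhoods are translates of each other within the ball.
\<close>

lemma settles_near_in_ball:
  assumes B: "ball x \<rho> \<subseteq> \<Omega>" and y: "y \<in> ball x \<rho>" "0 < r" "settles c (ball y r)" and y': "y' \<in> ball x \<rho>"
  shows "\<exists>r'>0. settles c (ball y' r')"
proof -
  obtain s where s: "0 < s" "ball y s \<subseteq> ball x \<rho>"
    using openE[OF open_ball y(1)] by blast
  obtain s' where s': "0 < s'" "ball y' s' \<subseteq> ball x \<rho>"
    using openE[OF open_ball y'] by blast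
  define r' where "r' = min r (min s s')"
  have r': "0 < r'" "r' \<le> r" "r' \<le> s" "r' \<le> s'" using y s s' by (auto simp: r'_def)
  have "settles c (ball y' r')"
  proof (rule settles_translate[OF y(3), where h = "y - y'"])
    fix z assume z: "z \<in> ball y' r'"
    have "dist y (z + (y - y')) = dist y' z" by (simp add: dist_norm algebra_simps)
    then have zy: "z + (y - y') \<in> ball y r'" using z by simp
    then show "z + (y - y') \<in> ball y r" using r' by auto
    fix t :: real assume t: "0 \<le> t" "t \<le> 1"
    have "(1 - t) *\<^sub>R z + t *\<^sub>R (z + (y - y')) \<in> ball x \<rho>"
    proof (rule convexD[OF convex_ball])
      show "z \<in> ball x \<rho>" using z r' s' by (meson subset_ball subsetD)
      show "z + (y - y') \<in> ball x \<rho>" using zy r' s by (meson subset_ball subsetD)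
    qed (use t in auto)
    then show "z + t *\<^sub>R (y - y') \<in> \<Omega>" using B by (auto simp: algebra_simps)
  qed auto
  then show ?thesis using r' by blast
qed

lemma settles_interior:
  assumes x: "x \<in> \<Omega>" "0 < r" "settles c (ball x r)" and y: "y \<in> \<Omega>"
  shows "\<exists>r'>0. settles c (ball y r')"
proof (rule connected_induction_simple[OF connected_domain x(1) y])
  show "\<exists>r'>0. settles c (ball x r')" using x by blast
  fix a assume "a \<in> \<Omega>"
  then obtain \<rho> where \<rho>: "0 < \<rho>" "ball a \<rho> \<subseteq> \<Omega>" using open_domain openE by blast
  show "\<exists>T. openin (top_of_set \<Omega>) T \<and> a \<in> T \<and>
     (\<forall>x\<in>T. \<forall>y\<in>T. (\<exists>r'>0. settles c (ball x r')) \<longrightarrow> (\<exists>r'>0. settles c (ball y r')))"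
  proof (intro exI[of _ "ball a \<rho>"] conjI ballI impI)
    show "openin (top_of_set \<Omega>) (ball a \<rho>)" using \<rho> open_domain by (simp add: openin_open_eq)
    fix x y assume "x \<in> ball a \<rho>" "y \<in> ball a \<rho>" "\<exists>r'>0. settles c (ball x r')"
    then show "\<exists>r'>0. settles c (ball y r')" using settles_near_in_ball[OF \<rho>(2)] by blast
  qed (use \<rho> in simp)
qed

text \<open>
  In a chart, the part of the domain near a boundary point is translated upwards into a ball inside the
  domain, and all intermediate translates stay in the domain.
\<close>

lemma settles_frontier:
  assumes int: "\<And>y. y \<in> \<Omega> \<Longrightarrow> \<exists>r>0. settles c (ball y r)" and x: "x \<in> frontier \<Omega>"
  shows "\<exists>r>0. settles c (\<Omega> \<inter> ball x r)"
proof -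
  obtain r e \<gamma> L where "lipschitz_chart \<Omega> x e r L \<gamma>"
    using lipschitz_boundary_chart[OF open_domain lipschitz_domain x] by blast
  then interpret lipschitz_chart \<Omega> x e r L \<gamma> .
  \<comment> \<open>From points at distance at most \<open>r/2\<close> the translation by \<open>r/4\<close> stays in the ball of the chart.\<close>
  define \<tau> where "\<tau> = r / 4"
  have up: "z + t *\<^sub>R e \<in> \<Omega>" if "height z \<le> z \<bullet> e" "dist x z < r / 2" "0 \<le> t" "t \<le> \<tau>" "height z < z \<bullet> e \<or> 0 < t" for z t
  proof -
    have "dist x (z + t *\<^sub>R e) \<le> dist x z + dist z (z + t *\<^sub>R e)" by (rule dist_triangle)
    also have "dist z (z + t *\<^sub>R e) = t" using that dir by (simp add: dist_norm)
    finally have "z + t *\<^sub>R e \<in> ball x r" using that radius by (simp add: \<tau>_def)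
    moreover have "height (z + t *\<^sub>R e) < (z + t *\<^sub>R e) \<bullet> e"
      using that by (auto simp: inner_add_left ee)
    ultimately show ?thesis by (simp add: domain_iff)
  qed
  have \<tau>: "0 < \<tau>" using radius by (simp add: \<tau>_def)
  have "x + \<tau> *\<^sub>R e \<in> \<Omega>"
    by (rule up) (use frontier_height[OF x] radius \<tau> in auto)
  then obtain s where s: "0 < s" "settles c (ball (x + \<tau> *\<^sub>R e) s)" using int by blast
  define \<rho> where "\<rho> = min s (r / 2)"
  have \<rho>: "0 < \<rho>" "\<rho> \<le> s" "\<rho> \<le> r / 2" using s radius by (auto simp: \<rho>_def)
  have "settles c (\<Omega> \<inter> ball x \<rho>)"
  proof (rule settles_translate[OF s(2), where h = "\<tau> *\<^sub>R e"])
    show "\<Omega> \<inter> ball x \<rho> \<in> sets borel" using open_domain by auto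
    fix z assume z: "z \<in> \<Omega> \<inter> ball x \<rho>"
    have "dist (x + \<tau> *\<^sub>R e) (z + \<tau> *\<^sub>R e) = dist x z" by simp
    then show "z + \<tau> *\<^sub>R e \<in> ball (x + \<tau> *\<^sub>R e) s" using z \<rho> by simp
    have h: "height z < z \<bullet> e" using z \<rho> radius domain_iff[of z] by auto
    fix t :: real assume "0 \<le> t" "t \<le> 1"
    then have "z + (t * \<tau>) *\<^sub>R e \<in> \<Omega>"
      using z \<rho> h \<tau> by (intro up) (auto intro: mult_left_le_one_le)
    then show "z + t *\<^sub>R (\<tau> *\<^sub>R e) \<in> \<Omega>" by simp
  qed simp
  then show ?thesis using \<rho> by blast
qed

lemma settles_domain: "\<exists>c. settles c \<Omega>"
proof (cases "\<Omega> = {}")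
  case True
  then show ?thesis by (simp add: settles_def)
next
  case False
  then obtain a where a0: "a \<in> \<Omega>" by blast
  obtain \<rho> where "0 < \<rho>" "ball a \<rho> \<subseteq> \<Omega>" using openE[OF open_domain a0] .
  note a = a0 this
  obtain c where c: "settles c (ball a \<rho>)" using settles_in_ball[OF a(2,3)] by blast
  have int: "\<exists>r>0. settles c (ball y r)" if "y \<in> \<Omega>" for y
    using settles_interior[OF a(1,2) c that] .
  have "\<forall>x\<in>closure \<Omega>. \<exists>r>0. settles c (\<Omega> \<inter> ball x r)"
  proof
    fix x assume "x \<in> closure \<Omega>"
    then consider "x \<in> \<Omega>" | "x \<in> frontier \<Omega>"
      using open_domain by (auto simp: frontier_def interior_open)
    then show "\<exists>r>0. settles c (\<Omega> \<inter> ball x r)"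
    proof cases
      case 1
      then obtain s where "0 < s" "settles c (ball x s)" using int by blast
      then show ?thesis using settles_subset[of c "ball x s" "\<Omega> \<inter> ball x s"] by blast
    next
      case 2
      then show ?thesis by (intro settles_frontier int)
    qed
  qed
  then obtain r where r: "\<And>x. x \<in> closure \<Omega> \<Longrightarrow> 0 < r x" "\<And>x. x \<in> closure \<Omega> \<Longrightarrow> settles c (\<Omega> \<inter> ball x (r x))"
    by (simp only: bchoice_iff) auto
  have "compact (closure \<Omega>)" using bounded_domain by (simp add: compact_closure)
  then obtain F where F: "F \<subseteq> closure \<Omega>" "finite F" "closure \<Omega> \<subseteq> (\<Union>x\<in>F. ball x (r x))"
    by (rule compactE_image[of _ "closure \<Omega>" "\<lambda>x. ball x (r x)"]) (use r in auto)
  have "settles c \<Omega>"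
    unfolding settles_def
  proof (rule tendsto_sandwich[OF _ _ tendsto_const])
    show "eventually (\<lambda>n. (\<integral>\<^sup>+z\<in>\<Omega>. ennreal \<bar>w n z - c n\<bar> \<partial>lborel) \<le>
       (\<Sum>x\<in>F. \<integral>\<^sup>+z\<in>\<Omega> \<inter> ball x (r x). ennreal \<bar>w n z - c n\<bar> \<partial>lborel)) sequentially"
    proof (intro always_eventually allI nn_integral_le_finite_cover)
      note [measurable] = measurable_C1_fun[OF C1]
      show "(\<lambda>z. ennreal \<bar>w n z - c n\<bar>) \<in> borel_measurable lborel" for n by measurable
      show "\<Omega> \<subseteq> (\<Union>x\<in>F. \<Omega> \<inter> ball x (r x))" using subset_trans[OF closure_subset F(3)] by auto
    qed (use F open_domain in auto)
    have "(\<lambda>n. \<Sum>x\<in>F. \<integral>\<^sup>+z\<in>\<Omega> \<inter> ball x (r x). ennreal \<bar>w n z - c n\<bar> \<partial>lborel) \<longlonglongrightarrow> (\<Sum>x\<in>F. 0)"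
      using r(2) F(1) unfolding settles_def by (intro tendsto_sum) auto
    then show "(\<lambda>n. \<Sum>x\<in>F. \<integral>\<^sup>+z\<in>\<Omega> \<inter> ball x (r x). ennreal \<bar>w n z - c n\<bar> \<partial>lborel) \<longlonglongrightarrow> 0" by simp
  qed simp
  then show ?thesis by blast
qed

lemma boundary_values_settle:
  "\<exists>c. (\<lambda>n. \<integral>\<^sup>+y. ennreal \<bar>w n y - c n\<bar> \<partial>surface_measure \<Omega>) \<longlonglongrightarrow> 0"
proof -
  obtain c where c: "settles c \<Omega>" using settles_domain by blast
  obtain C :: real where C: "0 \<le> C"
    "\<And>w. C1_fun w \<Longrightarrow> (\<integral>\<^sup>+y. ennreal \<bar>w y\<bar> \<partial>surface_measure \<Omega>) \<le> ennreal C * W11_norm \<Omega> w"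
    using trace_inequality[OF open_domain bounded_domain lipschitz_domain] by blast
  have "(\<lambda>n. \<integral>\<^sup>+y. ennreal \<bar>w n y - c n\<bar> \<partial>surface_measure \<Omega>) \<longlonglongrightarrow> 0"
  proof (rule tendsto_sandwich[OF _ _ tendsto_const])
    have sh: "C1_fun (\<lambda>x. w n x - c n)" "gradient (\<lambda>x. w n x - c n) = gradient (w n)" for n
      using C1_fun_linear_combination[OF C1[of n] C1_fun_const(1), of 1 "-1" "c n"]
      by (simp_all add: C1_fun_const(2))
    show "eventually (\<lambda>n. (\<integral>\<^sup>+y. ennreal \<bar>w n y - c n\<bar> \<partial>surface_measure \<Omega>) \<le>
      ennreal C * ((\<integral>\<^sup>+z\<in>\<Omega>. ennreal \<bar>w n z - c n\<bar> \<partial>lborel) + gradient_L1 \<Omega> (w n))) sequentially"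
      using C(2)[OF sh(1)] by (intro always_eventually allI) (simp add: W11_norm_def sh(2))
    have "(\<lambda>n. ennreal C * ((\<integral>\<^sup>+z\<in>\<Omega>. ennreal \<bar>w n z - c n\<bar> \<partial>lborel) + gradient_L1 \<Omega> (w n)))
      \<longlonglongrightarrow> ennreal C * (0 + 0)"
      using c vanish unfolding settles_def by (intro ennreal_tendsto_cmult tendsto_add) auto
    then show "(\<lambda>n. ennreal C * ((\<integral>\<^sup>+z\<in>\<Omega>. ennreal \<bar>w n z - c n\<bar> \<partial>lborel) + gradient_L1 \<Omega> (w n)))
      \<longlonglongrightarrow> 0" by simp
  qed simp
  then show ?thesis by blast
qed

end


section \<open>Linearity and uniqueness of traces\<close>

locale lipschitz_domain =
  fixes \<Omega> :: "'a::euclidean_space set" and p :: real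
  assumes open_domain: "open \<Omega>" and bounded_domain: "bounded \<Omega>"
    and lipschitz_domain: "lipschitz_boundary \<Omega>" and p: "1 < p"
begin

sublocale surface: finite_measure "surface_measure \<Omega>"
  using finite_measure_surface_measure open_domain bounded_domain lipschitz_domain .

sublocale volume: finite_measure "lebesgue_on \<Omega>"
  using finite_measure_lebesgue_on_open open_domain bounded_domain .

lemma W1_combine:
  assumes "u \<in> sobolev_W1 \<Omega> p" "v \<in> sobolev_W1 \<Omega> p"
  shows "(\<lambda>x. a * u x + b * v x) \<in> sobolev_W1 \<Omega> p"
    and "AE x in lebesgue_on \<Omega>. weak_gradient \<Omega> (\<lambda>x. a * u x + b * v x) x =
           a *\<^sub>R weak_gradient \<Omega> u x + b *\<^sub>R weak_gradient \<Omega> v x"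
  using sobolev_W1_linear_combination[OF open_domain assms] p by auto

lemma W1_diff:
  assumes "u \<in> sobolev_W1 \<Omega> p" "v \<in> sobolev_W1 \<Omega> p"
  shows "(\<lambda>x. u x - v x) \<in> sobolev_W1 \<Omega> p"
    and "AE x in lebesgue_on \<Omega>. weak_gradient \<Omega> (\<lambda>x. u x - v x) x =
           weak_gradient \<Omega> u x - weak_gradient \<Omega> v x"
  using W1_combine[OF assms, of 1 "-1"] by auto

lemma W1_C1_fun:
  assumes "C1_fun v"
  shows "v \<in> sobolev_W1 \<Omega> p" "AE x in lebesgue_on \<Omega>. weak_gradient \<Omega> v x = gradient v x"
  using C1_fun_sobolev_W1[OF open_domain bounded_domain assms] p by auto

lemma Lp_fun_surface_continuous:
  assumes "continuous_on UNIV v" "0 \<le> r"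
  shows "Lp_fun (surface_measure \<Omega>) r v"
proof -
  have "bounded (frontier \<Omega>)" using bounded_domain by (simp add: compact_frontier_bounded compact_imp_bounded)
  then obtain B where "\<And>x. x \<in> frontier \<Omega> \<Longrightarrow> norm (v x) \<le> B"
    using continuous_bounded_on_bounded[OF assms(1)] by blast
  then show ?thesis
    using assms by (intro surface.Lp_fun_bounded[of _ B])
      (auto simp: space_surface_measure intro!: borel_measurable_surface borel_measurable_continuous_onI)
qed

lemma has_traceE:
  assumes "has_trace \<Omega> p u g"
  obtains v where "\<And>n. smooth (v n)" "\<And>n. (\<lambda>x. v n x - u x) \<in> sobolev_W1 \<Omega> p"
    "(\<lambda>n. sobolev_norm \<Omega> p (\<lambda>x. v n x - u x)) \<longlonglongrightarrow> 0"
    "Lp_null (surface_measure \<Omega>) p (\<lambda>n x. v n x - g x)"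
proof -
  obtain v where v: "\<And>n. smooth (v n)" "(\<lambda>n. sobolev_norm \<Omega> p (\<lambda>x. v n x - u x)) \<longlonglongrightarrow> 0"
    "(\<lambda>n. LINT x|surface_measure \<Omega>. \<bar>v n x - g x\<bar> powr p) \<longlonglongrightarrow> 0"
    using assms by (auto simp: has_trace_def)
  have u: "u \<in> sobolev_W1 \<Omega> p" and g: "Lp_fun (surface_measure \<Omega>) p g"
    using assms by (auto simp: has_trace_def)
  have C1: "C1_fun (v n)" for n using v(1) smooth_imp_C1_fun by auto
  have "Lp_fun (surface_measure \<Omega>) p (\<lambda>x. v n x - g x)" for n
    using p by (intro Lp_fun_diff[OF Lp_fun_surface_continuous[OF C1_fun_continuous[OF C1]] g]) auto
  then have "Lp_null (surface_measure \<Omega>) p (\<lambda>n x. v n x - g x)"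
    using v(3) by (simp add: Lp_null_def)
  then show ?thesis
    using that[of v] v(1,2) W1_diff(1)[OF W1_C1_fun(1)[OF C1] u] by simp
qed

lemma has_trace_linear_combination:
  assumes "has_trace \<Omega> p u g" "has_trace \<Omega> p v h"
  shows "has_trace \<Omega> p (\<lambda>x. a * u x + b * v x) (\<lambda>x. a * g x + b * h x)"
proof -
  obtain U where U: "\<And>n. smooth (U n)" "\<And>n. (\<lambda>x. U n x - u x) \<in> sobolev_W1 \<Omega> p"
    "(\<lambda>n. sobolev_norm \<Omega> p (\<lambda>x. U n x - u x)) \<longlonglongrightarrow> 0"
    "Lp_null (surface_measure \<Omega>) p (\<lambda>n x. U n x - g x)"
    using has_traceE[OF assms(1)] by blast
  obtain V where V: "\<And>n. smooth (V n)" "\<And>n. (\<lambda>x. V n x - v x) \<in> sobolev_W1 \<Omega> p"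
    "(\<lambda>n. sobolev_norm \<Omega> p (\<lambda>x. V n x - v x)) \<longlonglongrightarrow> 0"
    "Lp_null (surface_measure \<Omega>) p (\<lambda>n x. V n x - h x)"
    using has_traceE[OF assms(2)] by blast
  have uv: "u \<in> sobolev_W1 \<Omega> p" "v \<in> sobolev_W1 \<Omega> p"
    and gh: "Lp_fun (surface_measure \<Omega>) p g" "Lp_fun (surface_measure \<Omega>) p h"
    using assms by (auto simp: has_trace_def)
  have e: "a * x + b * y - (a * x' + b * y') = a * (x - x') + b * (y - y')" for x y x' y' :: real
    by (simp add: algebra_simps)
  have 1: "(\<lambda>n. sobolev_norm \<Omega> p (\<lambda>x. a * U n x + b * V n x - (a * u x + b * v x))) \<longlonglongrightarrow> 0"
    unfolding e using p by (intro sobolev_null_linear_combination open_domain U V) auto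
  have "Lp_null (surface_measure \<Omega>) p (\<lambda>n x. a * U n x + b * V n x - (a * g x + b * h x))"
    unfolding e using Lp_null_linear_combination[OF U(4) V(4), of a b] p by simp
  then have 2: "(\<lambda>n. LINT x|surface_measure \<Omega>. \<bar>a * U n x + b * V n x - (a * g x + b * h x)\<bar> powr p) \<longlonglongrightarrow> 0"
    by (simp add: Lp_null_def)
  have 3: "Lp_fun (surface_measure \<Omega>) p (\<lambda>x. a * g x + b * h x)"
    using Lp_fun_linear_combination[OF gh, of a b] p by simp
  have 4: "smooth (\<lambda>x. a * U n x + b * V n x)" for n
    by (intro smooth_linear_combination U V)
  show ?thesis
    unfolding has_trace_def using 1 2 3 4 W1_combine(1)[OF uv]
    by (intro conjI exI[of _ "\<lambda>n x. a * U n x + b * V n x"] allI)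
qed

lemma has_trace_const: "has_trace \<Omega> p (\<lambda>x. c) (\<lambda>x. c)"
proof -
  note W = W1_C1_fun[OF C1_fun_const(1)]
  have "(LINT x|lebesgue_on \<Omega>. norm (weak_gradient \<Omega> (\<lambda>x. 0) x) powr p) = (LINT x|lebesgue_on \<Omega>. 0)"
  proof (rule integral_cong_AE)
    show "(\<lambda>x. norm (weak_gradient \<Omega> (\<lambda>x. 0) x) powr p) \<in> borel_measurable (lebesgue_on \<Omega>)"
      using sobolev_W1_gradient_Lp[OF open_domain W(1)[of 0]]
      by (intro borel_measurable_integrable) (simp add: Lp_fun_def)
    show "AE x in lebesgue_on \<Omega>. norm (weak_gradient \<Omega> (\<lambda>x. 0) x) powr p = 0"
      using W(2)[of 0] by eventually_elim (simp add: C1_fun_const(2))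
  qed simp
  then have 0: "sobolev_norm \<Omega> p (\<lambda>x. c - c) = 0"
    by (simp add: sobolev_norm_def)
  show ?thesis
    unfolding has_trace_def
    using p 0 W(1) smooth_const
    by (intro conjI exI[of _ "\<lambda>n x. c"] allI Lp_fun_surface_continuous) auto
qed

lemma nn_integral_volume:
  assumes "f \<in> borel_measurable borel"
  shows "(\<integral>\<^sup>+x. f x \<partial>lebesgue_on \<Omega>) = (\<integral>\<^sup>+x\<in>\<Omega>. f x \<partial>lborel)"
proof -
  have "(\<integral>\<^sup>+x. f x \<partial>lebesgue_on \<Omega>) = (\<integral>\<^sup>+x\<in>\<Omega>. f x \<partial>lebesgue)"
    using open_domain by (intro nn_integral_restrict_space) auto
  also have "\<dots> = (\<integral>\<^sup>+x\<in>\<Omega>. f x \<partial>lborel)"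
    using open_domain by (intro nn_integral_completion)
  finally show ?thesis .
qed

lemma has_trace_L1_approx:
  assumes "has_trace \<Omega> p u g"
  obtains v where "\<And>n. C1_fun (v n)"
    "(\<lambda>n. \<integral>\<^sup>+x. ennreal \<bar>v n x - u x\<bar> \<partial>lebesgue_on \<Omega>) \<longlonglongrightarrow> 0"
    "(\<lambda>n. \<integral>\<^sup>+x. ennreal (norm (gradient (v n) x - weak_gradient \<Omega> u x)) \<partial>lebesgue_on \<Omega>) \<longlonglongrightarrow> 0"
    "(\<lambda>n. \<integral>\<^sup>+y. ennreal \<bar>v n y - g y\<bar> \<partial>surface_measure \<Omega>) \<longlonglongrightarrow> 0"
proof -
  obtain v where v: "\<And>n. smooth (v n)" "\<And>n. (\<lambda>x. v n x - u x) \<in> sobolev_W1 \<Omega> p"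
    "(\<lambda>n. sobolev_norm \<Omega> p (\<lambda>x. v n x - u x)) \<longlonglongrightarrow> 0"
    "Lp_null (surface_measure \<Omega>) p (\<lambda>n x. v n x - g x)"
    using has_traceE[OF assms] by blast
  have u: "u \<in> sobolev_W1 \<Omega> p" using assms by (simp add: has_trace_def)
  have C1: "C1_fun (v n)" for n using v(1) by (rule smooth_imp_C1_fun)
  have N: "Lp_null (lebesgue_on \<Omega>) p (\<lambda>n x. v n x - u x)"
    "Lp_null (lebesgue_on \<Omega>) p (\<lambda>n. weak_gradient \<Omega> (\<lambda>x. v n x - u x))"
    using sobolev_norm_tendsto_0_iff[of \<Omega> p "\<lambda>n x. v n x - u x"] open_domain p v(2,3) by auto
  have "(\<lambda>n. \<integral>\<^sup>+x. ennreal (norm (v n x - u x)) \<partial>lebesgue_on \<Omega>) \<longlonglongrightarrow> 0"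
    using N(1) p by (intro volume.Lp_tendsto_imp_L1_tendsto[of p]) (auto simp: Lp_null_def)
  then have 1: "(\<lambda>n. \<integral>\<^sup>+x. ennreal \<bar>v n x - u x\<bar> \<partial>lebesgue_on \<Omega>) \<longlonglongrightarrow> 0" by simp
  have "(\<lambda>n. \<integral>\<^sup>+x. ennreal (norm (weak_gradient \<Omega> (\<lambda>x. v n x - u x) x)) \<partial>lebesgue_on \<Omega>) \<longlonglongrightarrow> 0"
    using N(2) p by (intro volume.Lp_tendsto_imp_L1_tendsto[of p]) (auto simp: Lp_null_def)
  moreover have "(\<integral>\<^sup>+x. ennreal (norm (weak_gradient \<Omega> (\<lambda>x. v n x - u x) x)) \<partial>lebesgue_on \<Omega>) =
     (\<integral>\<^sup>+x. ennreal (norm (gradient (v n) x - weak_gradient \<Omega> u x)) \<partial>lebesgue_on \<Omega>)" for n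
  proof (rule nn_integral_cong_AE)
    show "AE x in lebesgue_on \<Omega>. ennreal (norm (weak_gradient \<Omega> (\<lambda>x. v n x - u x) x)) =
       ennreal (norm (gradient (v n) x - weak_gradient \<Omega> u x))"
      using W1_diff(2)[OF W1_C1_fun(1)[OF C1[of n]] u] W1_C1_fun(2)[OF C1[of n]]
      by eventually_elim simp
  qed
  ultimately have 2: "(\<lambda>n. \<integral>\<^sup>+x. ennreal (norm (gradient (v n) x - weak_gradient \<Omega> u x)) \<partial>lebesgue_on \<Omega>) \<longlonglongrightarrow> 0"
    by simp
  have "(\<lambda>n. \<integral>\<^sup>+x. ennreal (norm (v n x - g x)) \<partial>surface_measure \<Omega>) \<longlonglongrightarrow> 0"
    using v(4) p by (intro surface.Lp_tendsto_imp_L1_tendsto[of p]) (auto simp: Lp_null_def)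
  then show ?thesis using that[of v] C1 1 2 by simp
qed

lemma nn_integral_norm_triangle:
  fixes f g :: "'b \<Rightarrow> 'c::{second_countable_topology,real_normed_vector}"
  assumes [measurable]: "f \<in> borel_measurable M" "g \<in> borel_measurable M"
  shows "(\<integral>\<^sup>+x. ennreal (norm (f x)) \<partial>M) \<le> (\<integral>\<^sup>+x. ennreal (norm (f x - g x)) \<partial>M) + (\<integral>\<^sup>+x. ennreal (norm (g x)) \<partial>M)"
proof -
  have "(\<integral>\<^sup>+x. ennreal (norm (f x)) \<partial>M) \<le> (\<integral>\<^sup>+x. ennreal (norm (f x - g x)) + ennreal (norm (g x)) \<partial>M)"
  proof (intro nn_integral_mono)
    fix x
    show "ennreal (norm (f x)) \<le> ennreal (norm (f x - g x)) + ennreal (norm (g x))"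
      using norm_triangle_ineq[of "f x - g x" "g x"]
      by (subst ennreal_plus[symmetric]) (simp_all only: norm_ge_zero, intro ennreal_leI, simp)
  qed
  also have "\<dots> = (\<integral>\<^sup>+x. ennreal (norm (f x - g x)) \<partial>M) + (\<integral>\<^sup>+x. ennreal (norm (g x)) \<partial>M)"
    by (intro nn_integral_add) measurable
  finally show ?thesis .
qed

text \<open>
  By linearity it suffices that the zero function has only the trace 0; the approximating smooth
  functions then tend to 0 in \<open>W\<^sup>1\<^sup>,\<^sup>1\<close>, hence on the boundary by the trace inequality.
\<close>

lemma has_trace_unique:
  assumes "has_trace \<Omega> p u g" "has_trace \<Omega> p u h"
  shows "AE x in surface_measure \<Omega>. g x = h x"
proof -
  have gh: "g \<in> borel_measurable (surface_measure \<Omega>)" "h \<in> borel_measurable (surface_measure \<Omega>)"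
    using assms by (auto simp: has_trace_def Lp_fun_def)
  have T: "has_trace \<Omega> p (\<lambda>x. 0) (\<lambda>x. g x - h x)"
    using has_trace_linear_combination[OF assms, of 1 "-1"] by simp
  obtain v where v: "\<And>n. C1_fun (v n)"
    "(\<lambda>n. \<integral>\<^sup>+x. ennreal \<bar>v n x - 0\<bar> \<partial>lebesgue_on \<Omega>) \<longlonglongrightarrow> 0"
    "(\<lambda>n. \<integral>\<^sup>+x. ennreal (norm (gradient (v n) x - weak_gradient \<Omega> (\<lambda>x. 0) x)) \<partial>lebesgue_on \<Omega>) \<longlonglongrightarrow> 0"
    "(\<lambda>n. \<integral>\<^sup>+y. ennreal \<bar>v n y - (g y - h y)\<bar> \<partial>surface_measure \<Omega>) \<longlonglongrightarrow> 0"
    using has_trace_L1_approx[OF T] by blast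
  obtain C :: real where C: "0 \<le> C"
    "\<And>w. C1_fun w \<Longrightarrow> (\<integral>\<^sup>+y. ennreal \<bar>w y\<bar> \<partial>surface_measure \<Omega>) \<le> ennreal C * W11_norm \<Omega> w"
    using trace_inequality[OF open_domain bounded_domain lipschitz_domain] by blast
  note [measurable] = gh measurable_C1_fun[OF v(1)]
  have W0: "AE x in lebesgue_on \<Omega>. weak_gradient \<Omega> (\<lambda>x. 0) x = 0"
    using W1_C1_fun(2)[OF C1_fun_const(1)[of 0]] by (simp add: C1_fun_const(2))
  have grad: "(\<integral>\<^sup>+x. ennreal (norm (gradient (v n) x - weak_gradient \<Omega> (\<lambda>x. 0) x)) \<partial>lebesgue_on \<Omega>) =
     gradient_L1 \<Omega> (v n)" for n
  proof -
    have "(\<integral>\<^sup>+x. ennreal (norm (gradient (v n) x - weak_gradient \<Omega> (\<lambda>x. 0) x)) \<partial>lebesgue_on \<Omega>) =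
      (\<integral>\<^sup>+x. ennreal (norm (gradient (v n) x)) \<partial>lebesgue_on \<Omega>)"
      by (rule nn_integral_cong_AE) (use W0 in eventually_elim, simp)
    then show ?thesis by (simp add: nn_integral_volume)
  qed
  have "(\<lambda>n. \<integral>\<^sup>+x\<in>\<Omega>. ennreal \<bar>v n x\<bar> \<partial>lborel) \<longlonglongrightarrow> 0"
    using v(2) by (simp add: nn_integral_volume)
  moreover have "(\<lambda>n. gradient_L1 \<Omega> (v n)) \<longlonglongrightarrow> 0"
    using v(3) unfolding grad .
  ultimately have "(\<lambda>n. (\<integral>\<^sup>+y. ennreal \<bar>v n y - (g y - h y)\<bar> \<partial>surface_measure \<Omega>) + ennreal C * W11_norm \<Omega> (v n))
      \<longlonglongrightarrow> 0 + ennreal C * (0 + 0)"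
    unfolding W11_norm_def using v(4) by (intro tendsto_add ennreal_tendsto_cmult) auto
  then have lim: "(\<lambda>n. (\<integral>\<^sup>+y. ennreal \<bar>v n y - (g y - h y)\<bar> \<partial>surface_measure \<Omega>) + ennreal C * W11_norm \<Omega> (v n))
      \<longlonglongrightarrow> 0" by simp
  have "(\<integral>\<^sup>+y. ennreal \<bar>g y - h y\<bar> \<partial>surface_measure \<Omega>) \<le> 0"
  proof (rule LIMSEQ_le_const[OF lim], intro exI[of _ 0] allI impI)
    fix n :: nat
    have vm: "v n \<in> borel_measurable (surface_measure \<Omega>)" by (intro borel_measurable_surface) measurable
    have "(\<integral>\<^sup>+y. ennreal \<bar>g y - h y\<bar> \<partial>surface_measure \<Omega>) \<le>
      (\<integral>\<^sup>+y. ennreal \<bar>v n y - (g y - h y)\<bar> \<partial>surface_measure \<Omega>) + (\<integral>\<^sup>+y. ennreal \<bar>v n y\<bar> \<partial>surface_measure \<Omega>)"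
      using nn_integral_norm_triangle[of "\<lambda>y. g y - h y" "surface_measure \<Omega>" "v n"] vm gh
      by (simp add: abs_minus_commute)
    also have "\<dots> \<le> (\<integral>\<^sup>+y. ennreal \<bar>v n y - (g y - h y)\<bar> \<partial>surface_measure \<Omega>) + ennreal C * W11_norm \<Omega> (v n)"
      by (intro add_left_mono C v)
    finally show "(\<integral>\<^sup>+y. ennreal \<bar>g y - h y\<bar> \<partial>surface_measure \<Omega>) \<le>
      (\<integral>\<^sup>+y. ennreal \<bar>v n y - (g y - h y)\<bar> \<partial>surface_measure \<Omega>) + ennreal C * W11_norm \<Omega> (v n)" .
  qed
  then have "AE y in surface_measure \<Omega>. ennreal \<bar>g y - h y\<bar> = 0"
    by (subst (asm) le_zero_eq, subst (asm) nn_integral_0_iff_AE) auto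
  then show ?thesis by eventually_elim (simp add: ennreal_eq_0_iff)
qed

lemma sobolev_trace:
  assumes "has_trace \<Omega> p u g"
  shows "has_trace \<Omega> p u (sobolev_trace \<Omega> p u)"
    and "AE x in surface_measure \<Omega>. sobolev_trace \<Omega> p u x = g x"
proof -
  show *: "has_trace \<Omega> p u (sobolev_trace \<Omega> p u)"
    unfolding sobolev_trace_def using assms by (rule someI[of "has_trace \<Omega> p u"])
  show "AE x in surface_measure \<Omega>. sobolev_trace \<Omega> p u x = g x"
    using has_trace_unique[OF * assms] .
qed

lemma trace_in_LI:
  assumes "has_trace \<Omega> p u g" "Lp_fun (surface_measure \<Omega>) r g"
  shows "trace_in_L \<Omega> p r u"
  unfolding trace_in_L_def
proof
  note T = sobolev_trace[OF assms(1)]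
  show "has_trace \<Omega> p u (sobolev_trace \<Omega> p u)" by (rule T)
  show "Lp_fun (surface_measure \<Omega>) r (sobolev_trace \<Omega> p u)"
  proof (rule Lp_fun_AE_cong[OF assms(2)])
    show "sobolev_trace \<Omega> p u \<in> borel_measurable (surface_measure \<Omega>)"
      using T(1) by (simp add: has_trace_def Lp_fun_def)
    show "AE x in surface_measure \<Omega>. g x = sobolev_trace \<Omega> p u x"
      using T(2) by eventually_elim simp
  qed
qed

text \<open>
  On a connected domain, functions whose gradients tend to 0 have traces that approach constants:
  they are replaced by smooth functions with almost the same gradient and trace.
\<close>

lemma traces_approach_constants:
  assumes conn: "connected \<Omega>" and T: "\<And>n. has_trace \<Omega> p (w n) (g n)"
    and null: "Lp_null (lebesgue_on \<Omega>) p (\<lambda>n. weak_gradient \<Omega> (w n))"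
  obtains c where "(\<lambda>n. \<integral>\<^sup>+y. ennreal \<bar>g n y - c n\<bar> \<partial>surface_measure \<Omega>) \<longlonglongrightarrow> 0"
proof -
  let ?e = "\<lambda>n. ennreal (1 / real (Suc n))"
  have e0: "?e \<longlonglongrightarrow> 0"
    using tendsto_ennrealI[OF LIMSEQ_inverse_real_of_nat] by (simp add: inverse_eq_divide)
  have "\<forall>n. \<exists>v. C1_fun v \<and>
     (\<integral>\<^sup>+x. ennreal (norm (gradient v x - weak_gradient \<Omega> (w n) x)) \<partial>lebesgue_on \<Omega>) < ?e n \<and>
     (\<integral>\<^sup>+y. ennreal \<bar>v y - g n y\<bar> \<partial>surface_measure \<Omega>) < ?e n"
  proof
    fix n
    obtain v where v: "\<And>k. C1_fun (v k)"
      "(\<lambda>k. \<integral>\<^sup>+x. ennreal (norm (gradient (v k) x - weak_gradient \<Omega> (w n) x)) \<partial>lebesgue_on \<Omega>) \<longlonglongrightarrow> 0"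
      "(\<lambda>k. \<integral>\<^sup>+y. ennreal \<bar>v k y - g n y\<bar> \<partial>surface_measure \<Omega>) \<longlonglongrightarrow> 0"
      using has_trace_L1_approx[OF T[of n]] by blast
    have pos: "0 < ?e n" by simp
    have "eventually (\<lambda>k. (\<integral>\<^sup>+x. ennreal (norm (gradient (v k) x - weak_gradient \<Omega> (w n) x)) \<partial>lebesgue_on \<Omega>) < ?e n \<and>
       (\<integral>\<^sup>+y. ennreal \<bar>v k y - g n y\<bar> \<partial>surface_measure \<Omega>) < ?e n) sequentially"
      by (intro eventually_conj order_tendstoD(2)[OF v(2) pos] order_tendstoD(2)[OF v(3) pos])
    then obtain k where "(\<integral>\<^sup>+x. ennreal (norm (gradient (v k) x - weak_gradient \<Omega> (w n) x)) \<partial>lebesgue_on \<Omega>) < ?e n \<and>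
       (\<integral>\<^sup>+y. ennreal \<bar>v k y - g n y\<bar> \<partial>surface_measure \<Omega>) < ?e n"
      using eventually_happens'[OF sequentially_bot] by blast
    with v(1)[of k] show "\<exists>v. C1_fun v \<and>
     (\<integral>\<^sup>+x. ennreal (norm (gradient v x - weak_gradient \<Omega> (w n) x)) \<partial>lebesgue_on \<Omega>) < ?e n \<and>
     (\<integral>\<^sup>+y. ennreal \<bar>v y - g n y\<bar> \<partial>surface_measure \<Omega>) < ?e n" by blast
  qed
  then obtain v where C1: "\<And>n. C1_fun (v n)"
    and v1: "\<And>n. (\<integral>\<^sup>+x. ennreal (norm (gradient (v n) x - weak_gradient \<Omega> (w n) x)) \<partial>lebesgue_on \<Omega>) < ?e n"
    and v2: "\<And>n. (\<integral>\<^sup>+y. ennreal \<bar>v n y - g n y\<bar> \<partial>surface_measure \<Omega>) < ?e n"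
    by (subst (asm) choice_iff) auto
  note [measurable] = measurable_C1_fun[OF C1]
  have W: "w n \<in> sobolev_W1 \<Omega> p" for n using T by (simp add: has_trace_def)
  have Wm: "weak_gradient \<Omega> (w n) \<in> borel_measurable (lebesgue_on \<Omega>)" for n
    using sobolev_W1_gradient_Lp[OF open_domain W] by (simp add: Lp_fun_def)
  have wn: "(\<lambda>n. \<integral>\<^sup>+x. ennreal (norm (weak_gradient \<Omega> (w n) x)) \<partial>lebesgue_on \<Omega>) \<longlonglongrightarrow> 0"
    using null p by (intro volume.Lp_tendsto_imp_L1_tendsto[of p]) (auto simp: Lp_null_def)
  have "(\<lambda>n. gradient_L1 \<Omega> (v n)) \<longlonglongrightarrow> 0"
  proof (rule tendsto_sandwich[OF _ _ tendsto_const])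
    show "eventually (\<lambda>n. gradient_L1 \<Omega> (v n) \<le>
       ?e n + (\<integral>\<^sup>+x. ennreal (norm (weak_gradient \<Omega> (w n) x)) \<partial>lebesgue_on \<Omega>)) sequentially"
    proof (intro always_eventually allI)
      fix n
      have gm: "gradient (v n) \<in> borel_measurable (lebesgue_on \<Omega>)"
        by (intro measurable_restrict_space1 measurable_completion) simp
      have "gradient_L1 \<Omega> (v n) =
        (\<integral>\<^sup>+x. ennreal (norm (gradient (v n) x)) \<partial>lebesgue_on \<Omega>)" by (simp add: nn_integral_volume)
      also have "\<dots> \<le> (\<integral>\<^sup>+x. ennreal (norm (gradient (v n) x - weak_gradient \<Omega> (w n) x)) \<partial>lebesgue_on \<Omega>) +
         (\<integral>\<^sup>+x. ennreal (norm (weak_gradient \<Omega> (w n) x)) \<partial>lebesgue_on \<Omega>)"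
        by (rule nn_integral_norm_triangle[OF gm Wm])
      also have "\<dots> \<le> ?e n + (\<integral>\<^sup>+x. ennreal (norm (weak_gradient \<Omega> (w n) x)) \<partial>lebesgue_on \<Omega>)"
        by (intro add_right_mono less_imp_le v1)
      finally show "gradient_L1 \<Omega> (v n) \<le>
       ?e n + (\<integral>\<^sup>+x. ennreal (norm (weak_gradient \<Omega> (w n) x)) \<partial>lebesgue_on \<Omega>)" .
    qed
    show "(\<lambda>n. ?e n + (\<integral>\<^sup>+x. ennreal (norm (weak_gradient \<Omega> (w n) x)) \<partial>lebesgue_on \<Omega>)) \<longlonglongrightarrow> 0"
      using tendsto_add[OF e0 wn] by simp
  qed simp
  then interpret vanishing_gradients \<Omega> v
    using open_domain bounded_domain lipschitz_domain conn C1 by unfold_locales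
  obtain c where c: "(\<lambda>n. \<integral>\<^sup>+y. ennreal \<bar>v n y - c n\<bar> \<partial>surface_measure \<Omega>) \<longlonglongrightarrow> 0"
    using boundary_values_settle by blast
  have "(\<lambda>n. \<integral>\<^sup>+y. ennreal \<bar>g n y - c n\<bar> \<partial>surface_measure \<Omega>) \<longlonglongrightarrow> 0"
  proof (rule tendsto_sandwich[OF _ _ tendsto_const])
    show "eventually (\<lambda>n. (\<integral>\<^sup>+y. ennreal \<bar>g n y - c n\<bar> \<partial>surface_measure \<Omega>) \<le>
      ?e n + (\<integral>\<^sup>+y. ennreal \<bar>v n y - c n\<bar> \<partial>surface_measure \<Omega>)) sequentially"
    proof (intro always_eventually allI)
      fix n
      have vm: "v n \<in> borel_measurable (surface_measure \<Omega>)" by (intro borel_measurable_surface) simp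
      have gm: "g n \<in> borel_measurable (surface_measure \<Omega>)" using T[of n] by (simp add: has_trace_def Lp_fun_def)
      have "(\<integral>\<^sup>+y. ennreal \<bar>g n y - c n\<bar> \<partial>surface_measure \<Omega>) \<le>
        (\<integral>\<^sup>+y. ennreal \<bar>v n y - g n y\<bar> \<partial>surface_measure \<Omega>) + (\<integral>\<^sup>+y. ennreal \<bar>v n y - c n\<bar> \<partial>surface_measure \<Omega>)"
        using nn_integral_norm_triangle[of "\<lambda>y. g n y - c n" "surface_measure \<Omega>" "\<lambda>y. v n y - c n"] vm gm
        by (simp add: abs_minus_commute)
      also have "\<dots> \<le> ?e n + (\<integral>\<^sup>+y. ennreal \<bar>v n y - c n\<bar> \<partial>surface_measure \<Omega>)"
        by (intro add_right_mono less_imp_le v2)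
      finally show "(\<integral>\<^sup>+y. ennreal \<bar>g n y - c n\<bar> \<partial>surface_measure \<Omega>) \<le>
        ?e n + (\<integral>\<^sup>+y. ennreal \<bar>v n y - c n\<bar> \<partial>surface_measure \<Omega>)" .
    qed
    show "(\<lambda>n. ?e n + (\<integral>\<^sup>+y. ennreal \<bar>v n y - c n\<bar> \<partial>surface_measure \<Omega>)) \<longlonglongrightarrow> 0"
      using tendsto_add[OF e0 c] by simp
  qed simp
  then show ?thesis by (rule that)
qed

end


section \<open>Uniform convexity of the \<open>p\<close>-th power of the norm\<close>

text \<open>
  The mean value theorem on both halves of the interval and strict monotonicity of the derivative.
\<close>

lemma powr_midpoint_less:
  fixes s t p :: real
  assumes p: "1 < p" and st: "0 \<le> s" "s < t"
  shows "((s + t) / 2) powr p < (s powr p + t powr p) / 2"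
proof -
  define m where "m = (s + t) / 2"
  have m: "s < m" "m < t" "t - m = m - s" using st by (auto simp: m_def field_simps)
  have c: "continuous_on {a..b} (\<lambda>x. x powr p)" if "0 \<le> a" for a b :: real
    using that p by (intro continuous_on_powr' continuous_intros) auto
  have d: "((\<lambda>x. x powr p) has_real_derivative (p * x powr (p - 1))) (at x)" if "0 < x" for x :: real
    using that by (auto intro!: derivative_eq_intros simp: powr_diff)
  have mvt: "\<exists>x. a < x \<and> x < b \<and> b powr p - a powr p = (b - a) * (p * x powr (p - 1))" if ab: "0 \<le> a" "a < b" for a b :: real
  proof -
    have diff: "(\<lambda>x. x powr p) differentiable (at x)" if "a < x" "x < b" for x
      using d[of x] ab that by (auto simp: real_differentiable_def)
    obtain l x where x: "a < x" "x < b" "((\<lambda>x. x powr p) has_real_derivative l) (at x)" "b powr p - a powr p = (b - a) * l"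
      using MVT[OF ab(2) c[OF ab(1)] diff] by blast
    have "0 < x" using x(1) ab by linarith
    then have "l = p * x powr (p - 1)" by (rule DERIV_unique[OF x(3) d])
    then show ?thesis using x by blast
  qed
  obtain x where x: "s < x" "x < m" "m powr p - s powr p = (m - s) * (p * x powr (p - 1))"
    using mvt[of s m] st m by auto
  obtain y where y: "m < y" "y < t" "t powr p - m powr p = (t - m) * (p * y powr (p - 1))"
    using mvt[of m t] st m by auto
  have "x powr (p - 1) < y powr (p - 1)"
    using x y st p by (intro powr_less_mono2) auto
  then have "(m - s) * (p * x powr (p - 1)) < (m - s) * (p * y powr (p - 1))"
    using m p by (intro mult_strict_left_mono) auto
  then have "m powr p - s powr p < t powr p - m powr p" using x y m by simp
  then show ?thesis by (simp add: m_def)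
qed

definition midpoint_defect :: "real \<Rightarrow> 'a::real_inner \<Rightarrow> 'a \<Rightarrow> real" where
  "midpoint_defect p a b = (norm a powr p + norm b powr p) / 2 - norm ((1 / 2) *\<^sub>R a + (1 / 2) *\<^sub>R b) powr p"

lemma midpoint_defect_pos:
  fixes a b :: "'a::real_inner"
  assumes p: "1 < p" and ab: "a \<noteq> b"
  shows "0 < midpoint_defect p a b"
proof -
  let ?m = "(1 / 2) *\<^sub>R a + (1 / 2) *\<^sub>R b"
  have le: "norm ?m \<le> (norm a + norm b) / 2"
    by (rule order_trans[OF norm_triangle_ineq]) simp
  show ?thesis
  proof (cases "norm a = norm b")
    case True
    have "(norm ?m)\<^sup>2 = ((norm a)\<^sup>2 + (norm b)\<^sup>2) / 2 - (norm (a - b))\<^sup>2 / 4"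
      unfolding power2_norm_eq_inner
      by (simp add: inner_add_left inner_add_right inner_diff_left inner_diff_right inner_commute[of b a] field_simps)
    moreover have "0 < (norm (a - b))\<^sup>2" using ab by simp
    ultimately have "(norm ?m)\<^sup>2 < (norm a)\<^sup>2" using True by simp
    then have "norm ?m < norm a" by (rule power2_less_imp_less) simp
    then have "norm ?m powr p < norm a powr p" using p by (intro powr_less_mono2) auto
    then show ?thesis using True by (simp add: midpoint_defect_def)
  next
    case False
    have "norm ?m powr p \<le> ((norm a + norm b) / 2) powr p"
      using le p by (intro powr_mono2) auto
    also have "\<dots> < (norm a powr p + norm b powr p) / 2"
      using powr_midpoint_less[OF p norm_ge_zero, of a "norm b"] powr_midpoint_less[OF p norm_ge_zero, of b "norm a"] False
      by (cases "norm a < norm b") (auto simp: add.commute)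
    finally show ?thesis by (simp add: midpoint_defect_def)
  qed
qed

lemma midpoint_defect_nonneg:
  fixes a b :: "'a::real_inner"
  assumes "1 < p"
  shows "0 \<le> midpoint_defect p a b"
proof (cases "a = b")
  case True
  have "(1 / 2) *\<^sub>R b + (1 / 2) *\<^sub>R b = b" by (simp flip: scaleR_left.add)
  then show ?thesis using True by (simp add: midpoint_defect_def)
qed (use midpoint_defect_pos[OF assms] in \<open>auto intro: less_imp_le\<close>)

lemma midpoint_defect_scaleR:
  assumes "0 \<le> c"
  shows "midpoint_defect p (c *\<^sub>R a) (c *\<^sub>R b) = c powr p * midpoint_defect p a b"
proof -
  have eq: "(1 / 2) *\<^sub>R c *\<^sub>R a + (1 / 2) *\<^sub>R c *\<^sub>R b = c *\<^sub>R ((1 / 2) *\<^sub>R a + (1 / 2) *\<^sub>R b)"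
    by (simp add: scaleR_add_right mult.commute)
  show ?thesis
    unfolding midpoint_defect_def eq norm_scaleR
    using assms by (simp only: powr_mult abs_ge_zero norm_ge_zero abs_of_nonneg) (simp add: field_simps)
qed

text \<open>
  By homogeneity it suffices to bound the midpoint defect from below on the compact set of
  normalised pairs at distance at least a given number, where it is positive and continuous.
\<close>

lemma norm_diff_powr_le_midpoint_defect:
  fixes p \<delta> :: real
  assumes p: "1 < p" and \<delta>: "0 < \<delta>"
  obtains K where "0 \<le> K"
    "\<And>a b :: 'a::euclidean_space.
       norm (a - b) powr p \<le> \<delta> * (norm a powr p + norm b powr p) + K * midpoint_defect p a b"
proof -
  let ?N = "\<lambda>z :: 'a \<times> 'a. norm (fst z) powr p + norm (snd z) powr p"
  let ?D = "\<lambda>z :: 'a \<times> 'a. midpoint_defect p (fst z) (snd z)"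
  let ?d = "\<lambda>z :: 'a \<times> 'a. norm (fst z - snd z) powr p"
  define \<Sigma> where "\<Sigma> = {z. ?N z = 1 \<and> \<delta> \<le> ?d z}"
  have cN: "continuous_on UNIV ?N" and cd: "continuous_on UNIV ?d" and cD: "continuous_on UNIV ?D"
    unfolding midpoint_defect_def using p
    by (intro continuous_intros continuous_on_powr'; auto)+
  have "closed \<Sigma>"
    unfolding \<Sigma>_def using cN cd
    by (intro closed_Collect_conj closed_Collect_eq closed_Collect_le continuous_on_const)
  moreover have "bounded \<Sigma>"
  proof -
    have "norm z \<le> 2" if "?N z = 1" for z :: "'a \<times> 'a"
    proof -
      have 1: "x \<le> 1" if "x powr p \<le> 1" "0 \<le> x" for x :: real
        proof (rule ccontr)
          assume "\<not> x \<le> 1"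
          then have "1 powr p < x powr p" using p by (intro powr_less_mono2) auto
          with that(1) show False by simp
        qed
      have "norm (fst z) \<le> 1" "norm (snd z) \<le> 1"
      proof -
        have "0 \<le> norm (fst z) powr p" "0 \<le> norm (snd z) powr p" by (rule powr_ge_zero)+
        then have le: "norm (fst z) powr p \<le> 1" "norm (snd z) powr p \<le> 1" using that by linarith+
        show "norm (fst z) \<le> 1" "norm (snd z) \<le> 1"
          by (rule 1[OF le(1) norm_ge_zero], rule 1[OF le(2) norm_ge_zero])
      qed
      then show ?thesis using norm_Pair_le[of "fst z" "snd z"] by simp
    qed
    then show ?thesis unfolding \<Sigma>_def by (intro boundedI[of _ 2]) auto
  qed
  ultimately have compact: "compact \<Sigma>" by (simp add: compact_eq_bounded_closed)
  obtain \<kappa> where \<kappa>: "0 < \<kappa>" "\<And>z. z \<in> \<Sigma> \<Longrightarrow> \<kappa> \<le> ?D z"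
  proof (cases "\<Sigma> = {}")
    case True
    then show ?thesis using that[of 1] by auto
  next
    case False
    obtain z0 where z0: "z0 \<in> \<Sigma>" "\<And>z. z \<in> \<Sigma> \<Longrightarrow> ?D z0 \<le> ?D z"
      using continuous_attains_inf[OF compact False continuous_on_subset[OF cD]] by auto
    have "fst z0 \<noteq> snd z0" using z0(1) \<delta> p by (auto simp: \<Sigma>_def)
    then show ?thesis using that[of "?D z0"] z0 midpoint_defect_pos[OF p] by auto
  qed
  \<comment> \<open>On the compact set the left-hand side is at most \<open>2\<^sup>p\<close> and the defect at least \<open>\<kappa>\<close>.\<close>
  define K where "K = 2 powr p / \<kappa>"
  have K: "0 \<le> K" using \<kappa> by (simp add: K_def)
  show ?thesis
  proof (rule that[OF K])
    fix a b :: 'a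
    define s where "s = norm a powr p + norm b powr p"
    have s0: "0 \<le> s" by (simp add: s_def)
    have KD: "0 \<le> K * midpoint_defect p a b" by (intro mult_nonneg_nonneg K midpoint_defect_nonneg p)
    show "norm (a - b) powr p \<le> \<delta> * (norm a powr p + norm b powr p) + K * midpoint_defect p a b"
    proof (cases "s = 0")
      case True
      then have "norm a powr p = 0" "norm b powr p = 0"
        using powr_ge_zero[of "norm a" p] powr_ge_zero[of "norm b" p] unfolding s_def by linarith+
      then show ?thesis using KD by simp
    next
      case False
      \<comment> \<open>Scaling by \<open>c\<close> normalises the pair.\<close>
      define c where "c = s powr (- 1 / p)"
      have c: "0 < c" "c powr p = 1 / s"
      proof -
        show "0 < c" using False s0 by (simp add: c_def)
        have "c powr p = s powr ((- 1 / p) * p)" unfolding c_def by (rule powr_powr)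
        also have "(- 1 / p) * p = - 1" using p by simp
        finally show "c powr p = 1 / s" using False s0 by (simp add: powr_minus_divide)
      qed
      let ?z = "(c *\<^sub>R a, c *\<^sub>R b)"
      have N: "?N ?z = 1"
      proof -
        have "?N ?z = c powr p * s" using c by (simp add: powr_mult s_def distrib_left)
        then show ?thesis using c False by simp
      qed
      have d: "?d ?z = norm (a - b) powr p / s"
        using c by (simp add: powr_mult flip: scaleR_diff_right)
      have D: "?D ?z = midpoint_defect p a b / s"
        using c by (simp add: midpoint_defect_scaleR)
      show ?thesis
      proof (cases "?z \<in> \<Sigma>")
        case True
        then have "\<kappa> * s \<le> midpoint_defect p a b"
          using \<kappa>(2)[OF True] D s0 False by (simp add: pos_le_divide_eq)
        then have "K * (\<kappa> * s) \<le> K * midpoint_defect p a b" using K by (rule mult_left_mono)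
        moreover have "K * (\<kappa> * s) = 2 powr p * s" using \<kappa> by (simp add: K_def)
        moreover have "norm (a - b) powr p \<le> 2 powr p * s"
          using norm_add_powr_le[of p a "- b"] p by (simp add: s_def)
        moreover have "0 \<le> \<delta> * s" using \<delta> s0 by simp
        ultimately show ?thesis unfolding s_def[symmetric] by linarith
      next
        case False
        then have "?d ?z < \<delta>" using N by (auto simp: \<Sigma>_def)
        then have "norm (a - b) powr p < \<delta> * s"
          using d s0 \<open>s \<noteq> 0\<close> by (simp add: pos_divide_less_eq)
        then show ?thesis using KD unfolding s_def[symmetric] by linarith
      qed
    qed
  qed
qed

text \<open>
  The pointwise estimate is integrated. The term with the small factor \<open>\<delta>\<close> contains the norms of \<open>a n\<close>,
  which are bounded in terms of \<open>a n - b\<close> and \<open>b\<close> and then absorbed into the left-hand side.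
\<close>

lemma Lp_null_if_midpoint_defect_null:
  fixes a :: "nat \<Rightarrow> 'b \<Rightarrow> 'a::euclidean_space"
  assumes p: "1 < p" and a: "\<And>n. Lp_fun M p (a n)" and b: "Lp_fun M p b"
    and lim: "(\<lambda>n. LINT x|M. midpoint_defect p (a n x) (b x)) \<longlonglongrightarrow> 0"
  shows "Lp_null M p (\<lambda>n x. a n x - b x)"
proof -
  have L: "Lp_fun M p (\<lambda>x. a n x - b x)" for n
    using p by (intro Lp_fun_diff a b) auto
  have ia: "integrable M (\<lambda>x. norm (a n x) powr p)" and ib: "integrable M (\<lambda>x. norm (b x) powr p)"
    and id: "integrable M (\<lambda>x. norm (a n x - b x) powr p)" for n
    using a b L by (auto simp: Lp_fun_def)
  have iD: "integrable M (\<lambda>x. midpoint_defect p (a n x) (b x))" for n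
  proof -
    have "Lp_fun M p (\<lambda>x. (1 / 2) *\<^sub>R a n x + (1 / 2) *\<^sub>R b x)"
      using p by (intro Lp_fun_linear_combination a b) auto
    then have "integrable M (\<lambda>x. norm ((1 / 2) *\<^sub>R a n x + (1 / 2) *\<^sub>R b x) powr p)" by (simp add: Lp_fun_def)
    then show ?thesis unfolding midpoint_defect_def using ia ib
      by (intro Bochner_Integration.integrable_diff integrable_divide_zero Bochner_Integration.integrable_add) auto
  qed
  define X where "X n = (LINT x|M. norm (a n x - b x) powr p)" for n
  define B where "B = (LINT x|M. norm (b x) powr p)"
  define d where "d n = (LINT x|M. midpoint_defect p (a n x) (b x))" for n
  have B: "0 \<le> B" unfolding B_def by (intro integral_nonneg_AE) auto
  have A: "(LINT x|M. norm (a n x) powr p) \<le> 2 powr p * (X n + B)" for n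
  proof -
    have "(LINT x|M. norm (a n x) powr p) \<le> (LINT x|M. 2 powr p * (norm (a n x - b x) powr p + norm (b x) powr p))"
    proof (rule integral_mono)
      show "norm (a n x) powr p \<le> 2 powr p * (norm (a n x - b x) powr p + norm (b x) powr p)" for x
        using norm_add_powr_le[of p "a n x - b x" "b x"] p by simp
    qed (use ia ib id in auto)
    then show ?thesis using id ib by (simp add: X_def B_def)
  qed
  have "X \<longlonglongrightarrow> 0"
  proof (rule LIMSEQ_I)
    fix \<epsilon> :: real assume \<epsilon>: "0 < \<epsilon>"
    \<comment> \<open>The first bound allows absorbing half of \<open>X n\<close>; the second makes the remaining constant at most \<open>\<epsilon>/4\<close>.\<close>
    define \<delta> where "\<delta> = min (1 / (2 * 2 powr p)) (\<epsilon> / (4 * ((2 powr p + 1) * (B + 1))))"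
    have P: "0 < (2 powr p + 1) * (B + 1)" using B by (intro mult_pos_pos) (auto simp: add_nonneg_pos)
    have \<delta>: "0 < \<delta>" "\<delta> * 2 powr p \<le> 1 / 2" "\<delta> * ((2 powr p + 1) * B) \<le> \<epsilon> / 4"
    proof -
      show "0 < \<delta>" using \<epsilon> P by (simp add: \<delta>_def)
      have "\<delta> * 2 powr p \<le> 1 / (2 * 2 powr p) * 2 powr p" by (intro mult_right_mono) (auto simp: \<delta>_def)
      then show "\<delta> * 2 powr p \<le> 1 / 2" by simp
      have "\<delta> * ((2 powr p + 1) * B) \<le> \<delta> * ((2 powr p + 1) * (B + 1))"
        using \<open>0 < \<delta>\<close> by (intro mult_left_mono) auto
      also have "\<dots> \<le> \<epsilon> / (4 * ((2 powr p + 1) * (B + 1))) * ((2 powr p + 1) * (B + 1))"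
        using P by (intro mult_right_mono) (auto simp: \<delta>_def)
      also have "\<dots> = \<epsilon> / 4" using P by (metis less_irrefl nonzero_divide_mult_cancel_right times_divide_eq_left divide_divide_eq_left' nonzero_mult_div_cancel_right times_divide_eq_right)
      finally show "\<delta> * ((2 powr p + 1) * B) \<le> \<epsilon> / 4" .
    qed
    obtain K where K: "0 \<le> K" "\<And>a b :: 'a.
       norm (a - b) powr p \<le> \<delta> * (norm a powr p + norm b powr p) + K * midpoint_defect p a b"
      using norm_diff_powr_le_midpoint_defect[OF p \<delta>(1)] by blast
    have X0: "0 \<le> X n" for n unfolding X_def by (intro integral_nonneg_AE) auto
    have X: "X n \<le> \<epsilon> / 2 + 2 * K * d n" for n
    proof -
      have "X n \<le> (LINT x|M. \<delta> * (norm (a n x) powr p + norm (b x) powr p) + K * midpoint_defect p (a n x) (b x))"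
        unfolding X_def using K(2) ia ib id iD by (intro integral_mono) auto
      also have "\<dots> = \<delta> * ((LINT x|M. norm (a n x) powr p) + B) + K * d n"
        using ia ib iD by (simp add: B_def d_def)
      also have "\<dots> \<le> \<delta> * (2 powr p * (X n + B) + B) + K * d n"
        using A[of n] \<delta>(1) by (intro add_right_mono mult_left_mono) auto
      also have "\<dots> = \<delta> * 2 powr p * X n + \<delta> * ((2 powr p + 1) * B) + K * d n"
        by (simp add: algebra_simps)
      also have "\<dots> \<le> 1 / 2 * X n + \<epsilon> / 4 + K * d n"
        using mult_right_mono[OF \<delta>(2) X0[of n]] \<delta>(3) by linarith
      finally show ?thesis by simp
    qed
    have "(\<lambda>n. 2 * K * d n) \<longlonglongrightarrow> 2 * K * 0" using lim unfolding d_def by (intro tendsto_mult tendsto_const)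
    then have "eventually (\<lambda>n. 2 * K * d n < \<epsilon> / 2) sequentially"
      using \<epsilon> by (intro order_tendstoD(2)) auto
    then obtain N where N: "\<And>n. n \<ge> N \<Longrightarrow> 2 * K * d n < \<epsilon> / 2" by (auto simp: eventually_sequentially)
    have "norm (X n - 0) < \<epsilon>" if "n \<ge> N" for n
    proof -
      have "0 \<le> X n" unfolding X_def by (intro integral_nonneg_AE) auto
      then show ?thesis using X[of n] N[OF that] by simp
    qed
    then show "\<exists>N. \<forall>n\<ge>N. norm (X n - 0) < \<epsilon>" by blast
  qed
  then show ?thesis using L unfolding Lp_null_def X_def by simp
qed


section \<open>Shifting a function to satisfy the constraint\<close>

text \<open>
  The derivative of \<open>|t|\<^sup>q / q\<close>.
\<close>

abbreviation odd_power :: "real \<Rightarrow> real \<Rightarrow> real" where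
  "odd_power q t \<equiv> \<bar>t\<bar> powr (q - 2) * t"

lemma odd_power_eq:
  fixes t q :: real
  assumes "1 < q"
  shows "odd_power q t = max t 0 powr (q - 1) - max (- t) 0 powr (q - 1)"
proof -
  have *: "s powr (q - 2) * s = s powr (q - 1)" if "0 < s" for s :: real
    using that powr_mult_base[of s "q - 2"] by (simp add: mult.commute)
  show ?thesis
    using *[of t] *[of "- t"] by (cases t "0::real" rule: linorder_cases) (auto simp: max_def)
qed

lemma abs_odd_power:
  fixes t q :: real
  assumes "1 < q"
  shows "\<bar>odd_power q t\<bar> = \<bar>t\<bar> powr (q - 1)"
  unfolding odd_power_eq[OF assms] by (auto simp: max_def)

lemma continuous_odd_power:
  fixes q :: real
  assumes "1 < q"
  shows "continuous_on UNIV (\<lambda>t::real. odd_power q t)"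
  unfolding odd_power_eq[OF assms] using assms
  by (intro continuous_intros continuous_on_powr') auto

text \<open>Convexity of \<open>t \<mapsto> |t|\<^sup>q\<close> in the form of Young's inequality.\<close>

lemma abs_powr_convex:
  fixes s t q :: real
  assumes q: "1 < q"
  shows "\<bar>s\<bar> powr q + q * (odd_power q s) * (t - s) \<le> \<bar>t\<bar> powr q"
proof -
  define q' where "q' = q / (q - 1)"
  have q': "1 < q'" "1 / q' + 1 / q = 1" "(q - 1) * q' = q"
    using q by (auto simp: q'_def field_simps)
  have "(odd_power q s) * t \<le> \<bar>odd_power q s\<bar> * \<bar>t\<bar>"
    by (simp flip: abs_mult)
  also have "\<dots> = \<bar>s\<bar> powr (q - 1) * \<bar>t\<bar>" by (simp add: abs_odd_power[OF q])
  also have "\<dots> \<le> (\<bar>s\<bar> powr (q - 1)) powr q' / q' + \<bar>t\<bar> powr q / q"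
    using q q' by (intro Youngs_inequality) auto
  also have "(\<bar>s\<bar> powr (q - 1)) powr q' = \<bar>s\<bar> powr q" by (simp add: powr_powr q')
  finally have 1: "q * ((odd_power q s) * t) \<le> q * (\<bar>s\<bar> powr q / q' + \<bar>t\<bar> powr q / q)"
    using q by (intro mult_left_mono) auto
  have 2: "q * (\<bar>s\<bar> powr q / q' + \<bar>t\<bar> powr q / q) = (q - 1) * \<bar>s\<bar> powr q + \<bar>t\<bar> powr q"
    using q by (simp add: q'_def field_simps)
  have "(odd_power q s) * s = \<bar>s\<bar> powr q"
  proof (cases "s = 0")
    case False
    have "(odd_power q s) * s = \<bar>s\<bar> * (\<bar>s\<bar> * \<bar>s\<bar> powr (q - 2))"
      by (simp add: abs_mult_self_eq flip: mult.assoc)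
    also have "\<dots> = \<bar>s\<bar> powr q" by (simp add: powr_mult_base)
    finally show ?thesis .
  qed simp
  then have "\<bar>s\<bar> powr q + q * (odd_power q s) * (t - s)
      = \<bar>s\<bar> powr q + q * ((odd_power q s) * t) - q * \<bar>s\<bar> powr q"
    by (simp add: right_diff_distrib mult.assoc)
  also have "\<dots> \<le> \<bar>t\<bar> powr q" using 1 2 by (simp add: left_diff_distrib)
  finally show ?thesis .
qed

context finite_measure
begin

lemma integrable_odd_power:
  assumes "Lp_fun M (q - 1) g" "1 < (q::real)"
  shows "integrable M (\<lambda>x. odd_power q (g x))"
proof (rule Bochner_Integration.integrable_bound)
  show "integrable M (\<lambda>x. \<bar>g x\<bar> powr (q - 1))" using assms by (simp add: Lp_fun_def)
  show "(\<lambda>x. odd_power q (g x)) \<in> borel_measurable M"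
    using measurable_compose[OF _ borel_measurable_continuous_onI[OF continuous_odd_power[OF assms(2)]]] assms(1)
    by (auto simp: Lp_fun_def)
  show "AE x in M. norm (odd_power q (g x)) \<le> norm (\<bar>g x\<bar> powr (q - 1))"
    using abs_odd_power[OF assms(2)] by simp
qed

lemma Lp_fun_shift:
  assumes "Lp_fun M r g" "0 \<le> r"
  shows "Lp_fun M r (\<lambda>x. g x - (c::real))"
  by (intro Lp_fun_diff assms Lp_fun_bounded[of "\<lambda>x. c" "norm c"]) auto

text \<open>
  Two parameters are needed: continuity in \<open>c\<close> at \<open>a = 1\<close> serves the intermediate value theorem, and
  the limit \<open>a \<longlonglongrightarrow> 0\<close> determines the sign for large shifts.
\<close>

lemma odd_power_integral_tendsto:
  fixes q :: real
  assumes g: "Lp_fun M (q - 1) g" and q: "1 < q" and a: "a \<longlonglongrightarrow> a'" and c: "c \<longlonglongrightarrow> c'"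
  shows "(\<lambda>n. LINT x|M. odd_power q (a n * g x - c n)) \<longlonglongrightarrow>
     (LINT x|M. odd_power q (a' * g x - c'))"
proof -
  obtain R where R: "\<And>n. \<bar>a n\<bar> \<le> R" "\<And>n. \<bar>c n\<bar> \<le> R"
  proof -
    obtain R1 R2 where "\<And>n. \<bar>a n\<bar> \<le> R1" "\<And>n. \<bar>c n\<bar> \<le> R2"
      using convergent_imp_bounded[OF a] convergent_imp_bounded[OF c] by (auto simp: bounded_iff)
    then show ?thesis using that[of "max R1 R2"] by (meson le_max_iff_disj)
  qed
  have R0: "0 \<le> R" using R(1)[of 0] by linarith
  have L: "Lp_fun M (q - 1) (\<lambda>x. a * g x - c)" for a c
    using Lp_fun_shift[OF Lp_fun_scaleR[OF g, of a], of c] q by simp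
  show ?thesis
  proof (rule integral_dominated_convergence[where w = "\<lambda>x. 2 powr (q - 1) * (R powr (q - 1) * \<bar>g x\<bar> powr (q - 1) + R powr (q - 1))"])
    show "integrable M (\<lambda>x. 2 powr (q - 1) * (R powr (q - 1) * \<bar>g x\<bar> powr (q - 1) + R powr (q - 1)))"
      using g by (intro integrable_mult_right Bochner_Integration.integrable_add integrable_const) (auto simp: Lp_fun_def)
    show "(\<lambda>x. odd_power q (a' * g x - c')) \<in> borel_measurable M"
      "(\<lambda>x. odd_power q (a n * g x - c n)) \<in> borel_measurable M" for n
      using integrable_odd_power[OF L q] by (auto intro: borel_measurable_integrable)
    show "AE x in M. (\<lambda>n. odd_power q (a n * g x - c n)) \<longlonglongrightarrow>
       odd_power q (a' * g x - c')"
      by (intro AE_I2 continuous_on_tendsto_compose[OF continuous_odd_power[OF q]] tendsto_intros a c) auto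
    show "AE x in M. norm (odd_power q (a n * g x - c n)) \<le>
       2 powr (q - 1) * (R powr (q - 1) * \<bar>g x\<bar> powr (q - 1) + R powr (q - 1))" for n
    proof (rule AE_I2)
      fix x
      have "norm (odd_power q (a n * g x - c n)) = norm (a n * g x + - c n) powr (q - 1)"
        using abs_odd_power[OF q] by simp
      also have "\<dots> \<le> 2 powr (q - 1) * (norm (a n * g x) powr (q - 1) + norm (- c n) powr (q - 1))"
        using q by (intro norm_add_powr_le) auto
      also have "\<dots> \<le> 2 powr (q - 1) * (R powr (q - 1) * \<bar>g x\<bar> powr (q - 1) + R powr (q - 1))"
        using R[of n] R0 q
        by (intro mult_left_mono add_mono) (auto simp: abs_mult powr_mult intro!: mult_right_mono powr_mono2)
      finally show "norm (odd_power q (a n * g x - c n)) \<le>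
       2 powr (q - 1) * (R powr (q - 1) * \<bar>g x\<bar> powr (q - 1) + R powr (q - 1))" .
    qed
  qed
qed

text \<open>
  By homogeneity, dividing the integral with \<open>c = R\<close> by \<open>R\<^sup>q\<^sup>-\<^sup>1\<close> yields the integral with \<open>g/R\<close> in place of
  \<open>g\<close> and 1 in place of \<open>c\<close>, which for \<open>R \<longlonglongrightarrow> \<infinity>\<close> tends to minus the total mass.
\<close>

lemma odd_power_integral_nonpos:
  fixes q :: real
  assumes g: "Lp_fun M (q - 1) g" and q: "1 < q"
  shows "\<exists>c\<ge>0. (LINT x|M. odd_power q (g x - c)) \<le> 0"
proof (cases "measure M (space M) = 0")
  case True
  then have "emeasure M (space M) = 0" by (simp add: emeasure_eq_measure)
  then have "space M \<in> null_sets M" by auto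
  then have "AE x in M. odd_power q (g x - 0) = 0"
    by (rule AE_I') auto
  then have "(LINT x|M. odd_power q (g x - 0)) = 0" by (rule integral_eq_zero_AE)
  then show ?thesis by (intro exI[of _ 0]) auto
next
  case False
  have "(\<lambda>n. LINT x|M. odd_power q (inverse (real (Suc n)) * g x - 1)) \<longlonglongrightarrow>
     (LINT x|M. odd_power q (0 * g x - 1))"
    by (intro odd_power_integral_tendsto g q LIMSEQ_inverse_real_of_nat tendsto_const)
  then have "(\<lambda>n. LINT x|M. odd_power q (inverse (real (Suc n)) * g x - 1))
     \<longlonglongrightarrow> - measure M (space M)" by simp
  moreover have "- measure M (space M) < 0" using False by (simp add: less_le)
  ultimately have "eventually (\<lambda>n. (LINT x|M. odd_power q (inverse (real (Suc n)) * g x - 1)) < 0) sequentially"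
    by (rule order_tendstoD(2))
  then obtain n where n: "(LINT x|M. odd_power q (inverse (real (Suc n)) * g x - 1)) < 0"
    using eventually_happens'[OF sequentially_bot] by blast
  define R where "R = real (Suc n)"
  have R: "0 < R" by (simp add: R_def)
  have eq: "odd_power q (g x - R) =
     R powr (q - 1) * (odd_power q (inverse R * g x - 1))" for x
  proof -
    have 1: "g x - R = R * (inverse R * g x - 1)" using R by (simp add: field_simps)
    have "odd_power q (R * y) = R powr (q - 1) * (odd_power q y)" for y
    proof -
      have "R powr (q - 1) = R * R powr (q - 2)" using R powr_mult_base[of R "q - 2"] by simp
      then show ?thesis using R by (simp add: abs_mult powr_mult)
    qed
    then show ?thesis by (metis 1)
  qed
  have "(LINT x|M. odd_power q (g x - R)) \<le> 0"
    unfolding eq integral_mult_right_zero using n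
    by (intro mult_nonneg_nonpos) (simp_all add: R_def[symmetric] del: of_nat_Suc)
  then show ?thesis using R by (intro exI[of _ R]) auto
qed

text \<open>
  The integral is continuous in \<open>c\<close> and nonpositive for some \<open>c\<close>; replacing \<open>g\<close> by \<open>- g\<close> shows that it is
  nonnegative for some other \<open>c\<close>.
\<close>

lemma ex_shift_odd_power_integral_zero:
  fixes q :: real
  assumes g: "Lp_fun M (q - 1) g" and q: "1 < q"
  shows "\<exists>c. (LINT x|M. odd_power q (g x - c)) = 0"
proof -
  define \<Psi> where "\<Psi> c = (LINT x|M. odd_power q (g x - c))" for c
  obtain c1 where c1: "0 \<le> c1" "\<Psi> c1 \<le> 0" using odd_power_integral_nonpos[OF g q] by (auto simp: \<Psi>_def)
  have g': "Lp_fun M (q - 1) (\<lambda>x. - g x)" using Lp_fun_scaleR[OF g, of "-1"] by simp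
  obtain c2 where c2: "0 \<le> c2" "(LINT x|M. odd_power q (- g x - c2)) \<le> 0"
    using odd_power_integral_nonpos[OF g' q] by auto
  have "(LINT x|M. odd_power q (- g x - c2)) = - \<Psi> (- c2)"
  proof -
    have "odd_power q (- g x - c2) = - (odd_power q (g x - - c2))" for x
    proof -
      have "- g x - c2 = - (g x - - c2)" by simp
      then show ?thesis by (metis abs_minus mult_minus_right)
    qed
    then show ?thesis by (simp add: \<Psi>_def)
  qed
  then have c2': "0 \<le> \<Psi> (- c2)" using c2(2) by linarith
  have "continuous_on {- c2..c1} \<Psi>"
  proof (rule continuous_on_subset[of UNIV])
    show "continuous_on UNIV \<Psi>"
      unfolding continuous_on_sequentially comp_def
    proof (intro allI ballI impI, elim conjE)
      fix c :: real and u assume "u \<longlonglongrightarrow> c"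
      then show "(\<lambda>n. \<Psi> (u n)) \<longlonglongrightarrow> \<Psi> c"
        using odd_power_integral_tendsto[OF g q tendsto_const[of 1], of u c] by (simp add: \<Psi>_def)
    qed
  qed simp
  then have "\<exists>x. - c2 \<le> x \<and> x \<le> c1 \<and> \<Psi> x = 0"
    using c1 c2' c2(1) by (intro IVT2') auto
  then show ?thesis by (auto simp: \<Psi>_def)
qed

end


section \<open>The expansion of the energy\<close>

context lipschitz_domain
begin

lemma sobolev_dual_linear_combination:
  assumes f: "f \<in> sobolev_dual \<Omega> p" and u: "u \<in> sobolev_W1 \<Omega> p" and v: "v \<in> sobolev_W1 \<Omega> p"
  shows "f (\<lambda>x. a * u x + b * v x) = a * f u + b * f v"
proof -
  have "(\<lambda>x. a * u x) \<in> sobolev_W1 \<Omega> p" "(\<lambda>x. b * v x) \<in> sobolev_W1 \<Omega> p"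
    using W1_combine(1)[OF u u, of a 0] W1_combine(1)[OF v v, of b 0] by simp_all
  then show ?thesis using f u v by (simp add: sobolev_dual_def)
qed

lemma gradient_integral_AE_cong:
  assumes w: "w \<in> sobolev_W1 \<Omega> p" and ae: "AE x in lebesgue_on \<Omega>. weak_gradient \<Omega> w x = G x"
    and G: "Lp_fun (lebesgue_on \<Omega>) p G"
  shows "(LINT x|lebesgue_on \<Omega>. norm (weak_gradient \<Omega> w x) powr p) = (LINT x|lebesgue_on \<Omega>. norm (G x) powr p)"
proof (rule integral_cong_AE)
  show "(\<lambda>x. norm (weak_gradient \<Omega> w x) powr p) \<in> borel_measurable (lebesgue_on \<Omega>)"
    "(\<lambda>x. norm (G x) powr p) \<in> borel_measurable (lebesgue_on \<Omega>)"
    using sobolev_W1_gradient_Lp[OF open_domain w] G by (auto simp: Lp_fun_def intro: borel_measurable_integrable)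
  show "AE x in lebesgue_on \<Omega>. norm (weak_gradient \<Omega> w x) powr p = norm (G x) powr p"
    using ae by eventually_elim simp
qed

lemma neumann_energy_shift:
  assumes f: "f \<in> sobolev_dual \<Omega> p" "f (\<lambda>x. 1) = 0" and u: "u \<in> sobolev_W1 \<Omega> p"
  shows "neumann_energy \<Omega> p f (\<lambda>x. u x - c) = neumann_energy \<Omega> p f u"
proof -
  note one = W1_C1_fun[OF C1_fun_const(1)[of 1]]
  have e: "(\<lambda>x. 1 * u x + (- c) * 1) = (\<lambda>x. u x - c)" by auto
  have "f (\<lambda>x. u x - c) = f u"
    using sobolev_dual_linear_combination[OF f(1) u one(1), of 1 "- c"] f(2) unfolding e by simp
  moreover have "(LINT x|lebesgue_on \<Omega>. norm (weak_gradient \<Omega> (\<lambda>x. u x - c) x) powr p) =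
      (LINT x|lebesgue_on \<Omega>. norm (weak_gradient \<Omega> u x) powr p)"
  proof (rule gradient_integral_AE_cong)
    show "(\<lambda>x. u x - c) \<in> sobolev_W1 \<Omega> p"
      using W1_combine(1)[OF u one(1), of 1 "- c"] unfolding e .
    show "AE x in lebesgue_on \<Omega>. weak_gradient \<Omega> (\<lambda>x. u x - c) x = weak_gradient \<Omega> u x"
      using W1_combine(2)[OF u one(1), of 1 "- c"] one(2) unfolding e
      by eventually_elim (simp add: C1_fun_const(2))
    show "Lp_fun (lebesgue_on \<Omega>) p (weak_gradient \<Omega> u)"
      by (rule sobolev_W1_gradient_Lp[OF open_domain u])
  qed
  ultimately show ?thesis by (simp add: neumann_energy_def)
qed

text \<open>
  The functional \<open>f\<close> is linear, so only the gradient term contributes to the convexity deficit.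
\<close>

lemma neumann_energy_midpoint:
  assumes f: "f \<in> sobolev_dual \<Omega> p" and u: "u \<in> sobolev_W1 \<Omega> p" and v: "v \<in> sobolev_W1 \<Omega> p"
  shows "1 / p * (LINT x|lebesgue_on \<Omega>. midpoint_defect p (weak_gradient \<Omega> u x) (weak_gradient \<Omega> v x)) =
    (neumann_energy \<Omega> p f u + neumann_energy \<Omega> p f v) / 2
    - neumann_energy \<Omega> p f (\<lambda>x. 1 / 2 * u x + 1 / 2 * v x)"
proof -
  let ?U = "weak_gradient \<Omega> u" and ?V = "weak_gradient \<Omega> v"
  let ?M = "\<lambda>x. (1 / 2) *\<^sub>R ?U x + (1 / 2) *\<^sub>R ?V x"
  have U: "Lp_fun (lebesgue_on \<Omega>) p ?U" and V: "Lp_fun (lebesgue_on \<Omega>) p ?V"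
    using sobolev_W1_gradient_Lp[OF open_domain] u v by auto
  have M: "Lp_fun (lebesgue_on \<Omega>) p ?M"
    using p by (intro Lp_fun_linear_combination U V) auto
  have I: "(LINT x|lebesgue_on \<Omega>. norm (weak_gradient \<Omega> (\<lambda>x. 1 / 2 * u x + 1 / 2 * v x) x) powr p) =
     (LINT x|lebesgue_on \<Omega>. norm (?M x) powr p)"
    by (rule gradient_integral_AE_cong[OF W1_combine[OF u v] M])
  have "(LINT x|lebesgue_on \<Omega>. midpoint_defect p (?U x) (?V x)) =
     ((LINT x|lebesgue_on \<Omega>. norm (?U x) powr p) + (LINT x|lebesgue_on \<Omega>. norm (?V x) powr p)) / 2
     - (LINT x|lebesgue_on \<Omega>. norm (?M x) powr p)"
    unfolding midpoint_defect_def using U V M by (simp add: Lp_fun_def)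
  note D = this
  show ?thesis
    unfolding neumann_energy_def I D sobolev_dual_linear_combination[OF f u v]
    by (simp add: diff_divide_distrib add_divide_distrib right_diff_distrib distrib_left)
qed

lemma trace_in_L_D:
  assumes "trace_in_L \<Omega> p r u"
  shows "has_trace \<Omega> p u (sobolev_trace \<Omega> p u)" "Lp_fun (surface_measure \<Omega>) r (sobolev_trace \<Omega> p u)"
    "u \<in> sobolev_W1 \<Omega> p"
  using assms by (auto simp: trace_in_L_def has_trace_def)

text \<open>
  Adding a constant leaves the energy unchanged because of the compatibility condition, and a suitable
  constant makes a function admissible. Hence the constrained infimum bounds the energy of every
  function with trace in \<open>L\<^sup>q\<close> from below.
\<close>

lemma E_neumann_le_energy:
  assumes f: "f \<in> sobolev_dual \<Omega> p" "f (\<lambda>x. 1) = 0" and q: "1 < q" and u: "trace_in_L \<Omega> p q u"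
  shows "E_neumann \<Omega> p q f \<le> ereal (neumann_energy \<Omega> p f u)"
proof -
  define g where "g = sobolev_trace \<Omega> p u"
  note T = trace_in_L_D[OF u, folded g_def]
  have g: "Lp_fun (surface_measure \<Omega>) (q - 1) g"
    using q by (intro surface.Lp_fun_antimono[OF T(2)]) auto
  obtain c where c: "(LINT x|surface_measure \<Omega>. odd_power q (g x - c)) = 0"
    using surface.ex_shift_odd_power_integral_zero[OF g q] by blast
  have Tc: "has_trace \<Omega> p (\<lambda>x. u x - c) (\<lambda>x. g x - c)"
    using has_trace_linear_combination[OF T(1) has_trace_const[of c], of 1 "-1"] by simp
  have gc: "Lp_fun (surface_measure \<Omega>) (q - 1) (\<lambda>x. g x - c)"
    using q by (intro surface.Lp_fun_shift g) auto
  have L: "trace_in_L \<Omega> p (q - 1) (\<lambda>x. u x - c)" by (rule trace_in_LI[OF Tc gc])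
  note T' = trace_in_L_D[OF L]
  have "(LINT x|surface_measure \<Omega>. odd_power q (sobolev_trace \<Omega> p (\<lambda>x. u x - c) x))
     = (LINT x|surface_measure \<Omega>. odd_power q (g x - c))"
  proof (rule integral_cong_AE)
    show "AE x in surface_measure \<Omega>. odd_power q (sobolev_trace \<Omega> p (\<lambda>x. u x - c) x)
       = odd_power q (g x - c)"
      using sobolev_trace(2)[OF Tc] by eventually_elim simp
  qed (use surface.integrable_odd_power[OF gc q] surface.integrable_odd_power[OF T'(2) q] in
      \<open>auto intro: borel_measurable_integrable\<close>)
  then have "(\<lambda>x. u x - c) \<in> neumann_admissible \<Omega> p q"
    unfolding neumann_admissible_def using L T'(3) c by simp
  then have "E_neumann \<Omega> p q f \<le> ereal (neumann_energy \<Omega> p f (\<lambda>x. u x - c))"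
    unfolding E_neumann_def by (rule INF_lower)
  then show ?thesis using neumann_energy_shift[OF f T(3)] by simp
qed

lemma abs_trace_integrable:
  assumes "Lp_fun (surface_measure \<Omega>) q g" "1 < q"
  shows "integrable (surface_measure \<Omega>) (\<lambda>x. \<bar>g x :: real\<bar>)"
  using surface.Lp_fun_antimono[OF assms(1), of 1] assms(2) by (simp add: Lp_fun_def)

text \<open>
  Lower semicontinuity along minimising sequences of the energy. By uniform convexity the gradients
  converge in \<open>L\<^sup>p\<close>, so that the traces converge to the trace of the minimizer up to constants. Bounded
  boundary integrals keep the constants bounded, and Fatou's lemma bounds
  \<open>\<integral>|u\<^sub>0 + c|\<^sup>q\<close> for some limit \<open>c\<close>. The constraint says that \<open>c = 0\<close> minimises this convex function of \<open>c\<close>.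
\<close>

lemma boundary_integral_lower_semicontinuous:
  assumes conn: "connected \<Omega>" and q: "1 < q"
    and f: "f \<in> sobolev_dual \<Omega> p" "f (\<lambda>x. 1) = 0"
    and min: "neumann_minimizer \<Omega> p q f u0" and u0: "trace_in_L \<Omega> p q u0"
    and u: "\<And>n. trace_in_L \<Omega> p q (u n)"
    and lim: "(\<lambda>n. neumann_energy \<Omega> p f (u n)) \<longlonglongrightarrow> neumann_energy \<Omega> p f u0"
    and B: "\<And>n. (LINT x|surface_measure \<Omega>. \<bar>sobolev_trace \<Omega> p (u n) x\<bar> powr q) \<le> B"
  shows "(LINT x|surface_measure \<Omega>. \<bar>sobolev_trace \<Omega> p u0 x\<bar> powr q) \<le> B"
proof -
  let ?S = "surface_measure \<Omega>" and ?J = "neumann_energy \<Omega> p f"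
  let ?D = "\<lambda>n. LINT x|lebesgue_on \<Omega>. midpoint_defect p (weak_gradient \<Omega> (u n) x) (weak_gradient \<Omega> u0 x)"
  define g where "g n = sobolev_trace \<Omega> p (u n)" for n
  define g0 where "g0 = sobolev_trace \<Omega> p u0"
  note T = trace_in_L_D[OF u, folded g_def]
  note T0 = trace_in_L_D[OF u0, folded g0_def]
  have B0: "0 \<le> B" using B[of 0] by (rule order_trans[rotated]) (auto intro!: integral_nonneg_AE)
  have "?D \<longlonglongrightarrow> 0"
  proof (rule tendsto_sandwich[OF _ _ tendsto_const])
    show "eventually (\<lambda>n. 0 \<le> ?D n) sequentially"
      using midpoint_defect_nonneg[OF p] by (intro always_eventually allI integral_nonneg_AE AE_I2)
    show "eventually (\<lambda>n. ?D n \<le> p / 2 * (?J (u n) - ?J u0)) sequentially"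
    proof (intro always_eventually allI)
      fix n
      have mid: "trace_in_L \<Omega> p q (\<lambda>x. 1 / 2 * u n x + 1 / 2 * u0 x)"
      proof (rule trace_in_LI[OF has_trace_linear_combination[OF T(1) T0(1)]])
        show "Lp_fun ?S q (\<lambda>x. 1 / 2 * g n x + 1 / 2 * g0 x)"
          using Lp_fun_linear_combination[OF T(2) T0(2), where a = "1 / 2" and b = "1 / 2"] q by simp
      qed
      have "?J u0 \<le> ?J (\<lambda>x. 1 / 2 * u n x + 1 / 2 * u0 x)"
        using E_neumann_le_energy[OF f q mid] min by (simp add: neumann_minimizer_def flip: ereal_less_eq(3))
      then have "1 / p * ?D n \<le> (?J (u n) + ?J u0) / 2 - ?J u0"
        unfolding neumann_energy_midpoint[OF f(1) T(3) T0(3)] by linarith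
      then show "?D n \<le> p / 2 * (?J (u n) - ?J u0)"
        using p by (simp add: field_simps)
    qed
    have "(\<lambda>n. p / 2 * (?J (u n) - ?J u0)) \<longlonglongrightarrow> p / 2 * (?J u0 - ?J u0)"
      by (intro tendsto_intros lim)
    then show "(\<lambda>n. p / 2 * (?J (u n) - ?J u0)) \<longlonglongrightarrow> 0" by simp
  qed
  then have null: "Lp_null (lebesgue_on \<Omega>) p (\<lambda>n x. weak_gradient \<Omega> (u n) x - weak_gradient \<Omega> u0 x)"
    by (intro Lp_null_if_midpoint_defect_null p sobolev_W1_gradient_Lp open_domain T T0)
  have Tw: "has_trace \<Omega> p (\<lambda>x. u n x - u0 x) (\<lambda>x. g n x - g0 x)" for n
    using has_trace_linear_combination[OF T(1)[of n] T0(1), of 1 "-1"] by simp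
  have null': "Lp_null (lebesgue_on \<Omega>) p (\<lambda>n. weak_gradient \<Omega> (\<lambda>x. u n x - u0 x))"
  proof (rule Lp_null_AE_cong[OF null])
    show "weak_gradient \<Omega> (\<lambda>x. u n x - u0 x) \<in> borel_measurable (lebesgue_on \<Omega>)" for n
      using sobolev_W1_gradient_Lp[OF open_domain W1_diff(1)[OF T(3) T0(3)]] by (simp add: Lp_fun_def)
    show "AE x in lebesgue_on \<Omega>. weak_gradient \<Omega> (\<lambda>x. u n x - u0 x) x = weak_gradient \<Omega> (u n) x - weak_gradient \<Omega> u0 x" for n
      by (rule W1_diff(2)[OF T(3) T0(3)])
  qed
  obtain c where c: "(\<lambda>n. \<integral>\<^sup>+y. ennreal \<bar>g n y - g0 y - c n\<bar> \<partial>?S) \<longlonglongrightarrow> 0"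
    using traces_approach_constants[OF conn Tw null'] by blast
  define h where "h n y = g n y - g0 y - c n" for n y
  have Lh: "Lp_fun ?S q (h n)" for n
    unfolding h_def using q by (intro surface.Lp_fun_shift Lp_fun_diff T T0) auto
  have ih: "integrable ?S (h n)" for n
    using abs_trace_integrable[OF Lh[of n] q] Lh[of n] by (simp add: integrable_abs_iff Lp_fun_def)
  have ig: "integrable ?S (\<lambda>x. \<bar>g n x\<bar>)" and ig0: "integrable ?S (\<lambda>x. \<bar>g0 x\<bar>)" for n
    using abs_trace_integrable T(2) T0(2) q by auto
  have iq: "integrable ?S (\<lambda>x. \<bar>g n x\<bar> powr q)" and iq0: "integrable ?S (\<lambda>x. \<bar>g0 x\<bar> powr q)" for n
    using T(2) T0(2) by (auto simp: Lp_fun_def)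
  have h0: "(\<lambda>n. LINT y|?S. norm (h n y)) \<longlonglongrightarrow> 0"
  proof -
    have "(\<integral>\<^sup>+y. ennreal \<bar>g n y - g0 y - c n\<bar> \<partial>?S) = ennreal (LINT y|?S. norm (h n y))" for n
      using integrable_norm[OF ih[of n]] by (subst nn_integral_eq_integral[symmetric]) (auto simp: h_def)
    then have "(\<lambda>n. ennreal (LINT y|?S. norm (h n y))) \<longlonglongrightarrow> ennreal 0" using c by simp
    then show ?thesis by (subst (asm) tendsto_ennreal_iff) (auto intro!: always_eventually integral_nonneg_AE)
  qed
  define \<mu> where "\<mu> = measure ?S (space ?S)"
  show ?thesis
  proof (cases "\<mu> = 0")
    case True
    then have "emeasure ?S (space ?S) = 0" by (simp add: surface.emeasure_eq_measure \<mu>_def)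
    then have "space ?S \<in> null_sets ?S" by auto
    then have "AE x in ?S. \<bar>g0 x\<bar> powr q = 0"
      by (rule AE_I') auto
    then have "(LINT x|?S. \<bar>g0 x\<bar> powr q) = 0" by (rule integral_eq_zero_AE)
    then show ?thesis using B0 by (simp add: g0_def)
  next
    case False
    then have \<mu>: "0 < \<mu>" by (simp add: \<mu>_def less_le)
    obtain X where X: "\<And>n. (LINT y|?S. norm (h n y)) \<le> X"
      using convergent_imp_bounded[OF h0] by (auto simp: bounded_iff abs_le_iff)
    \<comment> \<open>The constants are bounded: \<open>|c n| \<le> |h n| + |g n| + |g0|\<close>, and \<open>|t| \<le> 1 + |t|\<^sup>q\<close> controls \<open>g n\<close>.\<close>
    have "\<bar>c n\<bar> \<le> (X + (\<mu> + B) + (LINT y|?S. \<bar>g0 y\<bar>)) / \<mu>" for n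
    proof -
      have "\<bar>c n\<bar> * \<mu> = (LINT y|?S. \<bar>c n\<bar>)" by (simp add: \<mu>_def)
      also have "\<dots> \<le> (LINT y|?S. norm (h n y) + (1 + \<bar>g n y\<bar> powr q) + \<bar>g0 y\<bar>)"
      proof (rule integral_mono)
        fix y
        have "\<bar>g n y\<bar> \<le> 1 + \<bar>g n y\<bar> powr q"
        proof (cases "\<bar>g n y\<bar> \<le> 1")
          case True
          then show ?thesis by (simp add: add_increasing2)
        next
          case False
          then have "\<bar>g n y\<bar> powr 1 \<le> \<bar>g n y\<bar> powr q" using q by (intro powr_mono) auto
          then show ?thesis using False by simp
        qed
        then show "\<bar>c n\<bar> \<le> norm (h n y) + (1 + \<bar>g n y\<bar> powr q) + \<bar>g0 y\<bar>"
          unfolding h_def real_norm_def by linarith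
      qed (use ih iq ig0 in auto)
      also have "\<dots> = (LINT y|?S. norm (h n y)) + (\<mu> + (LINT y|?S. \<bar>g n y\<bar> powr q)) + (LINT y|?S. \<bar>g0 y\<bar>)"
        using ih[of n] iq[of n] ig0 by (simp add: \<mu>_def)
      also have "\<dots> \<le> X + (\<mu> + B) + (LINT y|?S. \<bar>g0 y\<bar>)"
        using X[of n] B[of n] by (simp add: g_def)
      finally show ?thesis using \<mu> by (simp add: pos_le_divide_eq)
    qed
    then have "bounded (range c)"
      by (intro boundedI[of _ "(X + (\<mu> + B) + (LINT y|?S. \<bar>g0 y\<bar>)) / \<mu>"]) auto
    then obtain c' \<sigma> where \<sigma>: "strict_mono \<sigma>" "(c \<circ> \<sigma>) \<longlonglongrightarrow> c'"
      using bounded_imp_convergent_subsequence by blast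
    have "(\<lambda>n. LINT y|?S. norm (h (\<sigma> n) y)) \<longlonglongrightarrow> 0"
      using LIMSEQ_subseq_LIMSEQ[OF h0 \<sigma>(1)] by (simp add: comp_def)
    from tendsto_L1_AE_subseq[OF ih this] obtain \<rho> where \<rho>: "strict_mono \<rho>"
      "AE y in ?S. (\<lambda>n. h (\<sigma> (\<rho> n)) y) \<longlonglongrightarrow> 0" by blast
    have c': "(\<lambda>n. c (\<sigma> (\<rho> n))) \<longlonglongrightarrow> c'"
      using LIMSEQ_subseq_LIMSEQ[OF \<sigma>(2) \<rho>(1)] by (simp add: comp_def)
    have lim_g: "AE y in ?S. (\<lambda>n. \<bar>g (\<sigma> (\<rho> n)) y\<bar> powr q) \<longlonglongrightarrow> \<bar>g0 y + c'\<bar> powr q"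
      using \<rho>(2)
    proof eventually_elim
      case (elim y)
      have "(\<lambda>n. h (\<sigma> (\<rho> n)) y + g0 y + c (\<sigma> (\<rho> n))) \<longlonglongrightarrow> 0 + g0 y + c'"
        by (intro tendsto_add elim c' tendsto_const)
      then have "(\<lambda>n. g (\<sigma> (\<rho> n)) y) \<longlonglongrightarrow> g0 y + c'" by (simp add: h_def)
      then show ?case using q by (intro tendsto_powr2 tendsto_rabs tendsto_const) auto
    qed
    have gm: "g n \<in> borel_measurable ?S" "g0 \<in> borel_measurable ?S" for n
      using T(2) T0(2) by (auto simp: Lp_fun_def)
    have igc: "integrable ?S (\<lambda>y. \<bar>g0 y + c'\<bar> powr q)"
      using surface.Lp_fun_shift[OF T0(2), of "- c'"] q by (simp add: Lp_fun_def)
    have "ennreal (LINT y|?S. \<bar>g0 y + c'\<bar> powr q) = (\<integral>\<^sup>+y. ennreal (\<bar>g0 y + c'\<bar> powr q) \<partial>?S)"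
      using igc by (intro nn_integral_eq_integral[symmetric]) auto
    also have "\<dots> = (\<integral>\<^sup>+y. liminf (\<lambda>n. ennreal (\<bar>g (\<sigma> (\<rho> n)) y\<bar> powr q)) \<partial>?S)"
    proof (rule nn_integral_cong_AE)
      show "AE y in ?S. ennreal (\<bar>g0 y + c'\<bar> powr q) = liminf (\<lambda>n. ennreal (\<bar>g (\<sigma> (\<rho> n)) y\<bar> powr q))"
        using lim_g
      proof eventually_elim
        case (elim y)
        show ?case
          by (rule lim_imp_Liminf[symmetric, OF sequentially_bot tendsto_ennrealI[OF elim]])
      qed
    qed
    also have "\<dots> \<le> liminf (\<lambda>n. \<integral>\<^sup>+y. ennreal (\<bar>g (\<sigma> (\<rho> n)) y\<bar> powr q) \<partial>?S)"
      using gm by (intro nn_integral_liminf) measurable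
    also have "\<dots> \<le> ennreal B"
    proof (rule Liminf_le)
      show "eventually (\<lambda>n. (\<integral>\<^sup>+y. ennreal (\<bar>g (\<sigma> (\<rho> n)) y\<bar> powr q) \<partial>?S) \<le> ennreal B) sequentially"
      proof (intro always_eventually allI)
        fix n
        have "(\<integral>\<^sup>+y. ennreal (\<bar>g (\<sigma> (\<rho> n)) y\<bar> powr q) \<partial>?S) = ennreal (LINT y|?S. \<bar>g (\<sigma> (\<rho> n)) y\<bar> powr q)"
          using iq by (intro nn_integral_eq_integral) auto
        also have "\<dots> \<le> ennreal B" using B[of "\<sigma> (\<rho> n)"] by (intro ennreal_leI) (simp add: g_def)
        finally show "(\<integral>\<^sup>+y. ennreal (\<bar>g (\<sigma> (\<rho> n)) y\<bar> powr q) \<partial>?S) \<le> ennreal B" .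
      qed
    qed simp
    finally have upper: "(LINT y|?S. \<bar>g0 y + c'\<bar> powr q) \<le> B"
      using B0 by (simp add: ennreal_le_iff)
    have Lq: "Lp_fun ?S (q - 1) g0" using q by (intro surface.Lp_fun_antimono[OF T0(2)]) auto
    have zero: "(LINT y|?S. odd_power q (g0 y)) = 0"
      using min by (simp add: neumann_minimizer_def neumann_admissible_def g0_def)
    have io: "integrable ?S (\<lambda>y. odd_power q (g0 y))"
      by (rule surface.integrable_odd_power[OF Lq q])
    have "(LINT y|?S. \<bar>g0 y\<bar> powr q + (q * c') * (odd_power q (g0 y))) \<le> (LINT y|?S. \<bar>g0 y + c'\<bar> powr q)"
    proof (rule integral_mono)
      show "integrable ?S (\<lambda>y. \<bar>g0 y\<bar> powr q + (q * c') * (odd_power q (g0 y)))"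
        by (intro Bochner_Integration.integrable_add integrable_mult_right iq0 io)
      show "\<bar>g0 y\<bar> powr q + (q * c') * (odd_power q (g0 y)) \<le> \<bar>g0 y + c'\<bar> powr q" for y
        using abs_powr_convex[OF q, of "g0 y" "g0 y + c'"] by (simp add: mult_ac)
    qed (rule igc)
    moreover have "(LINT y|?S. \<bar>g0 y\<bar> powr q + (q * c') * (odd_power q (g0 y))) = (LINT y|?S. \<bar>g0 y\<bar> powr q)"
      using iq0 io by (simp add: zero del: mult_eq_0_iff)
    ultimately show ?thesis using upper unfolding g0_def by linarith
  qed
qed

end

text \<open>
  The remainder \<open>r\<close> is nonpositive, as \<open>u\<^sub>0\<close> competes in the Robin problem. If it were below \<open>- \<epsilon> \<alpha>\<close> for
  arbitrarily small \<open>\<alpha>\<close>, almost optimal functions for the Robin problem would minimise the Neumann energy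
  in the limit while their boundary integrals stay a fixed amount below that of \<open>u\<^sub>0\<close>.
\<close>

theorem theorem4p1:
  fixes \<Omega> :: "'a::euclidean_space set" and p q :: real
    and f :: "('a \<Rightarrow> real) \<Rightarrow> real" and u\<^sub>0 :: "'a \<Rightarrow> real"
  assumes "open \<Omega>" and "bounded \<Omega>" and "connected \<Omega>" and "lipschitz_boundary \<Omega>"
    and "p > 1" and "q > 1"
    and "f \<in> sobolev_dual \<Omega> p" and "f (\<lambda>x. 1) = 0"
    and "neumann_minimizer \<Omega> p q f u\<^sub>0"
    and "trace_in_L \<Omega> p q u\<^sub>0"
  shows "\<exists>r :: real \<Rightarrow> real. r \<in> o[at_right 0](\<lambda>\<alpha>. \<alpha>) \<and>
    (\<forall>\<alpha> > 0. E_robin \<Omega> p q f \<alpha> =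
       E_neumann \<Omega> p q f
       + ereal (\<alpha> / q * (LINT x|surface_measure \<Omega>. \<bar>sobolev_trace \<Omega> p u\<^sub>0 x\<bar> powr q))
       + ereal (r \<alpha>))"
proof -
  interpret lipschitz_domain \<Omega> p using assms by unfold_locales
  let ?J = "neumann_energy \<Omega> p f"
  define b where "b u = (LINT x|surface_measure \<Omega>. \<bar>sobolev_trace \<Omega> p u x\<bar> powr q)" for u
  define m where "m = ?J u\<^sub>0"
  have En: "E_neumann \<Omega> p q f = ereal m"
    using assms(9) by (simp add: neumann_minimizer_def m_def)
  have q: "0 < q" using assms(6) by simp
  have b_nonneg: "0 \<le> b u" for u unfolding b_def by (intro integral_nonneg_AE) auto
  have energy_ge: "m \<le> ?J u" if "trace_in_L \<Omega> p q u" for u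
    using E_neumann_le_energy[OF assms(7,8,6) that] En by simp
  have upper: "E_robin \<Omega> p q f \<alpha> \<le> ereal (m + \<alpha> / q * b u\<^sub>0)" for \<alpha>
  proof -
    have "E_robin \<Omega> p q f \<alpha> \<le> ereal (?J u\<^sub>0) + ereal (\<alpha> / q) * boundary_integral \<Omega> p q u\<^sub>0"
      unfolding E_robin_def by (rule INF_lower) (rule trace_in_L_D(3)[OF assms(10)])
    then show ?thesis using assms(10) by (simp add: boundary_integral_def b_def m_def)
  qed
  have lower: "ereal m \<le> E_robin \<Omega> p q f \<alpha>" if \<alpha>: "0 < \<alpha>" for \<alpha>
    unfolding E_robin_def
  proof (rule INF_greatest)
    fix u
    show "ereal m \<le> ereal (?J u) + ereal (\<alpha> / q) * boundary_integral \<Omega> p q u"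
    proof (cases "trace_in_L \<Omega> p q u")
      case True
      then have "m \<le> ?J u + \<alpha> / q * b u"
        using energy_ge[OF True] b_nonneg[of u] \<alpha> q by (simp add: add_increasing2)
      then show ?thesis using True by (simp add: boundary_integral_def b_def)
    next
      case False
      then show ?thesis using \<alpha> q by (simp add: boundary_integral_def)
    qed
  qed
  define r where "r \<alpha> = real_of_ereal (E_robin \<Omega> p q f \<alpha>) - m - \<alpha> / q * b u\<^sub>0" for \<alpha>
  have Er: "E_robin \<Omega> p q f \<alpha> = ereal (m + \<alpha> / q * b u\<^sub>0 + r \<alpha>)" if pos: "0 < \<alpha>" for \<alpha>
  proof -
    obtain x where "E_robin \<Omega> p q f \<alpha> = ereal x"
      using upper[of \<alpha>] lower[OF pos] by (cases "E_robin \<Omega> p q f \<alpha>") auto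
    then show ?thesis by (simp add: r_def)
  qed
  have r_le: "r \<alpha> \<le> 0" if "0 < \<alpha>" for \<alpha>
    using upper[of \<alpha>] unfolding Er[OF that] by simp
  have "eventually (\<lambda>\<alpha>. - \<epsilon> * \<alpha> \<le> r \<alpha>) (at_right 0)" if \<epsilon>: "0 < \<epsilon>" for \<epsilon>
  proof (rule ccontr)
    assume "\<not> eventually (\<lambda>\<alpha>. - \<epsilon> * \<alpha> \<le> r \<alpha>) (at_right 0)"
    then have "\<forall>d>0. \<exists>\<alpha>. 0 < \<alpha> \<and> \<alpha> < d \<and> r \<alpha> < - \<epsilon> * \<alpha>"
      unfolding eventually_at_right_field by (auto simp: not_le)
    then have "\<forall>n. \<exists>\<alpha>. 0 < \<alpha> \<and> \<alpha> < inverse (real (Suc n)) \<and> r \<alpha> < - \<epsilon> * \<alpha>"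
      by (metis inverse_positive_iff_positive of_nat_0_less_iff zero_less_Suc)
    then obtain \<alpha> where \<alpha>: "\<And>n. 0 < \<alpha> n" "\<And>n. \<alpha> n < inverse (real (Suc n))" "\<And>n. r (\<alpha> n) < - \<epsilon> * \<alpha> n"
      by metis
    have \<alpha>0: "\<alpha> \<longlonglongrightarrow> 0"
      by (rule tendsto_sandwich[OF _ _ tendsto_const LIMSEQ_inverse_real_of_nat])
         (intro always_eventually allI less_imp_le \<alpha>)+
    have "\<exists>u. trace_in_L \<Omega> p q u \<and> ?J u + \<alpha> n / q * b u < m + \<alpha> n / q * b u\<^sub>0 - \<epsilon> * \<alpha> n" for n
    proof -
      have "E_robin \<Omega> p q f (\<alpha> n) < ereal (m + \<alpha> n / q * b u\<^sub>0 - \<epsilon> * \<alpha> n)"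
        unfolding Er[OF \<alpha>(1)] using \<alpha>(3)[of n] by simp
      then obtain u where u: "ereal (?J u) + ereal (\<alpha> n / q) * boundary_integral \<Omega> p q u
          < ereal (m + \<alpha> n / q * b u\<^sub>0 - \<epsilon> * \<alpha> n)"
        unfolding E_robin_def INF_less_iff by blast
      have "trace_in_L \<Omega> p q u"
        using u \<alpha>(1)[of n] q by (auto simp: boundary_integral_def split: if_splits)
      then show ?thesis using u by (intro exI[of _ u]) (simp add: boundary_integral_def b_def)
    qed
    then obtain u where u: "\<And>n. trace_in_L \<Omega> p q (u n)"
      "\<And>n. ?J (u n) + \<alpha> n / q * b (u n) < m + \<alpha> n / q * b u\<^sub>0 - \<epsilon> * \<alpha> n" by metis
    have bu: "b (u n) \<le> b u\<^sub>0 - q * \<epsilon>" for n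
    proof -
      have "\<alpha> n / q * b (u n) < \<alpha> n / q * b u\<^sub>0 - \<epsilon> * \<alpha> n"
        using u(2)[of n] energy_ge[OF u(1)[of n]] by linarith
      also have "\<dots> = \<alpha> n / q * (b u\<^sub>0 - q * \<epsilon>)" using q by (simp add: field_simps)
      finally have lt: "\<alpha> n / q * b (u n) < \<alpha> n / q * (b u\<^sub>0 - q * \<epsilon>)" .
      have "0 \<le> \<alpha> n / q" using less_imp_le[OF \<alpha>(1)[of n]] less_imp_le[OF q] by (rule divide_nonneg_nonneg)
      then show ?thesis by (rule less_imp_le[OF mult_left_less_imp_less[OF lt]])
    qed
    have "(\<lambda>n. ?J (u n)) \<longlonglongrightarrow> m"
    proof (rule tendsto_sandwich[OF _ _ tendsto_const])
      show "eventually (\<lambda>n. m \<le> ?J (u n)) sequentially"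
        by (intro always_eventually allI energy_ge u(1))
      show "eventually (\<lambda>n. ?J (u n) \<le> m + \<alpha> n / q * b u\<^sub>0) sequentially"
      proof (intro always_eventually allI)
        fix n
        have "0 \<le> \<alpha> n / q * b (u n)" "0 \<le> \<epsilon> * \<alpha> n"
          using \<alpha>(1)[of n] q b_nonneg[of "u n"] \<epsilon> by auto
        then show "?J (u n) \<le> m + \<alpha> n / q * b u\<^sub>0" using u(2)[of n] by linarith
      qed
      have "(\<lambda>n. m + \<alpha> n / q * b u\<^sub>0) \<longlonglongrightarrow> m + 0 / q * b u\<^sub>0"
        using q by (intro tendsto_intros \<alpha>0) auto
      then show "(\<lambda>n. m + \<alpha> n / q * b u\<^sub>0) \<longlonglongrightarrow> m" by simp
    qed
    then have "b u\<^sub>0 \<le> b u\<^sub>0 - q * \<epsilon>"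
      using boundary_integral_lower_semicontinuous[OF assms(3,6,7,8,9,10) u(1), where B = "b u\<^sub>0 - q * \<epsilon>"] bu
      by (simp add: b_def m_def)
    then show False using mult_pos_pos[OF q \<epsilon>] by linarith
  qed
  then have "r \<in> o[at_right 0](\<lambda>\<alpha>. \<alpha>)"
  proof (intro landau_o.smallI)
    fix c :: real assume "0 < c"
    assume *: "\<And>\<epsilon>. 0 < \<epsilon> \<Longrightarrow> eventually (\<lambda>\<alpha>. - \<epsilon> * \<alpha> \<le> r \<alpha>) (at_right 0)"
    show "eventually (\<lambda>\<alpha>. norm (r \<alpha>) \<le> c * norm \<alpha>) (at_right 0)"
      using *[OF \<open>0 < c\<close>] eventually_at_right_less[of "0::real"]
      by eventually_elim (use r_le in force)
  qed
  then show ?thesis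
    using Er En by (intro exI[of _ r]) (simp add: b_def)
qed

end
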